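(* $\mathrm{DAGR}(\mathsf{PSPACE})=\mathsf{PSPACE}$ and $\mathrm{DAGR}(\mathsf{NP})=\mathsf{NP}$.
   Context: For a language $L\subseteq\Sigma^*$, $\mathrm{DAGREACH}(L)$ is the set of triples $(G,s,t)$ where $G$ is a directed acyclic graph with edges labelled by symbols of $\Sigma$ and $s,t$ are vertices, such that some path from $s$ to $t$ has yield (concatenation of edge labels in order) in $L$. For a complexity class $\mathcal{C}$, $\mathrm{DAGR}(\mathcal{C})=\{L : \mathrm{DAGREACH}(L)\in\mathcal{C}\}$. *)

theory Defs
  imports
    "Graph_Theory.Arc_Walk"
    "HOL-Computational_Algebra.Polynomial"
begin

section \<open>Languages\<close>

text \<open>
  Symbols are natural numbers. A language comes with the finite alphabet \<open>\<Sigma>\<close> over which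
  it is considered, as the pair \<open>(\<Sigma>, L)\<close> with \<open>L \<subseteq> \<Sigma>\<^sup>*\<close>; a complexity class is a set of
  such pairs, so one class contains languages over all finite alphabets.
\<close>

type_synonym language = "nat set \<times> nat list set"

definition is_language :: "language \<Rightarrow> bool" where
  "is_language = (\<lambda>(\<Sigma>, L). finite \<Sigma> \<and> L \<subseteq> lists \<Sigma>)"


section \<open>Multi-tape Turing machines\<close>

datatype symbol = Blank | LeftEnd | Sym nat

datatype move = GoLeft | Stay | GoRight

text \<open>
  A transition \<open>(q, rs, q', as)\<close> applies in state \<open>q\<close> when the heads read the symbols \<open>rs\<close>;
  it enters state \<open>q'\<close>, and the \<open>i\<close>-th entry of \<open>as\<close> gives the symbol written to tape \<open>i\<close>
  and the move of head \<open>i\<close>. The transition relation is finite (see \<open>machine\<close> below), which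
  makes the sets of states and of tape symbols in use finite.
\<close>

type_synonym transition = "nat \<times> symbol list \<times> nat \<times> (symbol \<times> move) list"

record tm =
  ntapes :: nat
  start_state :: nat
  accept_state :: nat
  delta :: "transition set"

definition machine :: "tm \<Rightarrow> bool" where
  "machine M \<longleftrightarrow> ntapes M \<ge> 1 \<and> finite (delta M) \<and>
     (\<forall>(q, rs, q', as) \<in> delta M.
        q \<noteq> accept_state M \<and> length rs = ntapes M \<and> length as = ntapes M)"

definition deterministic :: "tm \<Rightarrow> bool" where
  "deterministic M \<longleftrightarrow>
     (\<forall>q rs q1 as1 q2 as2. (q, rs, q1, as1) \<in> delta M \<and> (q, rs, q2, as2) \<in> delta M
        \<longrightarrow> q1 = q2 \<and> as1 = as2)"

text \<open>
  Tapes are infinite to the right only; a tape is given by its contents and its head position.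
  A head in cell 0 that is told to move left stays there.
\<close>

type_synonym tape = "(nat \<Rightarrow> symbol) \<times> nat"
type_synonym config = "nat \<times> tape list"

fun read :: "tape \<Rightarrow> symbol" where
  "read (f, i) = f i"

fun move_head :: "move \<Rightarrow> nat \<Rightarrow> nat" where
  "move_head GoLeft i = i - 1"
| "move_head Stay i = i"
| "move_head GoRight i = i + 1"

fun act :: "symbol \<times> move \<Rightarrow> tape \<Rightarrow> tape" where
  "act (a, m) (f, i) = (f(i := a), move_head m i)"

definition step :: "tm \<Rightarrow> config \<Rightarrow> config \<Rightarrow> bool" where
  "step M c c' \<longleftrightarrow>
     (\<exists>(q, rs, q', as) \<in> delta M.
        fst c = q \<and> map read (snd c) = rs \<and> c' = (q', map2 act as (snd c)))"

text \<open>
  Cell 0 of every tape initially carries the left-end marker, after which the first tape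
  holds the input.
\<close>

definition init_tape :: "nat list \<Rightarrow> tape" where
  "init_tape x =
     ((\<lambda>i. if i = 0 then LeftEnd else if i \<le> length x then Sym (x ! (i - 1)) else Blank), 0)"

definition init_config :: "tm \<Rightarrow> nat list \<Rightarrow> config" where
  "init_config M x = (start_state M, init_tape x # replicate (ntapes M - 1) (init_tape []))"

definition reaches :: "tm \<Rightarrow> nat list \<Rightarrow> config \<Rightarrow> bool" where
  "reaches M x c \<longleftrightarrow> (step M)\<^sup>*\<^sup>* (init_config M x) c"

definition accepts :: "tm \<Rightarrow> nat list \<Rightarrow> bool" where
  "accepts M x \<longleftrightarrow> (\<exists>c. reaches M x c \<and> fst c = accept_state M)"

definition halts :: "tm \<Rightarrow> nat list \<Rightarrow> bool" where
  "halts M x \<longleftrightarrow> (\<exists>c. reaches M x c \<and> (\<nexists>c'. step M c c'))"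

text \<open>Every computation path, accepting or not, has at most \<open>T\<close> steps.\<close>

definition time_bounded :: "tm \<Rightarrow> nat list \<Rightarrow> nat \<Rightarrow> bool" where
  "time_bounded M x T \<longleftrightarrow> (\<forall>n c. (step M ^^ n) (init_config M x) c \<longrightarrow> n \<le> T)"

text \<open>
  Only the first \<open>S\<close> cells of each tape are ever scanned. The input tape is counted like the
  others, which makes no difference for polynomial bounds.
\<close>

definition space_bounded :: "tm \<Rightarrow> nat list \<Rightarrow> nat \<Rightarrow> bool" where
  "space_bounded M x S \<longleftrightarrow> (\<forall>c. reaches M x c \<longrightarrow> (\<forall>(f, i) \<in> set (snd c). i < S))"


section \<open>The classes NP and PSPACE\<close>

definition NP :: "language set" where
  "NP = {(\<Sigma>, L). is_language (\<Sigma>, L) \<and>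
     (\<exists>M (p :: nat poly). machine M \<and>
        (\<forall>x \<in> lists \<Sigma>. time_bounded M x (poly p (length x)) \<and> (accepts M x \<longleftrightarrow> x \<in> L)))}"

definition PSPACE :: "language set" where
  "PSPACE = {(\<Sigma>, L). is_language (\<Sigma>, L) \<and>
     (\<exists>M (p :: nat poly). machine M \<and> deterministic M \<and>
        (\<forall>x \<in> lists \<Sigma>. halts M x \<and> space_bounded M x (poly p (length x)) \<and>
           (accepts M x \<longleftrightarrow> x \<in> L)))}"


section \<open>Reachability in labelled DAGs\<close>

text \<open>
  An arc is a triple \<open>(u, a, v)\<close>: it leads from \<open>u\<close> to \<open>v\<close> and is labelled \<open>a\<close>. Arcs between the
  same two vertices with different labels are allowed.
\<close>

type_synonym ldigraph = "(nat, nat \<times> nat \<times> nat) pre_digraph"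

definition ldigraph :: "nat set \<Rightarrow> (nat \<times> nat \<times> nat) set \<Rightarrow> ldigraph" where
  "ldigraph V E = \<lparr>verts = V, arcs = E, tail = (\<lambda>(u, a, v). u), head = (\<lambda>(u, a, v). v)\<rparr>"

definition yield :: "(nat \<times> nat \<times> nat) list \<Rightarrow> nat list" where
  "yield = map (\<lambda>(u, a, v). a)"

definition dag_reach :: "language \<Rightarrow> (ldigraph \<times> nat \<times> nat) set" where
  "dag_reach = (\<lambda>(\<Sigma>, L). {(ldigraph V E, s, t) | V E s t.
     finite V \<and> E \<subseteq> V \<times> \<Sigma> \<times> V \<and> (\<nexists>p. pre_digraph.cycle (ldigraph V E) p) \<and>
     s \<in> V \<and> t \<in> V \<and>
     (\<exists>p. pre_digraph.apath (ldigraph V E) s p t \<and> yield p \<in> L)})"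

text \<open>
  Graphs are presented to machines on the vertex set \<open>{0, \<dots>, n - 1}\<close>, by an adjacency list
  containing the arcs in an arbitrary order. Symbol 0 is a separator, symbol 1 the digit of
  unary numbers, and \<open>a + 2\<close> stands for the label \<open>a\<close>. Since the vertices are numbered
  below \<open>n\<close>, writing them in unary keeps the length of the encoding polynomial in the size
  of the graph.
\<close>

definition unary :: "nat \<Rightarrow> nat list" where
  "unary k = replicate k 1"

definition encode_arc :: "nat \<times> nat \<times> nat \<Rightarrow> nat list" where
  "encode_arc = (\<lambda>(u, a, v). unary u @ [a + 2] @ unary v @ [0])"

definition encode :: "nat \<Rightarrow> (nat \<times> nat \<times> nat) list \<Rightarrow> nat \<Rightarrow> nat \<Rightarrow> nat list" where
  "encode n es s t =
     unary n @ [0] @ unary s @ [0] @ unary t @ [0] @ concat (map encode_arc es)"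

definition DAGREACH :: "language \<Rightarrow> language" where
  "DAGREACH = (\<lambda>(\<Sigma>, L).
     ({0, 1} \<union> (\<lambda>a. a + 2) ` \<Sigma>,
      {encode n es s t | n es s t. (ldigraph {..<n} (set es), s, t) \<in> dag_reach (\<Sigma>, L)}))"

definition DAGR :: "language set \<Rightarrow> language set" where
  "DAGR C = {(\<Sigma>, L). is_language (\<Sigma>, L) \<and> DAGREACH (\<Sigma>, L) \<in> C}"


section \<open>Basic properties of the encoding\<close>

lemma unary_append_eq:
  assumes "unary m @ a # xs = unary n @ b # ys" "a \<noteq> 1" "b \<noteq> 1"
  shows "m = n \<and> a = b \<and> xs = ys"
  using assms
proof (induction m arbitrary: n)
  case 0
  then show ?case by (cases n) (auto simp: unary_def)
next
  case (Suc m)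
  then show ?case by (cases n) (auto simp: unary_def)
qed

lemma encode_arcs_inj:
  "concat (map encode_arc es) = concat (map encode_arc es') \<Longrightarrow> es = es'"
proof (induction es arbitrary: es')
  case Nil
  then show ?case by (cases es') (auto simp: encode_arc_def)
next
  case (Cons e es)
  obtain u a v where e: "e = (u, a, v)" by (cases e)
  from Cons.prems obtain e' fs where es': "es' = e' # fs"
    by (cases es') (auto simp: encode_arc_def e)
  obtain u' a' v' where e': "e' = (u', a', v')" by (cases e')
  have "unary u @ (a + 2) # unary v @ 0 # concat (map encode_arc es) =
      unary u' @ (a' + 2) # unary v' @ 0 # concat (map encode_arc fs)"
    using Cons.prems by (simp add: encode_arc_def e e' es')
  from unary_append_eq[OF this] have *: "u = u'" "a = a'" and
    r: "unary v @ 0 # concat (map encode_arc es) = unary v' @ 0 # concat (map encode_arc fs)"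
    by auto
  from unary_append_eq[OF r] have "v = v'"
    and "concat (map encode_arc es) = concat (map encode_arc fs)" by auto
  with * Cons.IH show ?case by (simp add: e e' es')
qed

lemma encode_inj:
  assumes "encode n es s t = encode n' es' s' t'"
  shows "n = n' \<and> es = es' \<and> s = s' \<and> t = t'"
proof -
  have 1: "unary n @ 0 # unary s @ 0 # unary t @ 0 # concat (map encode_arc es) =
      unary n' @ 0 # unary s' @ 0 # unary t' @ 0 # concat (map encode_arc es')"
    using assms by (simp add: encode_def)
  from unary_append_eq[OF 1] have n: "n = n'" and
    2: "unary s @ 0 # unary t @ 0 # concat (map encode_arc es) =
      unary s' @ 0 # unary t' @ 0 # concat (map encode_arc es')" by auto
  from unary_append_eq[OF 2] have s: "s = s'" and
    3: "unary t @ 0 # concat (map encode_arc es) = unary t' @ 0 # concat (map encode_arc es')"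
    by auto
  from unary_append_eq[OF 3] n s encode_arcs_inj show ?thesis by auto
qed

lemma dag_reach_iff:
  "(ldigraph V E, s, t) \<in> dag_reach (\<Sigma>, L) \<longleftrightarrow>
     finite V \<and> E \<subseteq> V \<times> \<Sigma> \<times> V \<and> (\<nexists>p. pre_digraph.cycle (ldigraph V E) p) \<and>
     s \<in> V \<and> t \<in> V \<and>
     (\<exists>p. pre_digraph.apath (ldigraph V E) s p t \<and> yield p \<in> L)"
proof -
  have "ldigraph V E = ldigraph V' E' \<longleftrightarrow> V = V' \<and> E = E'" for V' E'
    by (auto simp: ldigraph_def)
  then show ?thesis by (auto simp: dag_reach_def)
qed

lemma is_language_DAGREACH:
  assumes "is_language (\<Sigma>, L)"
  shows "is_language (DAGREACH (\<Sigma>, L))"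
proof -
  have *: "encode n es s t \<in> lists ({0, 1} \<union> (\<lambda>a. a + 2) ` \<Sigma>)"
    if "set es \<subseteq> {..<n} \<times> \<Sigma> \<times> {..<n}" for n es s t
    using that by (force simp: encode_def encode_arc_def unary_def in_lists_conv_set)
  have "{encode n es s t | n es s t. (ldigraph {..<n} (set es), s, t) \<in> dag_reach (\<Sigma>, L)}
      \<subseteq> lists ({0, 1} \<union> (\<lambda>a. a + 2) ` \<Sigma>)"
    unfolding dag_reach_iff using * by blast
  moreover have "finite ({0, 1} \<union> (\<lambda>a. a + 2) ` \<Sigma>)"
    using assms by (simp add: is_language_def)
  ultimately show ?thesis
    by (simp only: is_language_def DAGREACH_def prod.case simp_thms)
qed

end

theory Submission
  imports Defs
begin

text \<open>
  A word \<open>x\<close> lies in \<open>L\<close> iff the path labelled with \<open>x\<close> is a yes-instance, which gives \<open>\<subseteq>\<close> by closure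
  under polynomial-time reductions. For \<open>\<supseteq>\<close>, annotate each letter of an encoded instance with two bits.
  The first bits list vertices in such an order that every arc \<open>(u, a, v)\<close> has \<open>u\<close> listed and \<open>v\<close> not
  listed before \<open>u\<close>, which certifies acyclicity; they fit because a vertex is listed only if it is the
  tail of an arc, whose encoding is as long. The second bits mark the arcs of a path from \<open>s\<close> to \<open>t\<close>.
  A polynomial-time transducer checks the annotation and outputs the yield, so \<open>DAGREACH(L)\<close> is a
  letter-to-letter projection of a language reducible to \<open>L\<close>. Both classes are closed under such
  projections: NP guesses the annotation, PSPACE counts through all of them.
\<close>

section \<open>Deterministic runs and running times in transition systems\<close>

text \<open>A many-one reduction alone would fail when \<open>L\<close> contains all words, since
  malformed or cyclic instances then have no no-instance to be mapped to; hence
  \<open>computes\<close> lets the transducer reject by itself. Projections are letter-to-letter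
  because an NP guess and a PSPACE counter then get the length of the input for free; the price is
  that the whole certificate has to fit into bits attached to the instance. Certifying acyclicity
  also spares the deterministic computation of a topological order: each arc costs one scan of the
  list. Since \<open>DAGR_eq\<close> takes only the two closure properties as hypotheses, both
  classes are treated at once. What remains is machine construction. Programs of a small language
  are compiled to machines. For NP their running times suffice, over all computation paths. For
  PSPACE the search through the annotations takes exponential time, so its space bound is carried as
  an invariant of every configuration, and the work tapes are wiped between two attempts.\<close>

definition stuck :: "('c \<Rightarrow> 'c \<Rightarrow> bool) \<Rightarrow> 'c \<Rightarrow> bool" where
  "stuck R c \<longleftrightarrow> (\<nexists>c'. R c c')"

text \<open>A forced run: each configuration on it has only one successor, although \<open>R\<close>
  may branch elsewhere. Keeping \<open>P\<close> on all configurations lets the same derivation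
  serve for acceptance, for time and for space.\<close>

inductive dsteps :: "('c \<Rightarrow> 'c \<Rightarrow> bool) \<Rightarrow> ('c \<Rightarrow> bool) \<Rightarrow> 'c \<Rightarrow> nat \<Rightarrow> 'c \<Rightarrow> bool" for R P where
  dsteps_0: "P c \<Longrightarrow> dsteps R P c 0 c"
| dsteps_Suc: "P c \<Longrightarrow> R c c1 \<Longrightarrow> (\<And>c2. R c c2 \<Longrightarrow> c2 = c1) \<Longrightarrow> dsteps R P c1 t c'
    \<Longrightarrow> dsteps R P c (Suc t) c'"

lemma dsteps_trans:
  assumes "dsteps R P c t c'" "dsteps R P c' t' c''"
  shows "dsteps R P c (t + t') c''"
  using assms
proof (induction rule: dsteps.induct)
  case (dsteps_Suc c c1 t c')
  have "dsteps R P c (Suc (t + t')) c''"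
    by (rule dsteps.dsteps_Suc[of P c R c1]) (use dsteps_Suc in blast)+
  then show ?case by simp
qed simp

lemma dsteps_mono:
  assumes "dsteps R P c t c'" "\<And>c. P c \<Longrightarrow> Q c"
  shows "dsteps R Q c t c'"
  using assms(1)
proof (induction rule: dsteps.induct)
  case (dsteps_0 c)
  then show ?case by (intro dsteps.dsteps_0 assms(2))
next
  case (dsteps_Suc c c1 t c')
  show ?case
    by (rule dsteps.dsteps_Suc[of Q c R c1]) (use dsteps_Suc assms(2) in blast)+
qed

lemma dsteps_imp_rtranclp:
  assumes "dsteps R P c t c'"
  shows "R\<^sup>*\<^sup>* c c'"
  using assms
proof (induction rule: dsteps.induct)
  case (dsteps_Suc c c1 t c')
  show ?case by (rule converse_rtranclp_into_rtranclp[of R c c1, OF dsteps_Suc.hyps(2) dsteps_Suc.IH])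
qed simp

text \<open>A stuck configuration cannot lie strictly inside a forced run, so whatever leads to it
  from \<open>c\<close> passes through \<open>c'\<close>. Acceptance may therefore be decided after
  any deterministic prefix.\<close>

lemma dsteps_reach_stuck:
  assumes "dsteps R P c t c'" "stuck R e"
  shows "R\<^sup>*\<^sup>* c e \<longleftrightarrow> R\<^sup>*\<^sup>* c' e"
  using assms
proof (induction rule: dsteps.induct)
  case (dsteps_Suc c c1 t c')
  have "R\<^sup>*\<^sup>* c e \<longleftrightarrow> R\<^sup>*\<^sup>* c1 e"
  proof
    assume "R\<^sup>*\<^sup>* c e"
    then show "R\<^sup>*\<^sup>* c1 e"
    proof (cases rule: converse_rtranclpE)
      case base
      then show ?thesis using dsteps_Suc.hyps(2) dsteps_Suc.prems by (auto simp: stuck_def)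
    next
      case (step y)
      then show ?thesis using dsteps_Suc.hyps(3) by blast
    qed
  qed (rule converse_rtranclp_into_rtranclp[of R c c1, OF dsteps_Suc.hyps(2)])
  then show ?case using dsteps_Suc.IH dsteps_Suc.prems by blast
qed simp

lemma dsteps_reach_invar:
  assumes "dsteps R P c t c'" "R\<^sup>*\<^sup>* c e" "\<And>e. R\<^sup>*\<^sup>* c' e \<Longrightarrow> P e"
  shows "P e"
  using assms
proof (induction rule: dsteps.induct)
  case (dsteps_Suc c c1 t c')
  from dsteps_Suc.prems(1) show ?case
  proof (cases rule: converse_rtranclpE)
    case base
    then show ?thesis using dsteps_Suc.hyps(1) by simp
  next
    case (step y)
    then have "R\<^sup>*\<^sup>* c1 e" using dsteps_Suc.hyps(3) by blast
    then show ?thesis using dsteps_Suc.prems(2) by (rule dsteps_Suc.IH)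
  qed
qed simp

section \<open>Time bounds over all computation paths\<close>

definition bounded_steps :: "('c \<Rightarrow> 'c \<Rightarrow> bool) \<Rightarrow> 'c \<Rightarrow> nat \<Rightarrow> bool" where
  "bounded_steps R c T \<longleftrightarrow> (\<forall>n c'. (R ^^ n) c c' \<longrightarrow> n \<le> T)"

lemma bounded_steps_mono: "bounded_steps R c T \<Longrightarrow> T \<le> T' \<Longrightarrow> bounded_steps R c T'"
  by (force simp: bounded_steps_def)

lemma bounded_steps_Suc:
  assumes "\<And>c'. R c c' \<Longrightarrow> bounded_steps R c' T"
  shows "bounded_steps R c (Suc T)"
  unfolding bounded_steps_def
proof (intro allI impI)
  fix n c' assume "(R ^^ n) c c'"
  then show "n \<le> Suc T"
  proof (cases n)
    case (Suc m)
    with \<open>(R ^^ n) c c'\<close> obtain d where "R c d" "(R ^^ m) d c'"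
      by (metis relpowp_Suc_D2)
    with assms Suc show ?thesis by (auto simp: bounded_steps_def)
  qed simp
qed

lemma bounded_steps_stuck: "stuck R c \<Longrightarrow> bounded_steps R c 0"
  unfolding bounded_steps_def stuck_def
  by (metis le_zero_eq not0_implies_Suc relpowp_Suc_D2)

lemma bounded_steps_dsteps:
  assumes "dsteps R P c t c'" "bounded_steps R c' T"
  shows "bounded_steps R c (t + T)"
  using assms
proof (induction rule: dsteps.induct)
  case (dsteps_Suc c c1 t c')
  have "bounded_steps R c (Suc (t + T))"
    by (rule bounded_steps_Suc) (use dsteps_Suc in blast)
  then show ?case by simp
qed simp

lemma bounded_steps_step:
  assumes "bounded_steps R c T" "R c c'"
  shows "0 < T \<and> bounded_steps R c' (T - 1)"
proof -
  have *: "(R ^^ n) c' d \<Longrightarrow> Suc n \<le> T" for n d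
    using assms(1) relpowp_Suc_I2[of R c c', OF assms(2)] unfolding bounded_steps_def by blast
  from *[of 0] have "0 < T" by auto
  moreover have "bounded_steps R c' (T - 1)"
    unfolding bounded_steps_def
  proof (intro allI impI)
    fix n d assume "(R ^^ n) c' d"
    from *[OF this] show "n \<le> T - 1" by simp
  qed
  ultimately show ?thesis ..
qed

section \<open>Tapes\<close>

definition tape_at :: "symbol list \<Rightarrow> nat \<Rightarrow> tape" where
  "tape_at xs p = ((\<lambda>i. if i < length xs then xs ! i else Blank), p)"

text \<open>\<open>l\<close> holds the cells left of the head, nearest first, and \<open>r\<close>
  those from the head on, so moves become list operations. Trailing blanks are not unique:
  \<open>zip_tape l []\<close> and \<open>zip_tape l [Blank]\<close> are the same tape.\<close>

definition zip_tape :: "symbol list \<Rightarrow> symbol list \<Rightarrow> tape" where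
  "zip_tape l r = tape_at (rev l @ r) (length l)"

lemma read_tape_at: "read (tape_at xs p) = (if p < length xs then xs ! p else Blank)"
  by (simp add: tape_at_def)

lemma act_tape_at_keep: "act (read (tape_at xs p), m) (tape_at xs p) = tape_at xs (move_head m p)"
  by (auto simp: tape_at_def fun_eq_iff)

lemma act_read_Stay [simp]: "act (read t, Stay) t = t"
  by (cases t) auto

lemma read_zip_tape [simp]:
  "read (zip_tape l []) = Blank" "read (zip_tape l (a # r)) = a"
  by (auto simp: zip_tape_def tape_at_def nth_append)

lemma act_zip_tape [simp]:
  "act (b, Stay) (zip_tape l []) = zip_tape l [b]"
  "act (b, Stay) (zip_tape l (a # r)) = zip_tape l (b # r)"
  "act (b, GoRight) (zip_tape l []) = zip_tape (b # l) []"
  "act (b, GoRight) (zip_tape l (a # r)) = zip_tape (b # l) r"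
  "act (b, GoLeft) (zip_tape (c # l) []) = zip_tape l [c, b]"
  "act (b, GoLeft) (zip_tape (c # l) (a # r)) = zip_tape l (c # b # r)"
  by (auto simp: zip_tape_def tape_at_def nth_append fun_eq_iff nth_Cons split: nat.splits)

lemma init_tape_eq: "init_tape x = zip_tape [] (LeftEnd # map Sym x)"
  by (auto simp: init_tape_def zip_tape_def tape_at_def fun_eq_iff nth_Cons split: nat.splits)

section \<open>A programming language for multi-tape machines\<close>

text \<open>
  \<open>Sim M d e fl off q\<close> runs \<open>M\<close> from state \<open>q\<close> on the tapes from number \<open>off\<close> on, where a symbol
  \<open>s\<close> on these tapes stands for the symbol \<open>d s\<close> of \<open>M\<close>, and \<open>e r s\<close> is what has to be written over
  \<open>r\<close> when \<open>M\<close> writes \<open>s\<close>. When \<open>M\<close> halts, tape \<open>fl\<close> records whether \<open>M\<close> has accepted.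
\<close>

datatype com =
    Skip
  | Fail
  | Put nat "symbol list \<Rightarrow> symbol" move
  | Choose nat "(symbol list \<Rightarrow> symbol) set" move
  | Seq com com (infixr \<open>;;\<close> 60)
  | Cond "symbol list \<Rightarrow> bool" com com
  | While "symbol list \<Rightarrow> bool" com
  | Sim tm "symbol \<Rightarrow> symbol" "symbol \<Rightarrow> symbol \<Rightarrow> symbol" nat nat nat

definition stay :: "symbol list \<Rightarrow> (symbol \<times> move) list" where
  "stay rs = map (\<lambda>s. (s, Stay)) rs"

definition sim_act ::
  "(symbol \<Rightarrow> symbol \<Rightarrow> symbol) \<Rightarrow> symbol list \<Rightarrow> (symbol \<times> move) list \<Rightarrow> (symbol \<times> move) list" where
  "sim_act e rs as = map2 (\<lambda>r a. (e r (fst a), snd a)) rs as"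

text \<open>Dropping a finished \<open>Skip\<close> from a sequence is a step of its own, the source
  of the \<open>+ 1\<close> in running times. \<open>Fail\<close> has no step and differs from
  \<open>Skip\<close>, so it is a rejecting halt. A simulation that can no longer move spends one
  step on recording its verdict.\<close>

fun sstep :: "com \<Rightarrow> symbol list \<Rightarrow> (com \<times> (symbol \<times> move) list) set" where
  "sstep Skip rs = {}"
| "sstep Fail rs = {}"
| "sstep (Put i g m) rs = {(Skip, (stay rs)[i := (g rs, m)])}"
| "sstep (Choose i G m) rs = (\<lambda>g. (Skip, (stay rs)[i := (g rs, m)])) ` G"
| "sstep (Seq a b) rs =
     (if a = Skip then {(b, stay rs)} else (\<lambda>(a', as). (Seq a' b, as)) ` sstep a rs)"
| "sstep (Cond b c d) rs = {(if b rs then c else d, stay rs)}"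
| "sstep (While b c) rs = {(if b rs then Seq c (While b c) else Skip, stay rs)}"
| "sstep (Sim M d e fl off q) rs =
     (if \<exists>q' as. (q, map d (drop off rs), q', as) \<in> delta M
      then {(Sim M d e fl off q', stay (take off rs) @ sim_act e (drop off rs) as) | q' as.
              (q, map d (drop off rs), q', as) \<in> delta M}
      else {(Skip, (stay rs)[fl := (if q = accept_state M then Sym 1 else Sym 0, Stay)])})"

definition cstep :: "com \<times> tape list \<Rightarrow> com \<times> tape list \<Rightarrow> bool" where
  "cstep c c' \<longleftrightarrow> (\<exists>as. (fst c', as) \<in> sstep (fst c) (map read (snd c)) \<and> snd c' = map2 act as (snd c))"

lemma length_stay [simp]: "length (stay rs) = length rs"
  by (simp add: stay_def)

lemma map2_act_stay [simp]: "map2 act (stay (map read \<sigma>)) \<sigma> = \<sigma>"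
  by (induction \<sigma>) (auto simp: stay_def)

lemma map2_list_update:
  "length xs = length ys \<Longrightarrow> map2 f (xs[i := a]) ys = (map2 f xs ys)[i := f a (ys ! i)]"
  by (cases "i < length ys") (auto intro!: nth_equalityI simp: nth_list_update)

lemma map2_act_update [simp]:
  "map2 act ((stay (map read \<sigma>))[i := a]) \<sigma> = \<sigma>[i := act a (\<sigma> ! i)]"
  by (simp add: map2_list_update)

lemma cstep_Skip [simp]: "\<not> cstep (Skip, \<sigma>) c"
  and cstep_Fail [simp]: "\<not> cstep (Fail, \<sigma>) c"
  by (auto simp: cstep_def)

lemma cstep_Put [simp]:
  "cstep (Put i g m, \<sigma>) c \<longleftrightarrow> c = (Skip, \<sigma>[i := act (g (map read \<sigma>), m) (\<sigma> ! i)])"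
  by (cases c) (auto simp: cstep_def)

lemma cstep_Choose [simp]:
  "cstep (Choose i G m, \<sigma>) c \<longleftrightarrow> (\<exists>g\<in>G. c = (Skip, \<sigma>[i := act (g (map read \<sigma>), m) (\<sigma> ! i)]))"
  by (cases c) (auto simp: cstep_def)

lemma cstep_Seq_Skip [simp]: "cstep (Skip ;; b, \<sigma>) c \<longleftrightarrow> c = (b, \<sigma>)"
  by (cases c) (auto simp: cstep_def)

lemma cstep_Seq:
  "a \<noteq> Skip \<Longrightarrow> cstep (a ;; b, \<sigma>) c \<longleftrightarrow> (\<exists>a' \<sigma>'. cstep (a, \<sigma>) (a', \<sigma>') \<and> c = (a' ;; b, \<sigma>'))"
  by (cases c) (auto simp: cstep_def image_iff split: prod.splits)

lemma cstep_Cond [simp]: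
  "cstep (Cond b c d, \<sigma>) c' \<longleftrightarrow> c' = (if b (map read \<sigma>) then c else d, \<sigma>)"
  by (cases c') (auto simp: cstep_def)

lemma cstep_While [simp]:
  "cstep (While b c, \<sigma>) c' \<longleftrightarrow> c' = (if b (map read \<sigma>) then c ;; While b c else Skip, \<sigma>)"
  by (cases c') (auto simp: cstep_def)

lemma stuck_Skip [simp]: "stuck cstep (Skip, \<sigma>)"
  by (simp add: stuck_def)

lemma stuck_Fail [simp]: "stuck cstep (Fail, \<sigma>)"
  by (simp add: stuck_def)

lemma dsteps_1: "P c \<Longrightarrow> P c' \<Longrightarrow> (\<And>e. R c e \<longleftrightarrow> e = c') \<Longrightarrow> dsteps R P c 1 c'"
  unfolding One_nat_def by (rule dsteps_Suc[of P c R c']) (simp_all add: dsteps_0)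

subsection \<open>Big-step semantics of the deterministic commands\<close>

text \<open>Times are exact, which makes time and result functions of the start
  (\<open>exec_det\<close>) and thus usable in equations. \<open>Choose\<close> and
  \<open>Sim\<close> have no rules; they are treated on configurations.\<close>

inductive exec :: "com \<Rightarrow> tape list \<Rightarrow> nat \<Rightarrow> tape list option \<Rightarrow> bool" where
  exec_Skip: "exec Skip \<sigma> 0 (Some \<sigma>)"
| exec_Fail: "exec Fail \<sigma> 0 None"
| exec_Put: "exec (Put i g m) \<sigma> 1 (Some (\<sigma>[i := act (g (map read \<sigma>), m) (\<sigma> ! i)]))"
| exec_Seq_None: "exec a \<sigma> t None \<Longrightarrow> exec (a ;; b) \<sigma> t None"
| exec_Seq_Some: "exec a \<sigma> t (Some \<sigma>') \<Longrightarrow> exec b \<sigma>' t' r \<Longrightarrow> exec (a ;; b) \<sigma> (t + 1 + t') r"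
| exec_Cond: "exec (if b (map read \<sigma>) then c else d) \<sigma> t r \<Longrightarrow> exec (Cond b c d) \<sigma> (t + 1) r"
| exec_While: "exec (if b (map read \<sigma>) then c ;; While b c else Skip) \<sigma> t r
    \<Longrightarrow> exec (While b c) \<sigma> (t + 1) r"

inductive_cases exec_SkipE: "exec Skip \<sigma> t r"
inductive_cases exec_FailE: "exec Fail \<sigma> t r"
inductive_cases exec_PutE: "exec (Put i g m) \<sigma> t r"
inductive_cases exec_SeqE: "exec (a ;; b) \<sigma> t r"
inductive_cases exec_CondE: "exec (Cond b c d) \<sigma> t r"
inductive_cases exec_WhileE: "exec (While b c) \<sigma> t r"

lemma exec_det: "exec c \<sigma> t r \<Longrightarrow> exec c \<sigma> t' r' \<Longrightarrow> t = t' \<and> r = r'"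
proof (induction arbitrary: t' r' rule: exec.induct)
  case (exec_Seq_None a \<sigma> t b)
  from exec_Seq_None.prems show ?case
    by (cases rule: exec_SeqE) (auto dest: exec_Seq_None.IH)
next
  case (exec_Seq_Some a \<sigma> t \<sigma>' b u r)
  from exec_Seq_Some.prems show ?case
    by (cases rule: exec_SeqE) (auto dest!: exec_Seq_Some.IH)
next
  case (exec_Cond b \<sigma> c d t r)
  from exec_Cond.prems show ?case
    by (cases rule: exec_CondE) (auto dest!: exec_Cond.IH)
next
  case (exec_While b \<sigma> c t r)
  from exec_While.prems show ?case
    by (cases rule: exec_WhileE) (auto dest!: exec_While.IH)
next
  case (exec_Skip \<sigma>)
  then show ?case by (cases rule: exec_SkipE) auto
next
  case (exec_Fail \<sigma>)
  then show ?case by (cases rule: exec_FailE) auto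
next
  case (exec_Put i g m \<sigma>)
  then show ?case by (cases rule: exec_PutE) auto
qed

text \<open>
  The continuation \<open>Q\<close> receives the running time and the final tapes, or \<open>None\<close> after \<open>Fail\<close>. In
  this form commands without loops are executed symbolically by rewriting.
\<close>

definition wp :: "com \<Rightarrow> tape list \<Rightarrow> (nat \<Rightarrow> tape list option \<Rightarrow> bool) \<Rightarrow> bool" where
  "wp c \<sigma> Q \<longleftrightarrow> (\<exists>t r. exec c \<sigma> t r \<and> Q t r)"

text \<open>The congruence leaves out \<open>Q\<close>, so the simplifier does not touch the
  continuation before the command in front of it has been executed.\<close>

lemma wp_cong [cong]: "c = c' \<Longrightarrow> \<sigma> = \<sigma>' \<Longrightarrow> wp c \<sigma> Q = wp c' \<sigma>' Q"
  by simp

text \<open>By determinism a proved run becomes an equation; results about loops enter later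
  symbolic executions in this form.\<close>

lemma exec_wp: "exec c \<sigma> t r \<Longrightarrow> wp c \<sigma> Q = Q t r"
  unfolding wp_def using exec_det by blast

lemma wp_exec: "wp c \<sigma> (\<lambda>t' r'. t' = t \<and> r' = r) \<longleftrightarrow> exec c \<sigma> t r"
  by (simp add: wp_def)

lemma wp_Skip [simp]: "wp Skip \<sigma> Q = Q 0 (Some \<sigma>)"
  by (rule exec_wp[OF exec_Skip])

lemma wp_Fail [simp]: "wp Fail \<sigma> Q = Q 0 None"
  by (rule exec_wp[OF exec_Fail])

lemma wp_Put [simp]:
  "wp (Put i g m) \<sigma> Q = Q 1 (Some (\<sigma>[i := act (g (map read \<sigma>), m) (\<sigma> ! i)]))"
  by (rule exec_wp[OF exec_Put])

inductive_simps exec_Seq_iff: "exec (a ;; b) \<sigma> t r"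
inductive_simps exec_Cond_iff: "exec (Cond b c d) \<sigma> t r"
inductive_simps exec_While_iff: "exec (While b c) \<sigma> t r"

lemma wp_Seq [simp]:
  "wp (a ;; b) \<sigma> Q = wp a \<sigma> (\<lambda>t r. case r of None \<Rightarrow> Q t None
     | Some \<sigma>' \<Rightarrow> wp b \<sigma>' (\<lambda>t' r'. Q (t + 1 + t') r'))" (is "?L = ?R")
proof -
  have "?R \<longleftrightarrow> (\<exists>t. exec a \<sigma> t None \<and> Q t None) \<or>
      (\<exists>t \<sigma>'. exec a \<sigma> t (Some \<sigma>') \<and> (\<exists>t' r'. exec b \<sigma>' t' r' \<and> Q (t + 1 + t') r'))"
    unfolding wp_def by (subst ex_comm) (auto simp: split_option_ex)
  moreover have e: "exec (a ;; b) \<sigma> t r \<longleftrightarrow> exec a \<sigma> t None \<and> r = None \<or>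
      (\<exists>t1 \<sigma>' t2. t = t1 + 1 + t2 \<and> exec a \<sigma> t1 (Some \<sigma>') \<and> exec b \<sigma>' t2 r)" for t r
    by (auto simp: exec_Seq_iff)
  have "?L \<longleftrightarrow> (\<exists>t r. (exec a \<sigma> t None \<and> r = None \<or>
      (\<exists>t1 \<sigma>' t2. t = t1 + 1 + t2 \<and> exec a \<sigma> t1 (Some \<sigma>') \<and> exec b \<sigma>' t2 r)) \<and> Q t r)"
    unfolding wp_def e by (rule refl)
  then have "?L \<longleftrightarrow> (\<exists>t. exec a \<sigma> t None \<and> Q t None) \<or>
      (\<exists>t \<sigma>'. exec a \<sigma> t (Some \<sigma>') \<and> (\<exists>t' r'. exec b \<sigma>' t' r' \<and> Q (t + 1 + t') r'))"
    by blast
  ultimately show ?thesis by blast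
qed

lemma wp_Cond [simp]:
  "wp (Cond b c d) \<sigma> Q =
     (if b (map read \<sigma>) then wp c \<sigma> (\<lambda>t. Q (t + 1)) else wp d \<sigma> (\<lambda>t. Q (t + 1)))"
  unfolding wp_def exec_Cond_iff by auto

text \<open>Kept out of the simplifier, where it would unroll loops forever; it is applied once per
  round by hand.\<close>

lemma wp_While:
  "wp (While b c) \<sigma> Q =
     (if b (map read \<sigma>) then wp (c ;; While b c) \<sigma> (\<lambda>t. Q (t + 1)) else Q 1 (Some \<sigma>))"
proof -
  have "wp (While b c) \<sigma> Q =
     wp (if b (map read \<sigma>) then c ;; While b c else Skip) \<sigma> (\<lambda>t. Q (t + 1))"
    unfolding wp_def exec_While_iff by auto
  then show ?thesis by (simp del: wp_Seq)
qed

text \<open>As long as the first component is not \<open>Skip\<close>, the steps of a sequence are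
  exactly the steps of that component, so uniqueness of successors lifts along with the run.\<close>

lemma dsteps_Seq_context:
  assumes "dsteps cstep P x t y"
    and "x = (a, \<sigma>)" "y = (a', \<sigma>')" "\<And>c \<tau>. P (c, \<tau>) \<Longrightarrow> P' (c ;; b, \<tau>)"
  shows "dsteps cstep P' (a ;; b, \<sigma>) t (a' ;; b, \<sigma>')"
  using assms
proof (induction arbitrary: a \<sigma> rule: dsteps.induct)
  case (dsteps_0 c)
  then have "P' (a ;; b, \<sigma>)" by simp
  then show ?case using dsteps_0 by (auto intro: dsteps.dsteps_0)
next
  case (dsteps_Suc c c1 t c')
  obtain a1 \<sigma>1 where c1: "c1 = (a1, \<sigma>1)" by (cases c1)
  have st: "cstep (a, \<sigma>) (a1, \<sigma>1)" and det: "\<And>c2. cstep (a, \<sigma>) c2 \<Longrightarrow> c2 = (a1, \<sigma>1)"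
    using dsteps_Suc.hyps(2,3) unfolding dsteps_Suc.prems(1) c1 by blast+
  from st have "a \<noteq> Skip" by auto
  show ?case
  proof (rule dsteps.dsteps_Suc)
    show "P' (a ;; b, \<sigma>)" using dsteps_Suc.hyps(1) dsteps_Suc.prems(1,3) by simp
    show "cstep (a ;; b, \<sigma>) (a1 ;; b, \<sigma>1)"
      using st \<open>a \<noteq> Skip\<close> by (auto simp: cstep_Seq)
    show "c2 = (a1 ;; b, \<sigma>1)" if "cstep (a ;; b, \<sigma>) c2" for c2
      using that unfolding cstep_Seq[OF \<open>a \<noteq> Skip\<close>] by (auto dest: det)
    show "dsteps cstep P' (a1 ;; b, \<sigma>1) t (a' ;; b, \<sigma>')"
      by (rule dsteps_Suc.IH[OF c1 dsteps_Suc.prems(2,3)])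
  qed
qed

lemma dsteps_start: "dsteps R P c t c' \<Longrightarrow> P c"
  by (induction rule: dsteps.induct)

lemma dsteps_Seq:
  assumes "dsteps cstep (\<lambda>x. P (snd x)) (a, \<sigma>) t (Skip, \<sigma>')" "dsteps cstep (\<lambda>x. P (snd x)) (b, \<sigma>') t' y"
  shows "dsteps cstep (\<lambda>x. P (snd x)) (a ;; b, \<sigma>) (t + 1 + t') y"
proof -
  have "dsteps cstep (\<lambda>x. P (snd x)) (a ;; b, \<sigma>) t (Skip ;; b, \<sigma>')"
    by (rule dsteps_Seq_context[OF assms(1)]) simp_all
  moreover have "P \<sigma>'" using dsteps_start[OF assms(2)] by simp
  then have "dsteps cstep (\<lambda>x. P (snd x)) (Skip ;; b, \<sigma>') (Suc t') y"
    using assms(2) by (intro dsteps_Suc[where ?c1.0 = "(b, \<sigma>')"]) simp_all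
  ultimately show ?thesis using dsteps_trans by fastforce
qed

text \<open>A failing run stops at \<open>Fail\<close> under the sequences that surround it, hence
  at some stuck program other than \<open>Skip\<close>, not necessarily at \<open>Fail\<close>
  itself.\<close>

lemma exec_dsteps:
  assumes "exec c \<sigma> t r"
  shows "case r of
      Some \<sigma>' \<Rightarrow> dsteps cstep (\<lambda>_. True) (c, \<sigma>) t (Skip, \<sigma>')
    | None \<Rightarrow> \<exists>c' \<sigma>'. dsteps cstep (\<lambda>_. True) (c, \<sigma>) t (c', \<sigma>') \<and> stuck cstep (c', \<sigma>') \<and> c' \<noteq> Skip"
proof -
  let ?D = "dsteps cstep (\<lambda>_. True)"
  let ?O = "\<lambda>c \<sigma> t r. case r of Some \<sigma>' \<Rightarrow> ?D (c, \<sigma>) t (Skip, \<sigma>')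
    | None \<Rightarrow> \<exists>c' \<sigma>'. ?D (c, \<sigma>) t (c', \<sigma>') \<and> stuck cstep (c', \<sigma>') \<and> c' \<noteq> Skip"
  have pre: "?O c \<sigma> (s + t) r" if "?D (c, \<sigma>) s (c', \<sigma>')" "?O c' \<sigma>' t r" for c \<sigma> s c' \<sigma>' t r
    using that dsteps_trans[OF that(1)] by (auto split: option.splits) blast
  show ?thesis using assms
  proof (induction rule: exec.induct)
    case (exec_Put i g m \<sigma>)
    have "?D (Put i g m, \<sigma>) 1 (Skip, \<sigma>[i := act (g (map read \<sigma>), m) (\<sigma> ! i)])"
      by (rule dsteps_1) auto
    then show ?case by simp
  next
    case (exec_Seq_None a \<sigma> t b)
    then obtain c' \<sigma>' where *: "?D (a, \<sigma>) t (c', \<sigma>')" "stuck cstep (c', \<sigma>')" "c' \<noteq> Skip" by auto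
    have "?D (a ;; b, \<sigma>) t (c' ;; b, \<sigma>')" by (rule dsteps_Seq_context[OF *(1)]) simp_all
    moreover have "stuck cstep (c' ;; b, \<sigma>')" using * by (auto simp: stuck_def cstep_Seq)
    ultimately show ?case by auto
  next
    case (exec_Seq_Some a \<sigma> t \<sigma>' b t' r)
    have "?D (a ;; b, \<sigma>) (t + 1 + 0) (b, \<sigma>')"
      by (rule dsteps_Seq[where P = "\<lambda>_. True"]) (use exec_Seq_Some in \<open>auto intro: dsteps_0\<close>)
    from pre[OF this exec_Seq_Some.IH(2)] show ?case unfolding add_0_right .
  next
    case (exec_Cond b \<sigma> c d t r)
    have "?D (Cond b c d, \<sigma>) 1 (if b (map read \<sigma>) then c else d, \<sigma>)"
      by (rule dsteps_1) auto
    from pre[OF this exec_Cond.IH] show ?case unfolding add.commute[of 1] .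
  next
    case (exec_While b \<sigma> c t r)
    have "?D (While b c, \<sigma>) 1 (if b (map read \<sigma>) then c ;; While b c else Skip, \<sigma>)"
      by (rule dsteps_1) auto
    from pre[OF this exec_While.IH] show ?case unfolding add.commute[of 1] .
  next
    case (exec_Fail \<sigma>)
    have "?D (Fail, \<sigma>) 0 (Fail, \<sigma>)" by (rule dsteps_0) simp
    then show ?case by (auto intro!: exI[of _ Fail])
  qed (auto intro: dsteps_0)
qed

section \<open>Bounding space by time\<close>

definition heads_le :: "nat \<Rightarrow> tape list \<Rightarrow> bool" where
  "heads_le B \<sigma> \<longleftrightarrow> (\<forall>\<tau>\<in>set \<sigma>. snd \<tau> \<le> B)"

lemma heads_le_mono: "heads_le B \<sigma> \<Longrightarrow> B \<le> B' \<Longrightarrow> heads_le B' \<sigma>"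
  by (force simp: heads_le_def)

lemma heads_le_map2_act:
  assumes "heads_le B \<sigma>"
  shows "heads_le (Suc B) (map2 act as \<sigma>)"
  unfolding heads_le_def
proof
  fix \<tau> assume "\<tau> \<in> set (map2 act as \<sigma>)"
  then obtain a \<tau>' where *: "\<tau> = act a \<tau>'" "\<tau>' \<in> set \<sigma>"
    by (auto dest: set_zip_rightD)
  obtain s m where "a = (s, m)" by (cases a)
  then show "snd \<tau> \<le> Suc B"
    using * assms by (cases \<tau>'; cases m) (force simp: heads_le_def)+
qed

lemma heads_le_cstep: "heads_le B \<sigma> \<Longrightarrow> cstep (c, \<sigma>) (c', \<sigma>') \<Longrightarrow> heads_le (Suc B) \<sigma>'"
  by (auto simp: cstep_def heads_le_map2_act)

text \<open>A head moves at most one cell per step, so the bound at the start plus the running time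
  bounds all heads. The fixed \<open>S\<close> dominates every intermediate bound and can therefore
  serve as the invariant of the run.\<close>

lemma dsteps_heads_le:
  assumes "dsteps cstep P x t y" "heads_le B (snd x)" "B + t \<le> S"
  shows "dsteps cstep (\<lambda>x. heads_le S (snd x)) x t y \<and> heads_le (B + t) (snd y)"
  using assms
proof (induction arbitrary: B rule: dsteps.induct)
  case (dsteps_0 c)
  then show ?case by (auto intro!: dsteps.dsteps_0 elim: heads_le_mono)
next
  case (dsteps_Suc c c1 t c')
  have 1: "heads_le (Suc B) (snd c1)"
    using dsteps_Suc.prems(1) dsteps_Suc.hyps(2) heads_le_cstep
    by (metis surjective_pairing)
  have 2: "dsteps cstep (\<lambda>x. heads_le S (snd x)) c1 t c' \<and> heads_le (Suc B + t) (snd c')"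
    by (rule dsteps_Suc.IH[OF 1]) (use dsteps_Suc.prems in simp)
  have "heads_le S (snd c)" using dsteps_Suc.prems by (auto intro: heads_le_mono)
  then have "dsteps cstep (\<lambda>x. heads_le S (snd x)) c (Suc t) c'"
    using 2 by (intro dsteps.dsteps_Suc[of _ c cstep c1] dsteps_Suc.hyps(2,3)) simp_all
  then show ?case using 2 by simp
qed

subsection \<open>Compilation to Turing machines\<close>

text \<open>The states of the machine are the remaining programs.\<close>

fun residuals :: "com \<Rightarrow> com set" where
  "residuals Skip = {Skip}"
| "residuals Fail = {Fail, Skip}"
| "residuals (Put i g m) = {Put i g m, Skip}"
| "residuals (Choose i G m) = {Choose i G m, Skip}"
| "residuals (Seq a b) = (\<lambda>a'. Seq a' b) ` residuals a \<union> residuals b"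
| "residuals (Cond b c d) = {Cond b c d} \<union> residuals c \<union> residuals d"
| "residuals (While b c) = {While b c, Skip} \<union> (\<lambda>c'. Seq c' (While b c)) ` residuals c"
| "residuals (Sim M d e fl off q) =
     {Skip} \<union> Sim M d e fl off ` (insert q ((\<lambda>(q, rs, q', as). q') ` delta M))"

text \<open>Closure of the finite alphabet \<open>\<Gamma>\<close> under everything the program may
  write: only then does a finite transition table describe it.\<close>

fun wf_com :: "symbol set \<Rightarrow> nat \<Rightarrow> com \<Rightarrow> bool" where
  "wf_com \<Gamma> k Skip = True"
| "wf_com \<Gamma> k Fail = True"
| "wf_com \<Gamma> k (Put i g m) = (\<forall>rs. length rs = k \<and> set rs \<subseteq> \<Gamma> \<longrightarrow> g rs \<in> \<Gamma>)"
| "wf_com \<Gamma> k (Choose i G m) = (finite G \<and> (\<forall>g\<in>G. \<forall>rs. length rs = k \<and> set rs \<subseteq> \<Gamma> \<longrightarrow> g rs \<in> \<Gamma>))"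
| "wf_com \<Gamma> k (Seq a b) = (wf_com \<Gamma> k a \<and> wf_com \<Gamma> k b)"
| "wf_com \<Gamma> k (Cond b c d) = (wf_com \<Gamma> k c \<and> wf_com \<Gamma> k d)"
| "wf_com \<Gamma> k (While b c) = wf_com \<Gamma> k c"
| "wf_com \<Gamma> k (Sim M d e fl off q) =
     (machine M \<and> off + ntapes M = k \<and> Sym 0 \<in> \<Gamma> \<and> Sym 1 \<in> \<Gamma> \<and>
      (\<forall>(q, rs, q', as) \<in> delta M. \<forall>a\<in>set as. \<forall>r\<in>\<Gamma>. e r (fst a) \<in> \<Gamma>))"

fun det_com :: "com \<Rightarrow> bool" where
  "det_com (Choose i G m) = False"
| "det_com (Seq a b) = (det_com a \<and> det_com b)"
| "det_com (Cond b c d) = (det_com c \<and> det_com d)"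
| "det_com (While b c) = det_com c"
| "det_com (Sim M d e fl off q) = deterministic M"
| "det_com _ = True"

lemma residuals_refl: "c \<in> residuals c"
  by (induction c) auto

text \<open>The accepting state is the code of \<open>Skip\<close>, and the coding is injective on
  the residuals only. This is why \<open>Skip\<close> is a residual even of programs that can never
  finish, such as \<open>Fail\<close>.\<close>

lemma Skip_residuals: "Skip \<in> residuals c"
  by (induction c) auto

lemma residuals_step: "c' \<in> residuals c \<Longrightarrow> (c'', as) \<in> sstep c' rs \<Longrightarrow> c'' \<in> residuals c"
proof (induction c arbitrary: c' c'' as)
  case (Seq a b)
  show ?case
  proof (cases "c' \<in> residuals b")
    case True
    then show ?thesis using Seq.IH(2)[OF True Seq.prems(2)] residuals_refl[of b] by auto
  next
    case False
    then obtain a' where a': "c' = Seq a' b" "a' \<in> residuals a" using Seq.prems by auto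
    show ?thesis
    proof (cases "a' = Skip")
      case True
      then show ?thesis using Seq.prems a' residuals_refl[of b] by auto
    next
      case False
      then obtain a'' where "c'' = Seq a'' b" "(a'', as) \<in> sstep a' rs" using Seq.prems a' by auto
      then show ?thesis using Seq.IH(1)[OF a'(2)] a' False Seq.prems
        by auto
    qed
  qed
next
  case (Cond b c d)
  consider "c' = Cond b c d" | "c' \<in> residuals c" | "c' \<in> residuals d" using Cond.prems by auto
  then show ?case
    by cases (use Cond residuals_refl in \<open>auto split: if_splits\<close>)
next
  case (While b c)
  consider "c' = While b c" | "c' = Skip" | a where "c' = Seq a (While b c)" "a \<in> residuals c"
    using While.prems by auto
  then show ?case
  proof cases
    case 1
    then show ?thesis using While.prems residuals_refl[of c] by (auto split: if_splits)
  next
    case 3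
    then show ?thesis
    proof (cases "a = Skip")
      case False
      then obtain a' where "c'' = Seq a' (While b c)" "(a', as) \<in> sstep a rs" using While.prems 3 by auto
      then show ?thesis using While.IH[OF 3(2)] by auto
    qed (use 3 While.prems in auto)
  qed (use While.prems in auto)
next
  case (Sim M d e fl off q)
  then show ?case by (force split: if_splits)
qed auto

lemma finite_residuals: "wf_com \<Gamma> k c \<Longrightarrow> finite (residuals c)"
  by (induction c) (auto simp: machine_def)

lemma wf_com_residuals: "c' \<in> residuals c \<Longrightarrow> wf_com \<Gamma> k c \<Longrightarrow> wf_com \<Gamma> k c'"
  by (induction c arbitrary: c') auto

lemma det_com_residuals: "c' \<in> residuals c \<Longrightarrow> det_com c \<Longrightarrow> det_com c'"
  by (induction c arbitrary: c') auto

lemma det_com_sstep: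
  "det_com c \<Longrightarrow> x \<in> sstep c rs \<Longrightarrow> y \<in> sstep c rs \<Longrightarrow> x = y"
proof (induction c arbitrary: x y)
  case (Sim M d e fl off q)
  then show ?case by (fastforce simp: deterministic_def split: if_splits)
qed (fastforce split: if_splits)+

lemma finite_sstep: "wf_com \<Gamma> k c \<Longrightarrow> finite (sstep c rs)"
proof (induction c)
  case (Sim M d e fl off q)
  have "{(Sim M d e fl off q', stay (take off rs) @ sim_act e (drop off rs) as) | q' as.
              (q, map d (drop off rs), q', as) \<in> delta M}
    \<subseteq> (\<lambda>(_, _, q', as). (Sim M d e fl off q', stay (take off rs) @ sim_act e (drop off rs) as)) ` delta M"
    by force
  moreover have "finite (delta M)" using Sim by (simp add: machine_def)
  ultimately show ?case by (auto intro: finite_subset)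
qed auto

lemma set_list_update_stay: "set ((stay rs)[i := a]) \<subseteq> insert a ((\<lambda>s. (s, Stay)) ` set rs)"
  using set_update_subset_insert[of "stay rs" i a] by (auto simp: stay_def)

lemma sstep_wf:
  assumes "wf_com \<Gamma> k c" "(c', as) \<in> sstep c rs" "length rs = k" "set rs \<subseteq> \<Gamma>"
  shows "length as = k \<and> fst ` set as \<subseteq> \<Gamma>"
  using assms
proof (induction c arbitrary: c')
  case (Put i g m)
  then have "g rs \<in> \<Gamma>" "as = (stay rs)[i := (g rs, m)]" by auto
  then show ?case using Put.prems set_list_update_stay[of rs i "(g rs, m)"] by fastforce
next
  case (Choose i G m)
  then obtain g where g: "g \<in> G" "as = (stay rs)[i := (g rs, m)]" by auto
  moreover from g have "g rs \<in> \<Gamma>" using Choose.prems by auto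
  ultimately show ?case using Choose.prems set_list_update_stay[of rs i "(g rs, m)"] by fastforce
next
  case (Sim M d e fl off q)
  show ?case
  proof (cases "\<exists>q' as. (q, map d (drop off rs), q', as) \<in> delta M")
    case True
    then obtain q' as' where *: "(q, map d (drop off rs), q', as') \<in> delta M"
      "as = stay (take off rs) @ sim_act e (drop off rs) as'"
      using Sim.prems(2) by (auto split: if_splits)
    have "length as' = ntapes M" using * Sim.prems by (auto simp: machine_def)
    moreover have "fst ` set (sim_act e (drop off rs) as') \<subseteq> \<Gamma>"
    proof -
      have "e r (fst a) \<in> \<Gamma>" if "(r, a) \<in> set (zip (drop off rs) as')" for r a
      proof -
        have "r \<in> set rs" "a \<in> set as'" using that by (auto dest: set_zip_leftD set_zip_rightD in_set_dropD)
        then show ?thesis using * Sim.prems by fastforce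
      qed
      then show ?thesis by (auto simp: sim_act_def)
    qed
    moreover have "fst ` set (stay (take off rs)) \<subseteq> \<Gamma>"
      using Sim.prems(4) by (auto simp: stay_def dest: in_set_takeD)
    ultimately show ?thesis using * Sim.prems by (auto simp: sim_act_def)
  next
    case False
    then have "as = (stay rs)[fl := (if q = accept_state M then Sym 1 else Sym 0, Stay)]"
      using Sim.prems(2) by auto
    moreover have "Sym 0 \<in> \<Gamma>" "Sym 1 \<in> \<Gamma>" using Sim.prems by auto
    ultimately show ?thesis
      using Sim.prems(3,4) set_list_update_stay[of rs fl "(if q = accept_state M then Sym 1 else Sym 0, Stay)"]
      by fastforce
  qed
qed (fastforce simp: stay_def split: if_splits)+

definition tape_over :: "symbol set \<Rightarrow> tape \<Rightarrow> bool" where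
  "tape_over \<Gamma> \<tau> \<longleftrightarrow> range (fst \<tau>) \<subseteq> \<Gamma>"

lemma tape_over_act: "tape_over \<Gamma> \<tau> \<Longrightarrow> fst a \<in> \<Gamma> \<Longrightarrow> tape_over \<Gamma> (act a \<tau>)"
  by (cases \<tau>; cases a) (auto simp: tape_over_def)

lemma tape_over_read: "tape_over \<Gamma> \<tau> \<Longrightarrow> read \<tau> \<in> \<Gamma>"
  by (cases \<tau>) (auto simp: tape_over_def)

text \<open>States are numbers of residual programs, and the table has entries for each residual and
  each word of symbols of \<open>\<Gamma>\<close> under the heads; both sets are finite. The machine
  copies \<open>cstep\<close> step for step, so acceptance, time, space and halting carry
  over.\<close>

lemma compile:
  assumes k: "k \<ge> 1" and \<Gamma>: "finite \<Gamma>" "Blank \<in> \<Gamma>" "LeftEnd \<in> \<Gamma>" and wf: "wf_com \<Gamma> k p"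
  obtains D where "machine D" "ntapes D = k" "det_com p \<Longrightarrow> deterministic D"
    and "\<And>x. Sym ` set x \<subseteq> \<Gamma> \<Longrightarrow>
      accepts D x \<longleftrightarrow> (\<exists>\<sigma>. cstep\<^sup>*\<^sup>* (p, init_tape x # replicate (k - 1) (init_tape [])) (Skip, \<sigma>))"
    and "\<And>x T. Sym ` set x \<subseteq> \<Gamma> \<Longrightarrow>
      bounded_steps cstep (p, init_tape x # replicate (k - 1) (init_tape [])) T \<Longrightarrow> time_bounded D x T"
    and "\<And>x S. Sym ` set x \<subseteq> \<Gamma> \<Longrightarrow>
      (\<And>c \<sigma>. cstep\<^sup>*\<^sup>* (p, init_tape x # replicate (k - 1) (init_tape [])) (c, \<sigma>) \<Longrightarrow> heads_le S \<sigma>) \<Longrightarrow>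
      space_bounded D x (Suc S)"
    and "\<And>x c. Sym ` set x \<subseteq> \<Gamma> \<Longrightarrow>
      cstep\<^sup>*\<^sup>* (p, init_tape x # replicate (k - 1) (init_tape [])) c \<Longrightarrow> stuck cstep c \<Longrightarrow> halts D x"
proof -
  define R where "R = residuals p"
  have finR: "finite R" using finite_residuals[OF wf] by (simp add: R_def)
  obtain g :: "com \<Rightarrow> nat" where g: "inj_on g R"
    using finite_imp_inj_to_nat_seg[OF finR] by blast
  define rds where "rds = {rs. set rs \<subseteq> \<Gamma> \<and> length rs = k}"
  have fin_rds: "finite rds" using finite_lists_length_eq[OF \<Gamma>(1)] by (simp add: rds_def)
  define D where "D = \<lparr>ntapes = k, start_state = g p, accept_state = g Skip,
    delta = {(g c, rs, g c', as) | c rs c' as. c \<in> R \<and> rs \<in> rds \<and> (c', as) \<in> sstep c rs}\<rparr>"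
  have wfR: "wf_com \<Gamma> k c" if "c \<in> R" for c
    using that wf wf_com_residuals by (auto simp: R_def)
  have stepR: "c' \<in> R" if "c \<in> R" "(c', as) \<in> sstep c rs" for c c' as rs
    using that residuals_step[of c p c' as rs] by (auto simp: R_def)
  have "delta D \<subseteq> (\<Union>c\<in>R. \<Union>rs\<in>rds. (\<lambda>(c', as). (g c, rs, g c', as)) ` sstep c rs)"
    by (force simp: D_def)
  moreover have "finite \<dots>" using finR fin_rds wfR finite_sstep by blast
  ultimately have fin: "finite (delta D)" by (rule finite_subset)
  have mach: "machine D"
    unfolding machine_def
  proof (intro conjI fin)
    show "1 \<le> ntapes D" using k by (simp add: D_def)
    show "\<forall>(q, rs, q', as) \<in> delta D. q \<noteq> accept_state D \<and> length rs = ntapes D \<and> length as = ntapes D"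
    proof clarify
      fix q rs q' as assume "(q, rs, q', as) \<in> delta D"
      then obtain c c' where *: "q = g c" "c \<in> R" "rs \<in> rds" "(c', as) \<in> sstep c rs"
        by (auto simp: D_def)
      have "c \<noteq> Skip" using * by auto
      then have "g c \<noteq> g Skip" using g * Skip_residuals[of p] by (auto simp: R_def inj_on_def)
      then show "q \<noteq> accept_state D \<and> length rs = ntapes D \<and> length as = ntapes D"
        using * sstep_wf[OF wfR] by (auto simp: D_def rds_def)
    qed
  qed
  have det: "deterministic D" if "det_com p"
    unfolding deterministic_def
  proof (intro allI impI)
    fix q rs q1 as1 q2 as2 assume "(q, rs, q1, as1) \<in> delta D \<and> (q, rs, q2, as2) \<in> delta D"
    then have "(\<exists>c c1. q = g c \<and> c \<in> R \<and> q1 = g c1 \<and> (c1, as1) \<in> sstep c rs) \<and>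
        (\<exists>d c2. q = g d \<and> d \<in> R \<and> q2 = g c2 \<and> (c2, as2) \<in> sstep d rs)"
      by (auto simp: D_def)
    then obtain c c1 d c2 where *: "q = g c" "q = g d" "c \<in> R" "d \<in> R" "q1 = g c1" "q2 = g c2"
      "(c1, as1) \<in> sstep c rs" "(c2, as2) \<in> sstep d rs" by blast
    have "c = d" using * g by (auto simp: inj_on_def)
    moreover have "det_com c" using * that det_com_residuals by (auto simp: R_def)
    ultimately show "q1 = q2 \<and> as1 = as2" using * det_com_sstep by blast
  qed
  \<comment> \<open>Outside this invariant the table has no entries: a foreign symbol or program
    would stop the machine but not the program.\<close>
  define I where "I = (\<lambda>(c, \<sigma>). c \<in> R \<and> length \<sigma> = k \<and> (\<forall>\<tau>\<in>set \<sigma>. tape_over \<Gamma> \<tau>))"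
  define h where "h = (\<lambda>(c, \<sigma> :: tape list). (g c, \<sigma>))"
  have I_rds: "map read (snd c) \<in> rds" if "I c" for c
    using that tape_over_read by (auto simp: I_def rds_def)
  have I_step: "I c'" if I: "I c" and st: "cstep c c'" for c c'
  proof -
    obtain as where as: "(fst c', as) \<in> sstep (fst c) (map read (snd c))" "snd c' = map2 act as (snd c)"
      using st by (auto simp: cstep_def)
    have w: "length as = k \<and> fst ` set as \<subseteq> \<Gamma>"
      using sstep_wf[OF wfR as(1)] I I_rds[OF I] unfolding I_def rds_def case_prod_beta by blast
    have "tape_over \<Gamma> \<tau>" if "\<tau> \<in> set (map2 act as (snd c))" for \<tau>
    proof -
      obtain a \<tau>' where *: "\<tau> = act a \<tau>'" "(a, \<tau>') \<in> set (zip as (snd c))"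
        using \<open>\<tau> \<in> set (map2 act as (snd c))\<close> by auto
      have "a \<in> set as" "\<tau>' \<in> set (snd c)" using *(2) by (auto dest: set_zip_leftD set_zip_rightD)
      then have "fst a \<in> \<Gamma>" "tape_over \<Gamma> \<tau>'" using w \<open>I c\<close> by (auto simp: I_def)
      then show ?thesis using * tape_over_act by blast
    qed
    then show ?thesis using as w I stepR[OF _ as(1)] by (auto simp: I_def)
  qed
  have sim: "step D (h c) y \<longleftrightarrow> (\<exists>c'. cstep c c' \<and> y = h c')" if I: "I c" for c y
  proof
    assume "step D (h c) y"
    then obtain q rs q' as where 1: "(q, rs, q', as) \<in> delta D" "fst (h c) = q"
      "map read (snd (h c)) = rs" "y = (q', map2 act as (snd (h c)))"
      unfolding step_def by blast
    from 1(1) obtain d c' where "q = g d" "q' = g c'" "d \<in> R" "(c', as) \<in> sstep d rs"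
      unfolding D_def by auto
    then have *: "g d = g (fst c)" "d \<in> R" "(c', as) \<in> sstep d (map read (snd c))"
      "y = (g c', map2 act as (snd c))"
      using 1(2-4) by (simp_all add: h_def case_prod_beta)
    have "d = fst c" using inj_onD[OF g *(1) *(2)] I by (simp add: I_def case_prod_beta)
    then have "cstep c (c', map2 act as (snd c))" using * by (auto simp: cstep_def)
    then show "\<exists>c'. cstep c c' \<and> y = h c'" using * by (auto simp: h_def)
  next
    assume "\<exists>c'. cstep c c' \<and> y = h c'"
    then obtain c' as where *: "(fst c', as) \<in> sstep (fst c) (map read (snd c))"
      "snd c' = map2 act as (snd c)" "y = h c'" by (auto simp: cstep_def)
    have "(g (fst c), map read (snd c), g (fst c'), as) \<in> delta D"
      using * I I_rds[OF I] unfolding D_def I_def case_prod_beta by auto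
    then show "step D (h c) y"
      using * unfolding step_def by (intro bexI[of _ "(g (fst c), map read (snd c), g (fst c'), as)"])
        (auto simp: h_def case_prod_beta)
  qed
  define c0 where "c0 = (\<lambda>x. (p, init_tape x # replicate (k - 1) (init_tape [])))"
  have I0: "I (c0 x)" if "Sym ` set x \<subseteq> \<Gamma>" for x
  proof -
    have "tape_over \<Gamma> (init_tape x)"
      unfolding tape_over_def
    proof clarify
      fix i
      show "fst (init_tape x) i \<in> \<Gamma>"
        using \<Gamma> that by (cases "i = 0"; cases "i \<le> length x") (auto simp: init_tape_def image_subset_iff)
    qed
    moreover have "tape_over \<Gamma> (init_tape [])"
      using \<Gamma> by (auto simp: tape_over_def init_tape_def)
    ultimately show ?thesis
      using k by (auto simp: I_def c0_def R_def residuals_refl)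
  qed
  have h0: "init_config D x = h (c0 x)" for x
    by (simp add: init_config_def h_def c0_def D_def)
  \<comment> \<open>Numbers of steps are matched, not just reachability, because
    \<open>time_bounded\<close> counts them.\<close>
  have pow: "(step D ^^ n) (h c) y \<longleftrightarrow> (\<exists>c'. (cstep ^^ n) c c' \<and> y = h c' \<and> I c')" if "I c" for n c y
    using that
  proof (induction n arbitrary: y)
    case (Suc n)
    show ?case
    proof
      assume "(step D ^^ Suc n) (h c) y"
      then obtain z where z: "(step D ^^ n) (h c) z" "step D z y" by auto
      then obtain d where d: "(cstep ^^ n) c d" "z = h d" "I d" using Suc.IH[OF Suc.prems] by blast
      then obtain c' where c': "cstep d c'" "y = h c'" using sim[OF d(3)] z(2) by blast
      have "(cstep ^^ Suc n) c c'" by (rule relpowp_Suc_I[OF d(1) c'(1)])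
      then show "\<exists>c'. (cstep ^^ Suc n) c c' \<and> y = h c' \<and> I c'"
        using c' I_step[OF d(3)] by blast
    next
      assume "\<exists>c'. (cstep ^^ Suc n) c c' \<and> y = h c' \<and> I c'"
      then obtain c' d where *: "(cstep ^^ n) c d" "cstep d c'" "y = h c'" by auto
      have "I e" if "(cstep ^^ m) c e" for m e using that
      proof (induction m arbitrary: e)
        case (Suc m)
        then show ?case using I_step by (meson relpowp_Suc_E)
      qed (use Suc.prems in simp)
      then have "I d" using *(1) by blast
      then have "(step D ^^ n) (h c) (h d)" using * Suc by blast
      moreover have "step D (h d) y" using sim[OF \<open>I d\<close>] * by blast
      ultimately show "(step D ^^ Suc n) (h c) y" by (rule relpowp_Suc_I)
    qed
  qed auto
  have reach: "reaches D x y \<longleftrightarrow> (\<exists>c. cstep\<^sup>*\<^sup>* (c0 x) c \<and> y = h c \<and> I c)" if "Sym ` set x \<subseteq> \<Gamma>" for x y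
    unfolding reaches_def h0 rtranclp_power pow[OF I0[OF that]] by blast
  show thesis
  proof (rule that[OF mach _ det])
    show "ntapes D = k" by (simp add: D_def)
  next
    fix x assume x: "Sym ` set x \<subseteq> \<Gamma>"
    have *: "fst (h c) = accept_state D \<longleftrightarrow> fst c = Skip" if "I c" for c
      using that g Skip_residuals[of p] by (auto simp: I_def h_def D_def R_def inj_on_def)
    have I: "I c" if "cstep\<^sup>*\<^sup>* (c0 x) c" for c
      using that by (induction rule: rtranclp_induct) (use I0[OF x] I_step in auto)
    have "accepts D x \<longleftrightarrow> (\<exists>c. cstep\<^sup>*\<^sup>* (c0 x) c \<and> fst c = Skip)"
      unfolding accepts_def reach[OF x] using * I by blast
    then show "accepts D x \<longleftrightarrow> (\<exists>\<sigma>. cstep\<^sup>*\<^sup>* (p, init_tape x # replicate (k - 1) (init_tape [])) (Skip, \<sigma>))"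
      by (simp add: c0_def)
    show "time_bounded D x T"
      if "bounded_steps cstep (p, init_tape x # replicate (k - 1) (init_tape [])) T" for T
      using that pow[OF I0[OF x]] unfolding time_bounded_def h0 bounded_steps_def c0_def by blast
    \<comment> \<open>\<open>heads_le\<close> admits position \<open>S\<close> itself, whereas
      \<open>space_bounded\<close> is strict.\<close>
    show "space_bounded D x (Suc S)"
      if "\<And>c \<sigma>. cstep\<^sup>*\<^sup>* (p, init_tape x # replicate (k - 1) (init_tape [])) (c, \<sigma>) \<Longrightarrow> heads_le S \<sigma>" for S
      unfolding space_bounded_def reach[OF x]
      using that by (fastforce simp: h_def c0_def heads_le_def)
    show "halts D x" if "cstep\<^sup>*\<^sup>* (p, init_tape x # replicate (k - 1) (init_tape [])) c" "stuck cstep c" for c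
    proof -
      have c: "cstep\<^sup>*\<^sup>* (c0 x) c" using that by (simp add: c0_def)
      have "\<nexists>y. step D (h c) y" using sim[OF I[OF c]] that(2) by (auto simp: stuck_def)
      then show ?thesis unfolding halts_def reach[OF x] using I[OF c] c by blast
    qed
  qed
qed

section \<open>Simulation of a Turing machine by a program\<close>

definition alph :: "nat \<Rightarrow> symbol set" where
  "alph b = {Blank, LeftEnd} \<union> Sym ` {..<b}"

lemma finite_alph [simp]: "finite (alph b)"
  and alph_simps [simp]: "Blank \<in> alph b" "LeftEnd \<in> alph b" "Sym n \<in> alph b \<longleftrightarrow> n < b"
  by (auto simp: alph_def)

lemma alph_mono: "b \<le> b' \<Longrightarrow> alph b \<subseteq> alph b'"
  by (auto simp: alph_def)

lemma finite_symbols_alph: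
  assumes "finite A"
  obtains b where "A \<subseteq> alph b"
proof -
  have "\<exists>b. A \<subseteq> alph b" using assms
  proof (induction A rule: finite_induct)
    case (insert s A)
    then obtain b where b: "A \<subseteq> alph b" by blast
    show ?case
    proof (cases s)
      case (Sym n)
      have "insert s A \<subseteq> alph (max b (Suc n))" using Sym b alph_mono[of b "max b (Suc n)"] by auto
      then show ?thesis ..
    qed (use b in auto)
  qed simp
  then show ?thesis using that by blast
qed

lemma machine_alph:
  assumes "machine M"
  obtains b where "\<And>q rs q' as a. (q, rs, q', as) \<in> delta M \<Longrightarrow> a \<in> set as \<Longrightarrow> fst a \<in> alph b"
proof -
  have "finite (\<Union>(q, rs, q', as)\<in>delta M. fst ` set as)"
    using assms by (auto simp: machine_def)
  then obtain b where "(\<Union>(q, rs, q', as)\<in>delta M. fst ` set as) \<subseteq> alph b"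
    by (rule finite_symbols_alph)
  then show ?thesis using that by fastforce
qed

lemma accept_stuck: "machine M \<Longrightarrow> stuck (step M) (accept_state M, \<tau>s)"
  by (fastforce simp: stuck_def step_def machine_def)

lemma step_iff:
  "step M (q, \<tau>s) c \<longleftrightarrow> (\<exists>q' as. (q, map read \<tau>s, q', as) \<in> delta M \<and> c = (q', map2 act as \<tau>s))"
  by (force simp: step_def)

lemma step_deterministic: "deterministic M \<Longrightarrow> step M c c1 \<Longrightarrow> step M c c2 \<Longrightarrow> c1 = c2"
  unfolding deterministic_def by (cases c) (fastforce simp: step_iff)

lemma deterministic_dsteps:
  assumes "deterministic M" "(step M)\<^sup>*\<^sup>* c c'"
  shows "\<exists>t. dsteps (step M) (\<lambda>_. True) c t c'"
  using assms(2)
proof (induction rule: converse_rtranclp_induct)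
  case base
  show ?case by (rule exI, rule dsteps_0) simp
next
  case (step c c1)
  then obtain t where "dsteps (step M) (\<lambda>_. True) c1 t c'" by blast
  then have "dsteps (step M) (\<lambda>_. True) c (Suc t) c'"
    using step(1) step_deterministic[OF assms(1)] by (intro dsteps_Suc[of _ c "step M" c1]) auto
  then show ?case by blast
qed

text \<open>An accepting configuration has no successor, and a deterministic computation has only
  one configuration without successor.\<close>

lemma deterministic_accepts:
  assumes "machine M" "deterministic M" "reaches M x c" "stuck (step M) c"
  shows "accepts M x \<longleftrightarrow> fst c = accept_state M"
proof
  assume "accepts M x"
  then obtain \<tau>s where *: "reaches M x (accept_state M, \<tau>s)" by (auto simp: accepts_def)
  obtain t where "dsteps (step M) (\<lambda>_. True) (init_config M x) t c"
    using deterministic_dsteps[OF assms(2) assms(3)[unfolded reaches_def]] by blast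
  from dsteps_reach_stuck[OF this accept_stuck[OF assms(1)]] *
  have "(step M)\<^sup>*\<^sup>* c (accept_state M, \<tau>s)" by (simp add: reaches_def)
  then show "fst c = accept_state M"
    using assms(4) by (cases rule: converse_rtranclpE) (auto simp: stuck_def)
qed (use assms(3) in \<open>unfold accepts_def, blast\<close>)

text \<open>What is written may depend on the symbol being overwritten; only decodability is
  demanded, so simulated tapes can carry extra information. Reductions and the NP projection use the
  identity encoding, the PSPACE projection one that marks cell 0.\<close>

locale simulation =
  fixes M :: tm and d :: "symbol \<Rightarrow> symbol" and e :: "symbol \<Rightarrow> symbol \<Rightarrow> symbol" and fl off :: nat
  assumes M: "machine M" and fl: "fl < off" and de: "\<And>r s. d (e r s) = s"
begin

abbreviation SIM :: "nat \<Rightarrow> com" where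
  "SIM q \<equiv> Sim M d e fl off q"

definition rel :: "tape list \<Rightarrow> tape list \<Rightarrow> bool" where
  "rel \<tau>s \<sigma>s \<longleftrightarrow> length \<tau>s = ntapes M \<and>
     list_all2 (\<lambda>\<tau> \<sigma>. (\<forall>j. d (fst \<sigma> j) = fst \<tau> j) \<and> snd \<sigma> = snd \<tau>) \<tau>s \<sigma>s"

definition nxt :: "(symbol \<times> move) list \<Rightarrow> tape list \<Rightarrow> tape list" where
  "nxt as \<sigma>s = map2 (\<lambda>a \<sigma>. act (e (read \<sigma>) (fst a), snd a) \<sigma>) as \<sigma>s"

definition flag :: "nat \<Rightarrow> tape list \<Rightarrow> tape list" where
  "flag q front = front[fl := act (if q = accept_state M then Sym 1 else Sym 0, Stay) (front ! fl)]"

lemma rel_read: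
  assumes "rel \<tau>s \<sigma>s"
  shows "map d (map read \<sigma>s) = map read \<tau>s"
proof (rule nth_equalityI)
  show "length (map d (map read \<sigma>s)) = length (map read \<tau>s)"
    using assms by (auto simp: rel_def dest: list_all2_lengthD)
next
  fix i assume "i < length (map d (map read \<sigma>s))"
  then have i: "i < length \<sigma>s" "i < length \<tau>s"
    using assms by (auto simp: rel_def dest: list_all2_lengthD)
  then have "\<forall>j. d (fst (\<sigma>s ! i) j) = fst (\<tau>s ! i) j" "snd (\<sigma>s ! i) = snd (\<tau>s ! i)"
    using assms list_all2_nthD by (auto simp: rel_def list_all2_conv_all_nth)
  then show "map d (map read \<sigma>s) ! i = map read \<tau>s ! i"
    using i by (cases "\<sigma>s ! i"; cases "\<tau>s ! i") auto
qed

lemma map2_act_sim: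
  "length front = n \<Longrightarrow>
   map2 act (stay (take n (map read (front @ \<sigma>s))) @ sim_act e (drop n (map read (front @ \<sigma>s))) as)
     (front @ \<sigma>s) = front @ nxt as \<sigma>s"
proof -
  assume n: "length front = n"
  have "map2 act (sim_act e (map read \<sigma>s) as) \<sigma>s = nxt as \<sigma>s"
    unfolding sim_act_def nxt_def by (rule nth_equalityI) auto
  then show ?thesis using n by (simp add: zip_append)
qed

lemma cstep_SIM:
  assumes "rel \<tau>s \<sigma>s" "length front = off" "\<not> stuck (step M) (q, \<tau>s)"
  shows "cstep (SIM q, front @ \<sigma>s) c \<longleftrightarrow>
    (\<exists>q' as. (q, map read \<tau>s, q', as) \<in> delta M \<and> c = (SIM q', front @ nxt as \<sigma>s))"
proof -
  have r: "map d (drop off (map read (front @ \<sigma>s))) = map read \<tau>s"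
    using assms(2) rel_read[OF assms(1)] by simp
  have ex: "\<exists>q' as. (q, map read \<tau>s, q', as) \<in> delta M"
    using assms(3) by (auto simp: stuck_def step_iff)
  have ss: "sstep (SIM q) (map read (front @ \<sigma>s)) =
    {(SIM q', stay (take off (map read (front @ \<sigma>s))) @ sim_act e (drop off (map read (front @ \<sigma>s))) as) | q' as.
       (q, map read \<tau>s, q', as) \<in> delta M}"
    unfolding sstep.simps r using ex by meson
  then show ?thesis
    unfolding cstep_def fst_conv snd_conv ss map2_act_sim[OF assms(2), symmetric]
    by (cases c) (simp del: map_append, blast)
qed

lemma cstep_SIM_stuck:
  assumes "rel \<tau>s \<sigma>s" "length front = off" "stuck (step M) (q, \<tau>s)"
  shows "cstep (SIM q, front @ \<sigma>s) c \<longleftrightarrow> c = (Skip, flag q front @ \<sigma>s)"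
proof -
  have r: "map d (drop off (map read (front @ \<sigma>s))) = map read \<tau>s"
    using assms(2) rel_read[OF assms(1)] by simp
  have ex: "\<not> (\<exists>q' as. (q, map read \<tau>s, q', as) \<in> delta M)"
    using assms(3) by (auto simp: stuck_def step_iff)
  have ss: "sstep (SIM q) (map read (front @ \<sigma>s)) =
    {(Skip, (stay (map read (front @ \<sigma>s)))[fl := (if q = accept_state M then Sym 1 else Sym 0, Stay)])}"
    unfolding sstep.simps r using ex by meson
  then show ?thesis
    unfolding cstep_def fst_conv snd_conv ss using fl assms(2)
    by (cases c) (auto simp: flag_def list_update_append nth_append simp del: map_append)
qed

lemma rel_nxt:
  assumes "rel \<tau>s \<sigma>s" "(q, map read \<tau>s, q', as) \<in> delta M"
  shows "rel (map2 act as \<tau>s) (nxt as \<sigma>s)"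
proof -
  have len: "length as = ntapes M" "length \<tau>s = ntapes M" "length \<sigma>s = ntapes M"
    using assms M by (auto simp: machine_def rel_def dest: list_all2_lengthD)
  have "(\<forall>j. d (fst (nxt as \<sigma>s ! i) j) = fst (map2 act as \<tau>s ! i) j) \<and>
      snd (nxt as \<sigma>s ! i) = snd (map2 act as \<tau>s ! i)" if i: "i < ntapes M" for i
  proof -
    obtain s m where a: "as ! i = (s, m)" by (cases "as ! i")
    have "\<forall>j. d (fst (\<sigma>s ! i) j) = fst (\<tau>s ! i) j" "snd (\<sigma>s ! i) = snd (\<tau>s ! i)"
      using assms(1) i len by (auto simp: rel_def list_all2_conv_all_nth)
    then show ?thesis
      using i len a de by (cases "\<sigma>s ! i"; cases "\<tau>s ! i") (auto simp: nxt_def)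
  qed
  then show ?thesis using len by (auto simp: rel_def list_all2_conv_all_nth nxt_def)
qed

text \<open>The \<open>2\<close> pays for writing the flag and for dropping \<open>Skip\<close>. The
  continuation \<open>b\<close> must be bounded for every final state and tape contents, as a
  nondeterministic \<open>M\<close> may halt in many ways.\<close>

lemma bounded_steps_SIM:
  assumes "bounded_steps (step M) (q, \<tau>s) T" "rel \<tau>s \<sigma>s" "length front = off"
    and "\<And>q \<sigma>s'. bounded_steps cstep (b, flag q front @ \<sigma>s') T'"
  shows "bounded_steps cstep (SIM q ;; b, front @ \<sigma>s) (T + 2 + T')"
  using assms(1,2)
proof (induction T arbitrary: q \<tau>s \<sigma>s rule: less_induct)
  case (less T)
  show ?case
  proof (cases "stuck (step M) (q, \<tau>s)")
    case True
    have "bounded_steps cstep (SIM q ;; b, front @ \<sigma>s) (Suc (Suc T'))"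
      by (intro bounded_steps_Suc)
        (auto simp: cstep_Seq cstep_SIM_stuck[OF less.prems(2) assms(3) True] intro: assms(4))
    then show ?thesis by (rule bounded_steps_mono) simp
  next
    case False
    then obtain c where "step M (q, \<tau>s) c" by (auto simp: stuck_def)
    then have T: "T > 0" using bounded_steps_step[OF less.prems(1)] by blast
    have "bounded_steps cstep (SIM q ;; b, front @ \<sigma>s) (Suc (T - 1 + 2 + T'))"
    proof (rule bounded_steps_Suc)
      fix c' assume "cstep (SIM q ;; b, front @ \<sigma>s) c'"
      then obtain q' as where *: "(q, map read \<tau>s, q', as) \<in> delta M" "c' = (SIM q' ;; b, front @ nxt as \<sigma>s)"
        by (auto simp: cstep_Seq cstep_SIM[OF less.prems(2) assms(3) False])
      then have "step M (q, \<tau>s) (q', map2 act as \<tau>s)" by (auto simp: step_iff)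
      then have "bounded_steps (step M) (q', map2 act as \<tau>s) (T - 1)"
        using bounded_steps_step[OF less.prems(1)] by blast
      then show "bounded_steps cstep c' (T - 1 + 2 + T')"
        unfolding *(2) by (intro less.IH[OF _ _ rel_nxt[OF less.prems(2) *(1)]]) (use T in simp)
    qed
    then show ?thesis using T by simp
  qed
qed

lemma flag_read: "length front = off \<Longrightarrow>
   read (flag q front ! fl) = (if q = accept_state M then Sym 1 else Sym 0)"
  using fl by (cases "front ! fl") (auto simp: flag_def)

definition accept_test :: com where
  "accept_test = Cond (\<lambda>rs. rs ! fl = Sym 1) Skip Fail"

lemma cstep_accept_test:
  assumes "length front = off"
  shows "cstep (accept_test, flag q front @ \<sigma>s) c \<longleftrightarrow>
     c = (if q = accept_state M then Skip else Fail, flag q front @ \<sigma>s)"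
proof -
  have "map read (flag q front @ \<sigma>s) ! fl = (if q = accept_state M then Sym 1 else Sym 0)"
    using flag_read[OF assms, of q] assms fl by (simp add: nth_append flag_def)
  then show ?thesis by (simp add: accept_test_def del: map_append)
qed

lemma bounded_steps_SIM_test:
  assumes "bounded_steps (step M) (q, \<tau>s) T" "rel \<tau>s \<sigma>s" "length front = off"
  shows "bounded_steps cstep (SIM q ;; accept_test, front @ \<sigma>s) (T + 3)"
proof -
  have "bounded_steps cstep (accept_test, flag q front @ \<sigma>s') 1" for q \<sigma>s'
    unfolding One_nat_def
    by (rule bounded_steps_Suc) (auto simp: cstep_accept_test[OF assms(3)] intro!: bounded_steps_stuck)
  from bounded_steps_SIM[OF assms this] show ?thesis by (simp add: numeral_3_eq_3)
qed

text \<open>Runs are followed step by step in both directions, since \<open>M\<close> may branch. An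
  accepting configuration of \<open>M\<close> is stuck, so the simulation ends there and sets the
  flag; conversely the test lets only this flag pass.\<close>

lemma SIM_test_accepts:
  assumes "rel \<tau>s \<sigma>s" "length front = off"
  shows "(\<exists>\<sigma>. cstep\<^sup>*\<^sup>* (SIM q ;; accept_test, front @ \<sigma>s) (Skip, \<sigma>)) \<longleftrightarrow>
     (\<exists>\<tau>s'. (step M)\<^sup>*\<^sup>* (q, \<tau>s) (accept_state M, \<tau>s'))"
proof
  assume "\<exists>\<sigma>. cstep\<^sup>*\<^sup>* (SIM q ;; accept_test, front @ \<sigma>s) (Skip, \<sigma>)"
  then obtain \<sigma> n where "(cstep ^^ n) (SIM q ;; accept_test, front @ \<sigma>s) (Skip, \<sigma>)"
    by (auto simp: rtranclp_power)
  then show "\<exists>\<tau>s'. (step M)\<^sup>*\<^sup>* (q, \<tau>s) (accept_state M, \<tau>s')" using assms(1)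
  proof (induction n arbitrary: q \<tau>s \<sigma>s)
    case (Suc n)
    obtain c where c: "cstep (SIM q ;; accept_test, front @ \<sigma>s) c" "(cstep ^^ n) c (Skip, \<sigma>)"
      using Suc.prems(1) by (meson relpowp_Suc_E2)
    show ?case
    proof (cases "stuck (step M) (q, \<tau>s)")
      case True
      then have "c = (Skip ;; accept_test, flag q front @ \<sigma>s)"
        using c(1) by (auto simp: cstep_Seq cstep_SIM_stuck[OF Suc.prems(2) assms(2) True])
      moreover have "cstep\<^sup>*\<^sup>* c (Skip, \<sigma>)" using c(2) by (rule relpowp_imp_rtranclp)
      ultimately have "cstep\<^sup>*\<^sup>* (accept_test, flag q front @ \<sigma>s) (Skip, \<sigma>)"
        by (auto elim: converse_rtranclpE)
      then have "cstep\<^sup>*\<^sup>* (if q = accept_state M then Skip else Fail, flag q front @ \<sigma>s) (Skip, \<sigma>)"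
        by (cases rule: converse_rtranclpE)
          (auto simp: cstep_accept_test[OF assms(2)], simp add: accept_test_def)
      then have "q = accept_state M"
        by (cases rule: converse_rtranclpE) (auto split: if_splits)
      then show ?thesis by blast
    next
      case False
      then obtain q' as where *: "(q, map read \<tau>s, q', as) \<in> delta M" "c = (SIM q' ;; accept_test, front @ nxt as \<sigma>s)"
        using c(1) by (auto simp: cstep_Seq cstep_SIM[OF Suc.prems(2) assms(2) False])
      then have st: "step M (q, \<tau>s) (q', map2 act as \<tau>s)" by (auto simp: step_iff)
      have "\<exists>\<tau>s'. (step M)\<^sup>*\<^sup>* (q', map2 act as \<tau>s) (accept_state M, \<tau>s')"
        by (rule Suc.IH[OF _ rel_nxt[OF Suc.prems(2) *(1)]]) (use c(2) * in simp)
      then show ?thesis using converse_rtranclp_into_rtranclp[of "step M", OF st] by blast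
    qed
  qed simp
next
  assume "\<exists>\<tau>s'. (step M)\<^sup>*\<^sup>* (q, \<tau>s) (accept_state M, \<tau>s')"
  then obtain \<tau>s' n where "(step M ^^ n) (q, \<tau>s) (accept_state M, \<tau>s')" by (auto simp: rtranclp_power)
  then show "\<exists>\<sigma>. cstep\<^sup>*\<^sup>* (SIM q ;; accept_test, front @ \<sigma>s) (Skip, \<sigma>)" using assms(1)
  proof (induction n arbitrary: q \<tau>s \<sigma>s)
    case 0
    then have q: "q = accept_state M" and st: "stuck (step M) (q, \<tau>s)" using accept_stuck[OF M] by auto
    have "cstep (SIM q ;; accept_test, front @ \<sigma>s) (Skip ;; accept_test, flag q front @ \<sigma>s)"
      by (auto simp: cstep_Seq cstep_SIM_stuck[OF 0(2) assms(2) st])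
    moreover have "cstep (Skip ;; accept_test, flag q front @ \<sigma>s) (accept_test, flag q front @ \<sigma>s)" by simp
    moreover have "cstep (accept_test, flag q front @ \<sigma>s) (Skip, flag q front @ \<sigma>s)"
      using q by (simp add: cstep_accept_test[OF assms(2)])
    ultimately show ?case by (meson converse_rtranclp_into_rtranclp rtranclp.rtrancl_refl)
  next
    case (Suc n)
    obtain c where c: "step M (q, \<tau>s) c" "(step M ^^ n) c (accept_state M, \<tau>s')"
      using Suc.prems(1) by (meson relpowp_Suc_E2)
    then obtain q' as where *: "(q, map read \<tau>s, q', as) \<in> delta M" "c = (q', map2 act as \<tau>s)"
      by (auto simp: step_iff)
    have ns: "\<not> stuck (step M) (q, \<tau>s)" using c(1) unfolding stuck_def by blast
    have "cstep (SIM q ;; accept_test, front @ \<sigma>s) (SIM q' ;; accept_test, front @ nxt as \<sigma>s)"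
      using *(1) by (auto simp: cstep_Seq cstep_SIM[OF Suc.prems(2) assms(2) ns])
    moreover have "\<exists>\<sigma>. cstep\<^sup>*\<^sup>* (SIM q' ;; accept_test, front @ nxt as \<sigma>s) (Skip, \<sigma>)"
      by (rule Suc.IH[OF _ rel_nxt[OF Suc.prems(2) *(1)]]) (use c(2) * in simp)
    ultimately show ?case by (meson converse_rtranclp_into_rtranclp)
  qed
qed

lemma heads_le_rel:
  assumes "rel \<tau>s \<sigma>s" "heads_le S \<tau>s"
  shows "heads_le S \<sigma>s"
  unfolding heads_le_def
proof
  fix \<sigma> assume "\<sigma> \<in> set \<sigma>s"
  then obtain i where i: "i < length \<sigma>s" "\<sigma> = \<sigma>s ! i" by (auto simp: in_set_conv_nth)
  then have "snd \<sigma> = snd (\<tau>s ! i)" "\<tau>s ! i \<in> set \<tau>s"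
    using assms(1) by (auto simp: rel_def list_all2_conv_all_nth)
  then show "snd \<sigma> \<le> S" using assms(2) by (auto simp: heads_le_def)
qed

lemma heads_le_flag:
  assumes "length front = off" "heads_le S front"
  shows "heads_le S (flag q front)"
proof -
  have "front ! fl \<in> set front" using fl assms(1) by simp
  then have "snd (front ! fl) \<le> S" using assms(2) by (auto simp: heads_le_def)
  then have "snd (act (s, Stay) (front ! fl)) \<le> S" for s by (cases "front ! fl") simp
  then show ?thesis
    using assms(2) by (auto simp: flag_def heads_le_def dest!: set_update_subset_insert[THEN subsetD])
qed

lemma heads_le_append [simp]: "heads_le S (xs @ ys) \<longleftrightarrow> heads_le S xs \<and> heads_le S ys"
  by (auto simp: heads_le_def)

text \<open>No running time enters: the heads are bounded by the space that \<open>M\<close> uses.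
  \<open>Iv\<close> is a property of single simulated tapes that survives encoded writes at
  positions up to \<open>S\<close>; the PSPACE search needs it to know that the tapes can be erased
  afterwards.\<close>

lemma SIM_deterministic:
  assumes det: "deterministic M" and run: "(step M)\<^sup>*\<^sup>* c c'" and st: "stuck (step M) c'"
    and "rel (snd c) \<sigma>s" "length front = off" "heads_le S front" "\<And>c1. (step M)\<^sup>*\<^sup>* c c1 \<Longrightarrow> heads_le S (snd c1)"
    and Iv: "\<And>\<sigma> s m. Iv \<sigma> \<Longrightarrow> snd \<sigma> \<le> S \<Longrightarrow> Iv (act (e (read \<sigma>) s, m) \<sigma>)" "\<forall>\<sigma>\<in>set \<sigma>s. Iv \<sigma>"
  shows "\<exists>t \<sigma>s'. dsteps cstep (\<lambda>x. heads_le S (snd x)) (SIM (fst c), front @ \<sigma>s) t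
      (Skip, flag (fst c') front @ \<sigma>s') \<and> rel (snd c') \<sigma>s' \<and> (\<forall>\<sigma>\<in>set \<sigma>s'. Iv \<sigma>)"
  using run assms(4-7,9)
proof (induction arbitrary: \<sigma>s rule: converse_rtranclp_induct)
  case base
  have "heads_le S \<sigma>s" using base.prems heads_le_rel by blast
  moreover obtain q \<tau>s where c: "c' = (q, \<tau>s)" by (cases c')
  ultimately have "dsteps cstep (\<lambda>x. heads_le S (snd x)) (SIM (fst c'), front @ \<sigma>s) 1
      (Skip, flag (fst c') front @ \<sigma>s)"
    using base.prems st
    by (intro dsteps_1) (auto simp: cstep_SIM_stuck heads_le_flag)
  then show ?case using base.prems by blast
next
  case (step c c1)
  obtain q \<tau>s where c: "c = (q, \<tau>s)" by (cases c)
  then obtain q' as where *: "(q, map read \<tau>s, q', as) \<in> delta M" "c1 = (q', map2 act as \<tau>s)"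
    using step(1) by (auto simp: step_iff)
  have ns: "\<not> stuck (step M) (q, \<tau>s)" using step(1) c unfolding stuck_def by blast
  have hd: "heads_le S \<sigma>s" using step.prems(1) step.prems(4)[of c] heads_le_rel by blast
  have "\<exists>t \<sigma>s'. dsteps cstep (\<lambda>x. heads_le S (snd x)) (SIM (fst c1), front @ nxt as \<sigma>s) t
      (Skip, flag (fst c') front @ \<sigma>s') \<and> rel (snd c') \<sigma>s' \<and> (\<forall>\<sigma>\<in>set \<sigma>s'. Iv \<sigma>)"
  proof (rule step.IH)
    show "rel (snd c1) (nxt as \<sigma>s)" using rel_nxt[OF _ *(1)] step.prems(1) * c by simp
    show "heads_le S (snd c2)" if "(step M)\<^sup>*\<^sup>* c1 c2" for c2
      using converse_rtranclp_into_rtranclp[of "step M", OF step(1) that] step.prems by blast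
    show "\<forall>\<sigma>\<in>set (nxt as \<sigma>s). Iv \<sigma>"
    proof
      fix \<sigma> assume "\<sigma> \<in> set (nxt as \<sigma>s)"
      then obtain a \<sigma>' where **: "\<sigma> = act (e (read \<sigma>') (fst a), snd a) \<sigma>'" "(a, \<sigma>') \<in> set (zip as \<sigma>s)"
        by (auto simp: nxt_def)
      have "\<sigma>' \<in> set \<sigma>s" using **(2) by (auto dest: set_zip_rightD)
      then show "Iv \<sigma>" unfolding **(1) using step.prems(5) hd by (intro Iv(1)) (auto simp: heads_le_def)
    qed
  qed (use step.prems in auto)
  then obtain t \<sigma>s' where **: "dsteps cstep (\<lambda>x. heads_le S (snd x)) (SIM q', front @ nxt as \<sigma>s) t
      (Skip, flag (fst c') front @ \<sigma>s')" "rel (snd c') \<sigma>s'" "\<forall>\<sigma>\<in>set \<sigma>s'. Iv \<sigma>"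
    unfolding * by auto
  have "dsteps cstep (\<lambda>x. heads_le S (snd x)) (SIM q, front @ \<sigma>s) (Suc t) (Skip, flag (fst c') front @ \<sigma>s')"
  proof (rule dsteps_Suc[OF _ _ _ **(1)])
    have r: "rel \<tau>s \<sigma>s" using step.prems(1) c by simp
    note cs = cstep_SIM[OF r step.prems(2) ns]
    show "cstep (SIM q, front @ \<sigma>s) (SIM q', front @ nxt as \<sigma>s)" using cs * by blast
    show "c2 = (SIM q', front @ nxt as \<sigma>s)" if "cstep (SIM q, front @ \<sigma>s) c2" for c2
      using that * det unfolding cs deterministic_def by blast
    show "heads_le S (snd (SIM q, front @ \<sigma>s))" using hd step.prems by simp
  qed
  then show ?case using ** c by auto
qed

end

section \<open>Closure under polynomial-time reductions\<close>

lemma poly_nat_mono: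
  fixes p :: "nat poly"
  assumes "m \<le> n"
  shows "poly p m \<le> poly p n"
  by (induction p) (auto intro!: add_mono mult_mono assms)

definition init_tapes :: "nat list \<Rightarrow> nat \<Rightarrow> tape list" where
  "init_tapes x k = init_tape x # replicate (k - 1) (init_tape [])"

text \<open>
  The output is left on tape \<open>off\<close>; this and the following tapes are then in the initial
  configuration of a machine started on the output.
\<close>

definition computes ::
  "com \<Rightarrow> nat \<Rightarrow> nat set \<Rightarrow> nat set \<Rightarrow> (nat list \<Rightarrow> nat list option) \<Rightarrow> bool" where
  "computes C off \<Sigma> \<Sigma>' f \<longleftrightarrow> det_com C \<and> 0 < off \<and> (\<exists>b0. \<forall>b\<ge>b0. \<forall>k>off. wf_com (alph b) k C) \<and>
     (\<exists>q :: nat poly. \<forall>k>off. \<forall>x\<in>lists \<Sigma>. \<exists>t\<le>poly q (length x). case f x of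
         None \<Rightarrow> exec C (init_tapes x k) t None
       | Some y \<Rightarrow> y \<in> lists \<Sigma>' \<and> length y \<le> poly q (length x) \<and>
           (\<exists>front. length front = off \<and> exec C (init_tapes x k) t (Some (front @ init_tapes y (k - off)))))"

lemma init_tape_fst: "fst (init_tape x) j = (if j = 0 then LeftEnd else if j \<le> length x then Sym (x ! (j - 1)) else Blank)"
  by (simp add: init_tape_def)

lemma heads_le_init_tapes: "heads_le 0 (init_tapes x k)"
  by (auto simp: heads_le_def init_tapes_def init_tape_def)

locale reduction =
  fixes C :: com and off :: nat and \<Sigma> \<Sigma>' :: "nat set" and f :: "nat list \<Rightarrow> nat list option"
    and M :: tm
  assumes computes: "computes C off \<Sigma> \<Sigma>' f" and mach: "machine M" and fin: "finite \<Sigma>"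
begin

text \<open>Tape 0 belongs to the front part left over by the transducer and is free to hold the
  flag; this is the purpose of \<open>0 < off\<close> in \<open>computes\<close>.\<close>

sublocale simulation M id "\<lambda>r s. s" 0 off
  using mach computes by unfold_locales (auto simp: computes_def)

definition prog :: com where
  "prog = C ;; SIM (start_state M) ;; accept_test"

definition k :: nat where "k = off + ntapes M"

lemma k: "k > off" "k - off = ntapes M" "k \<ge> 1"
  using mach by (auto simp: k_def machine_def)

lemma rel_init: "rel (init_tapes y (ntapes M)) (init_tapes y (ntapes M))"
  using mach by (auto simp: rel_def init_tapes_def machine_def list_all2_conv_all_nth)

lemma init_config_eq: "init_config M y = (start_state M, init_tapes y (ntapes M))"
  by (simp add: init_config_def init_tapes_def)

lemma prog_alph: "\<exists>b. wf_com (alph b) k prog \<and> Sym ` \<Sigma> \<subseteq> alph b"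
proof -
  obtain b1 where b1: "\<And>q rs q' as a. (q, rs, q', as) \<in> delta M \<Longrightarrow> a \<in> set as \<Longrightarrow> fst a \<in> alph b1"
    using machine_alph[OF mach] by blast
  obtain b0 where b0: "\<And>b k. b \<ge> b0 \<Longrightarrow> k > off \<Longrightarrow> wf_com (alph b) k C"
    using computes by (auto simp: computes_def)
  obtain b2 where b2: "Sym ` \<Sigma> \<subseteq> alph b2" using finite_symbols_alph[of "Sym ` \<Sigma>"] fin by blast
  define b where "b = b0 + b1 + b2 + 2"
  have "alph b1 \<subseteq> alph b" "alph b2 \<subseteq> alph b" by (auto intro!: alph_mono simp: b_def)
  moreover have "wf_com (alph b) k C" using b0[of b k] k by (simp add: b_def)
  ultimately have "wf_com (alph b) k prog \<and> Sym ` \<Sigma> \<subseteq> alph b"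
    using b1 b2 mach by (fastforce simp: prog_def accept_test_def k_def b_def)
  then show ?thesis ..
qed

lemma prog_None:
  assumes "exec C (init_tapes x k) t None"
  obtains c where "dsteps cstep (\<lambda>_. True) (prog, init_tapes x k) t c" "stuck cstep c" "fst c \<noteq> Skip"
  using exec_dsteps[OF exec_Seq_None[OF assms, of "SIM (start_state M) ;; accept_test"]] unfolding prog_def by auto

lemma prog_Some:
  assumes "exec C (init_tapes x k) t (Some \<sigma>)"
  shows "dsteps cstep (\<lambda>_. True) (prog, init_tapes x k) (t + 1) (SIM (start_state M) ;; accept_test, \<sigma>)"
proof -
  have "dsteps cstep (\<lambda>_. True) (prog, init_tapes x k) (t + 1 + 0) (SIM (start_state M) ;; accept_test, \<sigma>)"
    unfolding prog_def
    by (rule dsteps_Seq[where P = "\<lambda>_. True"]) (use exec_dsteps[OF assms] in \<open>auto intro: dsteps_0\<close>)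
  then show ?thesis by simp
qed

lemma stuck_reach_Skip: "stuck cstep c \<Longrightarrow> fst c \<noteq> Skip \<Longrightarrow> \<not> cstep\<^sup>*\<^sup>* c (Skip, \<sigma>)"
  by (auto simp: stuck_def elim: converse_rtranclpE)

lemma run_spec:
  "\<exists>q :: nat poly. \<forall>x\<in>lists \<Sigma>. \<exists>t\<le>poly q (length x). case f x of
         None \<Rightarrow> exec C (init_tapes x k) t None
       | Some y \<Rightarrow> y \<in> lists \<Sigma>' \<and> length y \<le> poly q (length x) \<and>
           (\<exists>front. length front = off \<and> exec C (init_tapes x k) t (Some (front @ init_tapes y (ntapes M))))"
proof -
  from computes obtain q :: "nat poly" where "\<forall>k>off. \<forall>x\<in>lists \<Sigma>. \<exists>t\<le>poly q (length x). case f x of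
         None \<Rightarrow> exec C (init_tapes x k) t None
       | Some y \<Rightarrow> y \<in> lists \<Sigma>' \<and> length y \<le> poly q (length x) \<and>
           (\<exists>front. length front = off \<and> exec C (init_tapes x k) t (Some (front @ init_tapes y (k - off))))"
    unfolding computes_def by blast
  from this[rule_format, OF k(1)] show ?thesis unfolding k(2) by blast
qed

lemma prog_accepts:
  assumes "x \<in> lists \<Sigma>"
  shows "(\<exists>\<sigma>. cstep\<^sup>*\<^sup>* (prog, init_tapes x k) (Skip, \<sigma>)) \<longleftrightarrow> (\<exists>y. f x = Some y \<and> accepts M y)"
proof -
  obtain q :: "nat poly" where q: "\<And>x. x \<in> lists \<Sigma> \<Longrightarrow> \<exists>t\<le>poly q (length x). case f x of
         None \<Rightarrow> exec C (init_tapes x k) t None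
       | Some y \<Rightarrow> y \<in> lists \<Sigma>' \<and> length y \<le> poly q (length x) \<and>
           (\<exists>front. length front = off \<and> exec C (init_tapes x k) t (Some (front @ init_tapes y (ntapes M))))"
    using run_spec by blast
  from q[OF assms] obtain t where t: "case f x of None \<Rightarrow> exec C (init_tapes x k) t None
     | Some y \<Rightarrow> y \<in> lists \<Sigma>' \<and> length y \<le> poly q (length x) \<and>
        (\<exists>front. length front = off \<and> exec C (init_tapes x k) t (Some (front @ init_tapes y (ntapes M))))"
    by blast
  show ?thesis
  proof (cases "f x")
    case None
    with t obtain c where c: "dsteps cstep (\<lambda>_. True) (prog, init_tapes x k) t c" "stuck cstep c" "fst c \<noteq> Skip"
      by (auto elim: prog_None)
    then show ?thesis
      using dsteps_reach_stuck[OF c(1)] stuck_reach_Skip[OF c(2,3)] None by auto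
  next
    case (Some y)
    with t obtain front where *: "length front = off"
      "exec C (init_tapes x k) t (Some (front @ init_tapes y (ntapes M)))" by auto
    have "accepts M y \<longleftrightarrow> (\<exists>\<tau>s'. (step M)\<^sup>*\<^sup>* (start_state M, init_tapes y (ntapes M)) (accept_state M, \<tau>s'))"
      by (auto simp: accepts_def reaches_def init_config_eq)
    then show ?thesis
      using dsteps_reach_stuck[OF prog_Some[OF *(2)] stuck_Skip] SIM_test_accepts[OF rel_init *(1)] Some
      by auto
  qed
qed

end

theorem NP_reduction:
  assumes L: "(\<Sigma>', L) \<in> NP" and comp: "computes C off \<Sigma> \<Sigma>' f" and fin: "finite \<Sigma>"
  shows "(\<Sigma>, {x \<in> lists \<Sigma>. \<exists>y\<in>L. f x = Some y}) \<in> NP"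
proof -
  obtain M p where HM: "machine M"
    "\<And>y. y \<in> lists \<Sigma>' \<Longrightarrow> time_bounded M y (poly p (length y)) \<and> (accepts M y \<longleftrightarrow> y \<in> L)"
    using L by (auto simp: NP_def)
  interpret reduction C off \<Sigma> \<Sigma>' f M by unfold_locales (use comp HM fin in auto)
  obtain b where b: "wf_com (alph b) k prog" "Sym ` \<Sigma> \<subseteq> alph b" using prog_alph by blast
  obtain D where D: "machine D" "\<And>x. Sym ` set x \<subseteq> alph b \<Longrightarrow>
      accepts D x \<longleftrightarrow> (\<exists>\<sigma>. cstep\<^sup>*\<^sup>* (prog, init_tapes x k) (Skip, \<sigma>))"
    "\<And>x T. Sym ` set x \<subseteq> alph b \<Longrightarrow>
      bounded_steps cstep (prog, init_tapes x k) T \<Longrightarrow> time_bounded D x T"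
    by (rule compile[OF k(3) finite_alph _ _ b(1)]) (auto simp: init_tapes_def)
  obtain q :: "nat poly" where q: "\<And>x. x \<in> lists \<Sigma> \<Longrightarrow> \<exists>t\<le>poly q (length x). case f x of
         None \<Rightarrow> exec C (init_tapes x k) t None
       | Some y \<Rightarrow> y \<in> lists \<Sigma>' \<and> length y \<le> poly q (length x) \<and>
           (\<exists>front. length front = off \<and> exec C (init_tapes x k) t (Some (front @ init_tapes y (ntapes M))))"
    using run_spec by blast
  \<comment> \<open>\<open>q\<close> bounds the transducer, one step leaves it, and simulation and
    test take at most three steps more than \<open>M\<close> on an output of length at most
    \<open>q\<close>.\<close>
  define r where "r = q + pcompose p q + [:4:]"
  have "time_bounded D x (poly r (length x)) \<and> (accepts D x \<longleftrightarrow> (\<exists>y\<in>L. f x = Some y))"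
    if x: "x \<in> lists \<Sigma>" for x
  proof -
    have al: "Sym ` set x \<subseteq> alph b" using x b(2) by auto
    obtain t where t: "t \<le> poly q (length x)" "case f x of
         None \<Rightarrow> exec C (init_tapes x k) t None
       | Some y \<Rightarrow> y \<in> lists \<Sigma>' \<and> length y \<le> poly q (length x) \<and>
           (\<exists>front. length front = off \<and> exec C (init_tapes x k) t (Some (front @ init_tapes y (ntapes M))))"
      using q[OF x] by blast
    have "bounded_steps cstep (prog, init_tapes x k) (poly r (length x))"
    proof (cases "f x")
      case None
      with t obtain c where c: "dsteps cstep (\<lambda>_. True) (prog, init_tapes x k) t c" "stuck cstep c"
        by (auto elim: prog_None)
      show ?thesis
        by (rule bounded_steps_mono[OF bounded_steps_dsteps[OF c(1) bounded_steps_stuck[OF c(2)]]])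
          (use t in \<open>simp add: r_def\<close>)
    next
      case (Some y)
      with t obtain front where *: "length front = off" "y \<in> lists \<Sigma>'" "length y \<le> poly q (length x)"
        "exec C (init_tapes x k) t (Some (front @ init_tapes y (ntapes M)))" by auto
      have "bounded_steps (step M) (start_state M, init_tapes y (ntapes M)) (poly p (length y))"
        using HM(2)[OF *(2)] by (simp add: time_bounded_def bounded_steps_def init_config_eq)
      from bounded_steps_dsteps[OF prog_Some[OF *(4)] bounded_steps_SIM_test[OF this rel_init *(1)]]
      show ?thesis
        by (rule bounded_steps_mono)
          (use t(1) poly_nat_mono[OF *(3), of p] in \<open>simp add: r_def poly_pcompose\<close>)
    qed
    moreover have "(\<exists>y. f x = Some y \<and> accepts M y) \<longleftrightarrow> (\<exists>y\<in>L. f x = Some y)"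
      using t(2) HM(2) by (auto split: option.splits)
    ultimately show ?thesis using D(2,3)[OF al] prog_accepts[OF x] by simp
  qed
  then show ?thesis
    using D(1) fin by (auto simp: NP_def is_language_def intro!: exI[of _ D] exI[of _ r])
qed

lemma dsteps_end: "dsteps R P c t e \<Longrightarrow> P e"
  by (induction rule: dsteps.induct)

text \<open>A forced run into a stuck configuration is the entire computation, so its invariant
  holds for everything reachable.\<close>

lemma dsteps_deterministic_space:
  assumes "dsteps R P c t e" "stuck R e" "R\<^sup>*\<^sup>* c c'"
  shows "P c'"
proof (rule dsteps_reach_invar[OF assms(1,3)])
  fix e' assume "R\<^sup>*\<^sup>* e e'"
  then have "e' = e" using assms(2) by (cases rule: converse_rtranclpE) (auto simp: stuck_def)
  moreover have "P e" using dsteps_end[OF assms(1)] .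
  ultimately show "P e'" by simp
qed

text \<open>The space of the transducer is bounded by its running time, that of the simulation by
  the space bound of \<open>M\<close> on an output of polynomial length.\<close>

theorem PSPACE_reduction:
  assumes L: "(\<Sigma>', L) \<in> PSPACE" and comp: "computes C off \<Sigma> \<Sigma>' f" and fin: "finite \<Sigma>"
  shows "(\<Sigma>, {x \<in> lists \<Sigma>. \<exists>y\<in>L. f x = Some y}) \<in> PSPACE"
proof -
  obtain M p where HM: "machine M" "deterministic M"
    "\<And>y. y \<in> lists \<Sigma>' \<Longrightarrow> halts M y \<and> space_bounded M y (poly p (length y)) \<and> (accepts M y \<longleftrightarrow> y \<in> L)"
    using L by (auto simp: PSPACE_def)
  interpret reduction C off \<Sigma> \<Sigma>' f M by unfold_locales (use comp HM fin in auto)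
  obtain b where b: "wf_com (alph b) k prog" "Sym ` \<Sigma> \<subseteq> alph b" using prog_alph by blast
  have dp: "det_com prog" using computes HM(2) by (simp add: prog_def accept_test_def computes_def)
  obtain D where D: "machine D" "deterministic D" "\<And>x. Sym ` set x \<subseteq> alph b \<Longrightarrow>
      accepts D x \<longleftrightarrow> (\<exists>\<sigma>. cstep\<^sup>*\<^sup>* (prog, init_tapes x k) (Skip, \<sigma>))"
    "\<And>x S. Sym ` set x \<subseteq> alph b \<Longrightarrow> (\<And>c \<sigma>. cstep\<^sup>*\<^sup>* (prog, init_tapes x k) (c, \<sigma>) \<Longrightarrow> heads_le S \<sigma>) \<Longrightarrow>
      space_bounded D x (Suc S)"
    "\<And>x c. Sym ` set x \<subseteq> alph b \<Longrightarrow>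
      cstep\<^sup>*\<^sup>* (prog, init_tapes x k) c \<Longrightarrow> stuck cstep c \<Longrightarrow> halts D x"
    by (rule compile[OF k(3) finite_alph _ _ b(1)]) (use dp in \<open>auto simp: init_tapes_def\<close>)
  obtain q :: "nat poly" where q: "\<And>x. x \<in> lists \<Sigma> \<Longrightarrow> \<exists>t\<le>poly q (length x). case f x of
         None \<Rightarrow> exec C (init_tapes x k) t None
       | Some y \<Rightarrow> y \<in> lists \<Sigma>' \<and> length y \<le> poly q (length x) \<and>
           (\<exists>front. length front = off \<and> exec C (init_tapes x k) t (Some (front @ init_tapes y (ntapes M))))"
    using run_spec by blast
  define r where "r = q + pcompose p q + [:4:]"
  have "halts D x \<and> space_bounded D x (poly r (length x)) \<and> (accepts D x \<longleftrightarrow> (\<exists>y\<in>L. f x = Some y))"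
    if x: "x \<in> lists \<Sigma>" for x
  proof -
    have al: "Sym ` set x \<subseteq> alph b" using x b(2) by auto
    obtain t where t: "t \<le> poly q (length x)" "case f x of
         None \<Rightarrow> exec C (init_tapes x k) t None
       | Some y \<Rightarrow> y \<in> lists \<Sigma>' \<and> length y \<le> poly q (length x) \<and>
           (\<exists>front. length front = off \<and> exec C (init_tapes x k) t (Some (front @ init_tapes y (ntapes M))))"
      using q[OF x] by blast
    \<comment> \<open>Time for the transducer and for leaving it, plus the space of \<open>M\<close>
      on the output.\<close>
    define S where "S = poly q (length x) + poly p (poly q (length x)) + 2"
    have "\<exists>u e. dsteps cstep (\<lambda>c. heads_le S (snd c)) (prog, init_tapes x k) u e \<and> stuck cstep e"
    proof (cases "f x")
      case None
      with t obtain c where c: "dsteps cstep (\<lambda>_. True) (prog, init_tapes x k) t c" "stuck cstep c"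
        by (auto elim: prog_None)
      have "dsteps cstep (\<lambda>c. heads_le S (snd c)) (prog, init_tapes x k) t c"
        using dsteps_heads_le[OF c(1), of 0 S] t(1) heads_le_init_tapes by (simp add: S_def)
      then show ?thesis using c by blast
    next
      case (Some y)
      with t obtain front where *: "length front = off" "y \<in> lists \<Sigma>'" "length y \<le> poly q (length x)"
        "exec C (init_tapes x k) t (Some (front @ init_tapes y (ntapes M)))" by auto
      let ?c = "(start_state M, init_tapes y (ntapes M))"
      have 1: "dsteps cstep (\<lambda>c. heads_le S (snd c)) (prog, init_tapes x k) (t + 1)
          (SIM (start_state M) ;; accept_test, front @ init_tapes y (ntapes M))"
        and hl: "heads_le S (front @ init_tapes y (ntapes M))"
        using dsteps_heads_le[OF prog_Some[OF *(4)], of 0 S] t(1) heads_le_init_tapes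
        by (auto simp: S_def intro: heads_le_mono)
      have "poly p (length y) \<le> S" using poly_nat_mono[OF *(3), of p] by (simp add: S_def)
      moreover have "heads_le (poly p (length y)) (snd c1)" if "(step M)\<^sup>*\<^sup>* ?c c1" for c1
      proof -
        have "\<forall>(g, i)\<in>set (snd c1). i < poly p (length y)"
          using HM(3)[OF *(2)] that unfolding space_bounded_def reaches_def init_config_eq by blast
        then show ?thesis by (force simp: heads_le_def)
      qed
      ultimately have sp: "heads_le S (snd c1)" if "(step M)\<^sup>*\<^sup>* ?c c1" for c1
        using that heads_le_mono by blast
      obtain c' where c': "(step M)\<^sup>*\<^sup>* ?c c'" "stuck (step M) c'"
        using HM(3)[OF *(2)] by (auto simp: halts_def reaches_def init_config_eq stuck_def)
      obtain u \<sigma>s' where 2: "dsteps cstep (\<lambda>c. heads_le S (snd c)) (SIM (start_state M), front @ init_tapes y (ntapes M)) u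
          (Skip, flag (fst c') front @ \<sigma>s')"
        using SIM_deterministic[OF HM(2) c' _ *(1) _ sp, of "init_tapes y (ntapes M)" "\<lambda>_. True"]
          rel_init hl by auto
      have hl': "heads_le S (flag (fst c') front @ \<sigma>s')" using dsteps_end[OF 2] by simp
      let ?e = "(if fst c' = accept_state M then Skip else Fail, flag (fst c') front @ \<sigma>s')"
      have 3: "dsteps cstep (\<lambda>c. heads_le S (snd c)) (accept_test, flag (fst c') front @ \<sigma>s') 1 ?e"
        by (rule dsteps_1) (use hl' cstep_accept_test[OF *(1)] in auto)
      show ?thesis
        using dsteps_trans[OF 1 dsteps_Seq[OF 2 3]] by (intro exI[of _ "?e"] exI conjI) auto
    qed
    then obtain u e where e: "dsteps cstep (\<lambda>c. heads_le S (snd c)) (prog, init_tapes x k) u e" "stuck cstep e"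
      by blast
    have "halts D x" using D(5)[OF al dsteps_imp_rtranclp[OF e(1)] e(2)] .
    moreover have "space_bounded D x (Suc S)"
      using dsteps_deterministic_space[OF e] by (intro D(4)[OF al]) fastforce
    then have "space_bounded D x (poly r (length x))"
      by (fastforce simp: space_bounded_def r_def S_def poly_pcompose intro: less_le_trans)
    moreover have "(\<exists>y. f x = Some y \<and> accepts M y) \<longleftrightarrow> (\<exists>y\<in>L. f x = Some y)"
      using t(2) HM(3) by (auto split: option.splits)
    ultimately show ?thesis using D(3)[OF al] prog_accepts[OF x] by simp
  qed
  then show ?thesis
    using D(1,2) fin by (auto simp: PSPACE_def is_language_def intro!: exI[of _ D] exI[of _ r])
qed

section \<open>Elementary programs\<close>

abbreviation goR :: "nat \<Rightarrow> com" where
  "goR i \<equiv> Put i (\<lambda>rs. rs ! i) GoRight"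

abbreviation goL :: "nat \<Rightarrow> com" where
  "goL i \<equiv> Put i (\<lambda>rs. rs ! i) GoLeft"

abbreviation put :: "nat \<Rightarrow> symbol \<Rightarrow> move \<Rightarrow> com" where
  "put i s m \<equiv> Put i (\<lambda>rs. s) m"

definition Rew :: "nat \<Rightarrow> com" where
  "Rew i = While (\<lambda>rs. rs ! i \<noteq> LeftEnd) (goL i)"

text \<open>\<open>z\<close> recognises cell 0 even if its end marker has been overwritten. The
  first blank bounds the written cells, provided that none of them is blank; erasing then runs
  leftwards down to cell 0, where the marker is restored.\<close>

definition Clean :: "(symbol \<Rightarrow> bool) \<Rightarrow> nat \<Rightarrow> com" where
  "Clean z i = While (\<lambda>rs. rs ! i \<noteq> Blank) (goR i) ;; goL i ;;
     While (\<lambda>rs. \<not> z (rs ! i)) (put i Blank GoLeft) ;; put i LeftEnd Stay"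

lemma wf_com_Rew [simp]: "i < k \<Longrightarrow> wf_com \<Gamma> k (Rew i)"
  and det_com_Rew [simp]: "det_com (Rew i)"
  by (auto simp: Rew_def subset_iff)

lemma wf_com_Clean [simp]: "i < k \<Longrightarrow> wf_com (alph b) k (Clean z i)"
  and det_com_Clean [simp]: "det_com (Clean z i)"
  by (auto simp: Clean_def subset_iff)

lemma exec_Rew:
  assumes "i < length \<sigma>" "\<sigma> ! i = tape_at (LeftEnd # xs) p" "LeftEnd \<notin> set xs"
  shows "exec (Rew i) \<sigma> (3 * p + 1) (Some (\<sigma>[i := tape_at (LeftEnd # xs) 0]))"
  using assms(1,2)
proof (induction p arbitrary: \<sigma>)
  case 0
  then have "\<sigma>[i := tape_at (LeftEnd # xs) 0] = \<sigma>" by (metis list_update_id)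
  then show ?case
    unfolding wp_exec[symmetric] Rew_def
    using 0 by (subst wp_While) (simp add: read_tape_at)
next
  case (Suc p)
  have "(LeftEnd # xs) ! Suc p \<noteq> LeftEnd" if "Suc p < length (LeftEnd # xs)"
    using assms(3) that by (auto simp: in_set_conv_nth)
  then have r: "read (\<sigma> ! i) \<noteq> LeftEnd" using Suc.prems by (auto simp: read_tape_at)
  have a: "act (read (\<sigma> ! i), GoLeft) (\<sigma> ! i) = tape_at (LeftEnd # xs) p"
    unfolding Suc.prems(2) act_tape_at_keep by simp
  have "exec (Rew i) (\<sigma>[i := tape_at (LeftEnd # xs) p]) (3 * p + 1)
      (Some (\<sigma>[i := tape_at (LeftEnd # xs) 0]))"
    using Suc.IH[of "\<sigma>[i := tape_at (LeftEnd # xs) p]"] Suc.prems by simp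
  note e = exec_wp[OF this]
  show ?case
    unfolding wp_exec[symmetric]
    by (subst Rew_def, subst wp_While) (simp add: r a Suc.prems(1) Rew_def[symmetric] e)
qed

lemma exec_Rew_zip:
  assumes "i < length \<sigma>" "\<sigma> ! i = zip_tape (l @ [LeftEnd]) r" "LeftEnd \<notin> set l" "LeftEnd \<notin> set r"
  shows "exec (Rew i) \<sigma> (3 * length l + 4) (Some (\<sigma>[i := zip_tape [] (LeftEnd # rev l @ r)]))"
  using exec_Rew[OF assms(1), of "rev l @ r" "Suc (length l)"] assms by (simp add: zip_tape_def add.commute)

lemma tape_at_erase:
  "0 < p \<Longrightarrow> act (Blank, GoLeft) (tape_at (take (Suc p) xs) p) = tape_at (take p xs) (p - 1)"
  by (auto simp: tape_at_def fun_eq_iff min_def)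

lemma exec_Clean:
  assumes i: "i < length \<sigma>" and "\<sigma> ! i = tape_at (c # cs) p" and c: "c \<noteq> Blank" "Blank \<notin> set cs"
    and z: "z c" "\<not> z Blank" "\<And>s. s \<in> set cs \<Longrightarrow> \<not> z s"
  shows "\<exists>t \<le> 6 * (length cs + p) + 20. exec (Clean z i) \<sigma> t (Some (\<sigma>[i := tape_at [LeftEnd] 0]))"
proof -
  let ?xs = "c # cs" and ?R = "While (\<lambda>rs. rs ! i \<noteq> Blank) (goR i)"
    and ?L = "While (\<lambda>rs. \<not> z (rs ! i)) (put i Blank GoLeft)"
  have R: "exec ?R (\<sigma>[i := tape_at ?xs p]) (3 * (length ?xs - p) + 1) (Some (\<sigma>[i := tape_at ?xs (max p (length ?xs))]))" for p
  proof (induction "length ?xs - p" arbitrary: p)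
    case 0
    then show ?case unfolding wp_exec[symmetric] using i
      by (subst wp_While) (simp add: read_tape_at max_def)
  next
    case (Suc n)
    then have p: "p < length ?xs" by simp
    then have r: "?xs ! p \<noteq> Blank" using c by (metis nth_mem set_ConsD)
    have a: "act (?xs ! p, GoRight) (tape_at ?xs p) = tape_at ?xs (Suc p)"
      using act_tape_at_keep[of ?xs p GoRight] p by (simp add: read_tape_at)
    have "exec ?R (\<sigma>[i := tape_at ?xs (Suc p)]) (3 * (length ?xs - Suc p) + 1)
       (Some (\<sigma>[i := tape_at ?xs (max (Suc p) (length ?xs))]))"
      using Suc.hyps(2) by (intro Suc.hyps(1)) simp
    note e = exec_wp[OF this]
    have m: "max (Suc p) (length ?xs) = max p (length ?xs)" "3 * (length ?xs - p) = 3 + 3 * (length ?xs - Suc p)"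
      using p by auto
    show ?case unfolding wp_exec[symmetric] using i p r
      by (subst wp_While) (simp add: read_tape_at a e m del: length_Cons)
  qed
  have L: "exec ?L (\<sigma>[i := tape_at (take (Suc q) ?xs) q]) (3 * q + 1) (Some (\<sigma>[i := tape_at [c] 0]))" for q
  proof (induction q)
    case 0
    show ?case unfolding wp_exec[symmetric] using i z
      by (subst wp_While) (simp add: read_tape_at)
  next
    case (Suc q)
    have "\<not> z (read (tape_at (take (Suc (Suc q)) ?xs) (Suc q)))"
      using z by (auto simp: read_tape_at)
    moreover have "act (Blank, GoLeft) (tape_at (take (Suc (Suc q)) ?xs) (Suc q)) = tape_at (take (Suc q) ?xs) q"
      using tape_at_erase[of "Suc q" ?xs] by simp
    ultimately show ?case unfolding wp_exec[symmetric] using i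
      by (subst wp_While) (simp add: exec_wp[OF Suc.IH] del: take_Suc_Cons)
  qed
  \<comment> \<open>The first loop stops at the first blank, or at once if the head already stands
    beyond the contents.\<close>
  define m where "m = max p (length ?xs)"
  define t where "t = 3 * (length ?xs - p) + 1 + 1 + (1 + 1 + (3 * (m - 1) + 1 + 1 + 1))"
  have E: "exec (Clean z i) \<sigma> t
      (Some (\<sigma>[i := tape_at [LeftEnd] 0]))"
  proof -
    have s: "\<sigma>[i := tape_at ?xs p] = \<sigma>" using assms(2) by (metis list_update_id)
    have g: "exec (goL i) (\<sigma>[i := tape_at ?xs m]) 1 (Some (\<sigma>[i := tape_at (take (Suc (m - 1)) ?xs) (m - 1)]))"
    proof -
      have "act (read (tape_at ?xs m), GoLeft) (tape_at ?xs m) = tape_at (take (Suc (m - 1)) ?xs) (m - 1)"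
        unfolding act_tape_at_keep using m_def by auto
      then show ?thesis unfolding wp_exec[symmetric] using i by simp
    qed
    have l: "exec (put i LeftEnd Stay) (\<sigma>[i := tape_at [c] 0]) 1 (Some (\<sigma>[i := tape_at [LeftEnd] 0]))"
    proof -
      have "act (LeftEnd, Stay) (tape_at [c] 0) = tape_at [LeftEnd] 0" by (auto simp: tape_at_def fun_eq_iff)
      then show ?thesis unfolding wp_exec[symmetric] using i by simp
    qed
    show ?thesis
      unfolding Clean_def t_def
      by (rule exec_Seq_Some[OF R[of p, unfolded s, folded m_def]], rule exec_Seq_Some[OF g],
          rule exec_Seq_Some[OF L l])
  qed
  have "3 * A + 1 + 1 + (1 + 1 + (3 * B + 1 + 1 + 1)) \<le> 6 * (n + p) + 20"
    if "A \<le> n + 1" "B \<le> p + n" for A B n :: nat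
    using that by simp
  from this[of "length ?xs - p" "length cs" "m - 1"] have "t \<le> 6 * (length cs + p) + 20"
    unfolding t_def by (simp add: m_def)
  then show ?thesis by (intro exI[of _ t] conjI E)
qed

definition Copy :: "nat \<Rightarrow> nat \<Rightarrow> (symbol \<Rightarrow> symbol) \<Rightarrow> com" where
  "Copy i j g = While (\<lambda>rs. rs ! i \<noteq> Blank) (Put j (\<lambda>rs. g (rs ! i)) GoRight ;; goR i)"

definition Transfer :: "nat \<Rightarrow> nat \<Rightarrow> (symbol \<Rightarrow> symbol) \<Rightarrow> com" where
  "Transfer i j g = goR i ;; goR j ;; Copy i j g ;; Rew i ;; Rew j"

lemma wf_com_Transfer [simp]:
  "i < k \<Longrightarrow> j < k \<Longrightarrow> (\<And>s. s \<in> \<Gamma> \<Longrightarrow> g s \<in> \<Gamma>) \<Longrightarrow> wf_com \<Gamma> k (Transfer i j g)"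
  and det_com_Transfer [simp]: "det_com (Transfer i j g)"
  by (auto simp: Transfer_def Copy_def subset_iff)

lemma exec_Copy:
  assumes "i < length \<sigma>" "j < length \<sigma>" "i \<noteq> j"
    and "\<sigma> ! i = zip_tape l (map Sym r)" "\<sigma> ! j = zip_tape l' []" "\<And>a. a \<in> set r \<Longrightarrow> g (Sym a) = Sym (h a)"
  shows "exec (Copy i j g) \<sigma> (5 * length r + 1)
    (Some (\<sigma>[i := zip_tape (map Sym (rev r) @ l) [], j := zip_tape (map Sym (rev (map h r)) @ l') []]))"
  using assms
proof (induction r arbitrary: \<sigma> l l')
  case Nil
  then have "\<sigma>[i := zip_tape l [], j := zip_tape l' []] = \<sigma>"
    by (metis list.map_disc_iff list_update_id)
  then show ?case unfolding wp_exec[symmetric] Copy_def using Nil by (subst wp_While) simp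
next
  case (Cons a r)
  let ?\<sigma> = "\<sigma>[j := zip_tape (Sym (h a) # l') [], i := zip_tape (Sym a # l) (map Sym r)]"
  have u: "\<sigma>[j := x, i := y, i := z, j := w] = \<sigma>[i := z, j := w]" for x y z w
    using \<open>i \<noteq> j\<close> by (simp add: list_update_swap[of i j])
  have "exec (Copy i j g) ?\<sigma> (5 * length r + 1) (Some (?\<sigma>[i := zip_tape (map Sym (rev r) @ Sym a # l) [],
      j := zip_tape (map Sym (rev (map h r)) @ Sym (h a) # l') []]))"
    by (rule Cons.IH) (use Cons.prems in auto)
  note e = exec_wp[OF this[unfolded u]]
  show ?case
    unfolding wp_exec[symmetric]
    by (subst Copy_def, subst wp_While) (use Cons.prems in \<open>simp add: Copy_def[symmetric] e\<close>)
qed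

lemma exec_Transfer:
  assumes "i < length \<sigma>" "j < length \<sigma>" "i \<noteq> j"
    and "\<sigma> ! i = init_tape r" "\<sigma> ! j = init_tape []" "\<And>a. a \<in> set r \<Longrightarrow> g (Sym a) = Sym (h a)"
  shows "exec (Transfer i j g) \<sigma> (11 * length r + 15) (Some (\<sigma>[j := init_tape (map h r)]))"
proof -
  let ?s1 = "\<sigma>[i := zip_tape [LeftEnd] (map Sym r), j := zip_tape [LeftEnd] []]"
  let ?L = "map Sym (rev r)" and ?L' = "map Sym (rev (map h r))"
  let ?s2 = "\<sigma>[i := zip_tape (?L @ [LeftEnd]) [], j := zip_tape (?L' @ [LeftEnd]) []]"
  let ?s3 = "\<sigma>[i := init_tape r, j := zip_tape (?L' @ [LeftEnd]) []]"
  have u: "\<sigma>[i := x, j := y, i := z, j := w] = \<sigma>[i := z, j := w]" for x y z w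
    using \<open>i \<noteq> j\<close> by (simp add: list_update_swap[of j i])
  have u2: "\<sigma>[i := x, j := y, i := z] = \<sigma>[i := z, j := y]" for x y z
    using \<open>i \<noteq> j\<close> by (simp add: list_update_swap[of j i])
  have "exec (Copy i j g) ?s1 (5 * length r + 1) (Some (?s1[i := zip_tape (?L @ [LeftEnd]) [], j := zip_tape (?L' @ [LeftEnd]) []]))"
    by (rule exec_Copy) (use assms in auto)
  note 1 = exec_wp[OF this[unfolded u]]
  have "exec (Rew i) ?s2 (3 * length ?L + 4) (Some (?s2[i := zip_tape [] (LeftEnd # rev ?L @ [])]))"
    by (rule exec_Rew_zip) (use assms in auto)
  then have "exec (Rew i) ?s2 (3 * length r + 4) (Some ?s3)"
    unfolding u2 by (simp add: rev_map init_tape_eq)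
  note 2 = exec_wp[OF this]
  have "exec (Rew j) ?s3 (3 * length ?L' + 4) (Some (?s3[j := zip_tape [] (LeftEnd # rev ?L' @ [])]))"
    by (rule exec_Rew_zip) (use assms in auto)
  moreover have "\<sigma>[i := init_tape r] = \<sigma>" using assms by (metis list_update_id)
  ultimately have "exec (Rew j) ?s3 (3 * length r + 4) (Some (\<sigma>[j := init_tape (map h r)]))"
    by (simp add: rev_map init_tape_eq comp_def)
  note 3 = exec_wp[OF this]
  show ?thesis
    unfolding wp_exec[symmetric] Transfer_def
    using assms by (simp add: init_tape_eq 1 2[unfolded init_tape_eq] 3[unfolded init_tape_eq])
qed

lemma exec_then_dsteps:
  assumes "exec a \<sigma> t (Some \<sigma>')" "dsteps cstep (\<lambda>_. True) (b, \<sigma>') t' c"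
  shows "dsteps cstep (\<lambda>_. True) (a ;; b, \<sigma>) (t + 1 + t') c"
  using dsteps_Seq[where P = "\<lambda>_. True", OF _ assms(2)] exec_dsteps[OF assms(1)] by simp

lemma dsteps_refl: "dsteps R (\<lambda>_. True) c 0 c"
  by (rule dsteps_0) simp

definition accepting :: "com \<times> tape list \<Rightarrow> bool" where
  "accepting c \<longleftrightarrow> (\<exists>\<sigma>. cstep\<^sup>*\<^sup>* c (Skip, \<sigma>))"

lemma accepting_step:
  assumes "fst c \<noteq> Skip"
  shows "accepting c \<longleftrightarrow> (\<exists>c'. cstep c c' \<and> accepting c')"
proof
  assume "accepting c"
  then obtain \<sigma> where "cstep\<^sup>*\<^sup>* c (Skip, \<sigma>)" by (auto simp: accepting_def)
  then show "\<exists>c'. cstep c c' \<and> accepting c'"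
    by (cases rule: converse_rtranclpE) (use assms in \<open>auto simp: accepting_def\<close>)
next
  assume "\<exists>c'. cstep c c' \<and> accepting c'"
  then obtain c' \<sigma> where "cstep c c'" "cstep\<^sup>*\<^sup>* c' (Skip, \<sigma>)" by (auto simp: accepting_def)
  then show "accepting c"
    unfolding accepting_def by (intro exI[of _ \<sigma>] converse_rtranclp_into_rtranclp[of cstep c c'])
qed

lemma accepting_dsteps: "dsteps cstep P c t c' \<Longrightarrow> accepting c \<longleftrightarrow> accepting c'"
  unfolding accepting_def by (simp add: dsteps_reach_stuck[OF _ stuck_Skip])

section \<open>Closure of NP under letter-to-letter projection\<close>

text \<open>A symbol \<open>v\<close> stands for the letter \<open>v div 4\<close> together with the two certificate bits \<open>v mod 4\<close>.\<close>

definition annotated :: "nat set \<Rightarrow> nat set" where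
  "annotated \<Sigma> = {v. v div 4 \<in> \<Sigma>}"

lemma finite_annotated: "finite \<Sigma> \<Longrightarrow> finite (annotated \<Sigma>)"
proof -
  assume "finite \<Sigma>"
  have "annotated \<Sigma> \<subseteq> (\<lambda>(a, c). 4 * a + c) ` (\<Sigma> \<times> {..<4})"
  proof
    fix v assume "v \<in> annotated \<Sigma>"
    then show "v \<in> (\<lambda>(a, c). 4 * a + c) ` (\<Sigma> \<times> {..<4})"
      by (intro image_eqI[of _ _ "(v div 4, v mod 4)"]) (auto simp: annotated_def)
  qed
  then show ?thesis using \<open>finite \<Sigma>\<close> by (auto intro: finite_subset)
qed

lemma annotated_lists: "map (\<lambda>v. v div 4) z \<in> lists \<Sigma> \<longleftrightarrow> z \<in> lists (annotated \<Sigma>)"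
  by (induction z) (auto simp: annotated_def)

text \<open>The result lies in \<open>alph b\<close> whatever is read, so \<open>wf_com\<close>
  holds without knowledge of the tape contents. The default \<open>Blank\<close> is avoided wherever
  the bound on \<open>h a\<close> is established.\<close>

definition lift_sym :: "nat \<Rightarrow> (nat \<Rightarrow> nat) \<Rightarrow> symbol \<Rightarrow> symbol" where
  "lift_sym b h s = (case s of Sym a \<Rightarrow> if h a < b then Sym (h a) else Blank | _ \<Rightarrow> Blank)"

lemma lift_sym_Sym [simp]: "h a < b \<Longrightarrow> lift_sym b h (Sym a) = Sym (h a)"
  by (simp add: lift_sym_def)

lemma lift_sym_alph: "b \<le> b' \<Longrightarrow> lift_sym b h s \<in> alph b'"
  by (auto simp: lift_sym_def split: symbol.splits)

locale np_projection =
  fixes \<Sigma> :: "nat set" and M :: tm and b :: nat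
  assumes mach: "machine M" and fin: "finite \<Sigma>" and b: "\<And>v. v \<in> annotated \<Sigma> \<Longrightarrow> v < b"
begin

text \<open>The input tape doubles as the flag, because it is not read again once the annotation has
  been guessed.\<close>

sublocale simulation M id "\<lambda>r s. s" 0 1
  using mach by unfold_locales auto

definition guess :: com where
  "guess = Choose 1 ((\<lambda>c rs. lift_sym b (\<lambda>a. 4 * a + c) (rs ! 0)) ` {..<4}) GoRight"

definition guess_loop :: com where
  "guess_loop = While (\<lambda>rs. rs ! 0 \<noteq> Blank) (guess ;; goR 0)"

definition run :: com where
  "run = Rew 1 ;; SIM (start_state M) ;; accept_test"

definition prog :: com where
  "prog = goR 0 ;; goR 1 ;; guess_loop ;; run"

definition tapes :: "nat list \<Rightarrow> nat list \<Rightarrow> nat list \<Rightarrow> tape list" where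
  "tapes x r z = zip_tape (map Sym (rev x) @ [LeftEnd]) (map Sym r) #
     zip_tape (map Sym (rev z) @ [LeftEnd]) [] # replicate (ntapes M - 1) (init_tape [])"

text \<open>The leading \<open>Skip\<close> is what remains of the choice; from there to the next
  loop test the run is forced.\<close>

lemma guess_round:
  assumes "c < 4" "a \<in> \<Sigma>"
  shows "dsteps cstep (\<lambda>_. True)
     (((Skip ;; goR 0) ;; guess_loop) ;; run, (tapes x (a # r) z)[1 := zip_tape (map Sym (rev (z @ [4 * a + c])) @ [LeftEnd]) []])
     3 (guess_loop ;; run, tapes (x @ [a]) r (z @ [4 * a + c]))"
proof -
  have "exec (Skip ;; goR 0) ((tapes x (a # r) z)[1 := zip_tape (map Sym (rev (z @ [4 * a + c])) @ [LeftEnd]) []]) 2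
      (Some (tapes (x @ [a]) r (z @ [4 * a + c])))"
    unfolding wp_exec[symmetric] by (simp add: tapes_def)
  from exec_then_dsteps[OF this dsteps_refl]
  have "dsteps cstep (\<lambda>_. True) ((Skip ;; goR 0) ;; guess_loop, (tapes x (a # r) z)[1 := zip_tape (map Sym (rev (z @ [4 * a + c])) @ [LeftEnd]) []])
     (2 + 1 + 0) (guess_loop, tapes (x @ [a]) r (z @ [4 * a + c]))" .
  from dsteps_Seq_context[OF this refl refl, of "\<lambda>_. True" run] show ?thesis
    by (simp add: numeral_3_eq_3)
qed

lemma guess_step:
  assumes "a \<in> \<Sigma>"
  shows "cstep ((((guess ;; goR 0) ;; guess_loop) ;; run), tapes x (a # r) z) c \<longleftrightarrow>
    (\<exists>d<4. c = (((Skip ;; goR 0) ;; guess_loop) ;; run,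
      (tapes x (a # r) z)[1 := zip_tape (map Sym (rev (z @ [4 * a + d])) @ [LeftEnd]) []]))"
proof -
  have *: "4 * a + d < b" if "d < 4" for d
    using b[of "4 * a + d"] assms that by (simp add: annotated_def)
  have "guess \<noteq> Skip" by (simp add: guess_def)
  moreover have "cstep (guess, tapes x (a # r) z) c \<longleftrightarrow> (\<exists>d<4. c = (Skip,
      (tapes x (a # r) z)[1 := zip_tape (map Sym (rev (z @ [4 * a + d])) @ [LeftEnd]) []]))" for c
    unfolding guess_def using * by (force simp: tapes_def)
  ultimately show ?thesis by (auto simp: cstep_Seq)
qed

lemma loop_step:
  "cstep (guess_loop ;; run, tapes x (a # r) z) c \<longleftrightarrow>
     c = (((guess ;; goR 0) ;; guess_loop) ;; run, tapes x (a # r) z)"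
  by (auto simp: cstep_Seq guess_loop_def tapes_def)

lemma loop_end:
  "dsteps cstep (\<lambda>_. True) (guess_loop ;; run, tapes x [] z) (3 * length z + 7)
     (SIM (start_state M) ;; accept_test, [hd (tapes x [] z)] @ init_tapes z (ntapes M))"
proof -
  have 1: "exec guess_loop (tapes x [] z) 1 (Some (tapes x [] z))"
    unfolding wp_exec[symmetric] guess_loop_def by (subst wp_While) (simp add: tapes_def)
  have "exec (Rew 1) (tapes x [] z) (3 * length z + 4)
      (Some ((tapes x [] z)[1 := zip_tape [] (LeftEnd # rev (map Sym (rev z)) @ [])]))"
    using exec_Rew_zip[of 1 "tapes x [] z" "map Sym (rev z)" "[]"]
    by (auto simp: tapes_def)
  then have 2: "exec (Rew 1) (tapes x [] z) (3 * length z + 4)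
      (Some ([hd (tapes x [] z)] @ init_tapes z (ntapes M)))"
    by (simp add: tapes_def init_tapes_def init_tape_eq rev_map)
  have "dsteps cstep (\<lambda>_. True) (guess_loop ;; run, tapes x [] z) (1 + 1 + (3 * length z + 4 + 1 + 0))
     (SIM (start_state M) ;; accept_test, [hd (tapes x [] z)] @ init_tapes z (ntapes M))"
    unfolding run_def
    by (rule exec_then_dsteps[OF 1 exec_then_dsteps[OF 2 dsteps_refl]])
  then show ?thesis by (simp add: eval_nat_numeral)
qed

lemma rel_init: "rel (init_tapes y (ntapes M)) (init_tapes y (ntapes M))"
  using mach by (auto simp: rel_def init_tapes_def machine_def list_all2_conv_all_nth)

lemma init_config_eq: "init_config M y = (start_state M, init_tapes y (ntapes M))"
  by (simp add: init_config_def init_tapes_def)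

text \<open>Generalised over the part \<open>z\<close> already guessed: each choice moves one letter
  from the unread \<open>r\<close> to \<open>z\<close>, and the four values of \<open>d\<close> are
  exactly the letters \<open>v\<close> with \<open>v div 4 = a\<close>.\<close>

lemma loop_accepting:
  assumes "set r \<subseteq> \<Sigma>"
  shows "accepting (guess_loop ;; run, tapes x r z) \<longleftrightarrow>
     (\<exists>w. map (\<lambda>v. v div 4) w = r \<and> accepts M (z @ w))"
  using assms
proof (induction r arbitrary: x z)
  case Nil
  have "accepting (guess_loop ;; run, tapes x [] z) \<longleftrightarrow> accepts M z"
    unfolding accepting_dsteps[OF loop_end]
    using SIM_test_accepts[OF rel_init[of z], of "[hd (tapes x [] z)]"]
    by (auto simp: accepting_def accepts_def reaches_def init_config_eq)
  then show ?case by simp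
next
  case (Cons a r)
  have a: "a \<in> \<Sigma>" using Cons.prems by simp
  have "accepting (guess_loop ;; run, tapes x (a # r) z) \<longleftrightarrow>
      accepting (((guess ;; goR 0) ;; guess_loop) ;; run, tapes x (a # r) z)"
    by (subst accepting_step) (simp_all add: loop_step)
  also have "\<dots> \<longleftrightarrow> (\<exists>d<4. accepting (guess_loop ;; run, tapes (x @ [a]) r (z @ [4 * a + d])))"
    using accepting_dsteps[OF guess_round[OF _ a, of _ x r z]]
    by (subst accepting_step) (auto simp: guess_step[OF a])
  also have "\<dots> \<longleftrightarrow> (\<exists>d<4. \<exists>w. map (\<lambda>v. v div 4) w = r \<and> accepts M (z @ (4 * a + d) # w))"
    using Cons by simp
  also have "\<dots> \<longleftrightarrow> (\<exists>v w. v div 4 = a \<and> map (\<lambda>v. v div 4) w = r \<and> accepts M (z @ v # w))"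
  proof safe
    fix d w assume "d < (4 :: nat)" "accepts M (z @ (4 * a + d) # w)" "r = map (\<lambda>v. v div 4) w"
    then show "\<exists>v wa. v div 4 = a \<and> map (\<lambda>v. v div 4) wa = map (\<lambda>v. v div 4) w \<and> accepts M (z @ v # wa)"
      by (intro exI[of _ "4 * a + d"] exI[of _ w]) auto
  next
    fix v w assume "accepts M (z @ v # w)" "a = v div 4" "r = map (\<lambda>v. v div 4) w"
    then show "\<exists>d<4. \<exists>wa. map (\<lambda>v. v div 4) wa = map (\<lambda>v. v div 4) w \<and> accepts M (z @ (4 * (v div 4) + d) # wa)"
      by (intro exI[of _ "v mod 4"]) auto
  qed
  also have "\<dots> \<longleftrightarrow> (\<exists>w. map (\<lambda>v. v div 4) w = a # r \<and> accepts M (z @ w))"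
  proof
    assume "\<exists>v w. v div 4 = a \<and> map (\<lambda>v. v div 4) w = r \<and> accepts M (z @ v # w)"
    then obtain v w where "v div 4 = a" "map (\<lambda>v. v div 4) w = r" "accepts M (z @ v # w)" by blast
    then show "\<exists>w. map (\<lambda>v. v div 4) w = a # r \<and> accepts M (z @ w)" by (intro exI[of _ "v # w"]) simp
  next
    assume "\<exists>w. map (\<lambda>v. v div 4) w = a # r \<and> accepts M (z @ w)"
    then obtain w where "map (\<lambda>v. v div 4) w = a # r" "accepts M (z @ w)" by (elim exE conjE)
    then show "\<exists>v w. v div 4 = a \<and> map (\<lambda>v. v div 4) w = r \<and> accepts M (z @ v # w)"
      by (cases w) auto
  qed
  finally show ?case .
qed

text \<open>The \<open>5\<close> per letter are the loop test, the choice and three forced steps;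
  the \<open>3\<close> per letter rewind the guess; \<open>10\<close> is the \<open>7\<close> of
  \<open>loop_end\<close> and the \<open>3\<close> of the simulation with its test. The time bound
  is assumed for all annotations since every guess is a computation path.\<close>

lemma loop_bounded:
  assumes "set r \<subseteq> \<Sigma>"
    and "\<And>w. map (\<lambda>v. v div 4) w = map (\<lambda>v. v div 4) z @ r \<Longrightarrow> time_bounded M w T"
  shows "bounded_steps cstep (guess_loop ;; run, tapes x r z) (5 * length r + 3 * (length z + length r) + T + 10)"
  using assms
proof (induction r arbitrary: x z)
  case Nil
  have "time_bounded M z T" using Nil by simp
  then have "bounded_steps (step M) (start_state M, init_tapes z (ntapes M)) T"
    by (simp add: time_bounded_def bounded_steps_def init_config_eq)
  from bounded_steps_dsteps[OF loop_end bounded_steps_SIM_test[OF this rel_init]]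
  show ?case by (simp add: add.commute add.left_commute)
next
  case (Cons a r)
  have a: "a \<in> \<Sigma>" using Cons.prems by simp
  let ?T = "5 * length r + 3 * (Suc (length z) + length r) + T + 10"
  have "bounded_steps cstep (guess_loop ;; run, tapes (x @ [a]) r (z @ [4 * a + d])) ?T" if "d < 4" for d
  proof -
    have "bounded_steps cstep (guess_loop ;; run, tapes (x @ [a]) r (z @ [4 * a + d]))
       (5 * length r + 3 * (length (z @ [4 * a + d]) + length r) + T + 10)"
      by (rule Cons.IH) (use Cons.prems that in auto)
    then show ?thesis by simp
  qed
  from bounded_steps_dsteps[OF guess_round[OF _ a] this]
  have 1: "bounded_steps cstep (((guess ;; goR 0) ;; guess_loop) ;; run, tapes x (a # r) z) (Suc (3 + ?T))"
    by (intro bounded_steps_Suc) (unfold guess_step[OF a], blast)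
  have "bounded_steps cstep (guess_loop ;; run, tapes x (a # r) z) (Suc (Suc (3 + ?T)))"
    by (rule bounded_steps_Suc) (unfold loop_step, use 1 in blast)
  then show ?case by (rule bounded_steps_mono) simp
qed

lemma prog_start:
  "dsteps cstep (\<lambda>_. True) (prog, init_tapes x (Suc (ntapes M))) 4 (guess_loop ;; run, tapes [] x [])"
proof -
  have 1: "exec (goR 0) (init_tapes x (Suc (ntapes M))) 1 (Some
     (zip_tape [LeftEnd] (map Sym x) # replicate (ntapes M) (init_tape [])))"
    unfolding wp_exec[symmetric] by (simp add: init_tapes_def init_tape_eq)
  have 2: "exec (goR 1) (zip_tape [LeftEnd] (map Sym x) # replicate (ntapes M) (init_tape [])) 1
     (Some (tapes [] x []))"
    unfolding wp_exec[symmetric] using mach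
    by (cases "ntapes M") (simp_all add: machine_def tapes_def init_tape_eq)
  have "dsteps cstep (\<lambda>_. True) (prog, init_tapes x (Suc (ntapes M))) (1 + 1 + (1 + 1 + 0)) (guess_loop ;; run, tapes [] x [])"
    unfolding prog_def
    by (rule exec_then_dsteps[OF 1 exec_then_dsteps[OF 2 dsteps_refl]])
  then show ?thesis by (simp add: eval_nat_numeral)
qed

end

theorem NP_projection:
  assumes L: "(annotated \<Sigma>, L) \<in> NP" and fin: "finite \<Sigma>"
  shows "(\<Sigma>, {x \<in> lists \<Sigma>. \<exists>z\<in>L. map (\<lambda>v. v div 4) z = x}) \<in> NP"
proof -
  obtain M p where HM: "machine M"
    "\<And>y. y \<in> lists (annotated \<Sigma>) \<Longrightarrow> time_bounded M y (poly p (length y)) \<and> (accepts M y \<longleftrightarrow> y \<in> L)"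
    using L by (auto simp: NP_def)
  have Lsub: "L \<subseteq> lists (annotated \<Sigma>)" using L by (auto simp: NP_def is_language_def)
  obtain b1 where b1: "Sym ` (annotated \<Sigma>) \<subseteq> alph b1"
    using finite_symbols_alph[of "Sym ` annotated \<Sigma>"] finite_annotated[OF fin] by blast
  interpret np_projection \<Sigma> M b1
    by unfold_locales (use HM fin b1 in auto)
  obtain b2 where b2: "\<And>q rs q' as a. (q, rs, q', as) \<in> delta M \<Longrightarrow> a \<in> set as \<Longrightarrow> fst a \<in> alph b2"
    using machine_alph[OF HM(1)] by blast
  obtain b3 where b3: "Sym ` \<Sigma> \<subseteq> alph b3" using finite_symbols_alph[of "Sym ` \<Sigma>"] fin by blast
  define b where "b = b1 + b2 + b3 + 2"
  have al: "alph b2 \<subseteq> alph b" "alph b3 \<subseteq> alph b" by (auto intro!: alph_mono simp: b_def)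
  have wf: "wf_com (alph b) (Suc (ntapes M)) prog"
  proof -
    have "wf_com (alph b) (Suc (ntapes M)) (SIM (start_state M))"
      using al b2 HM(1) by (fastforce simp: b_def)
    moreover have "0 < ntapes M" using HM(1) by (simp add: machine_def)
    ultimately show ?thesis
      by (auto simp: prog_def run_def accept_test_def guess_loop_def guess_def b_def subset_iff
          intro!: lift_sym_alph simp del: wf_com.simps(8))
  qed
  obtain D where D: "machine D" "\<And>x. Sym ` set x \<subseteq> alph b \<Longrightarrow>
      accepts D x \<longleftrightarrow> accepting (prog, init_tapes x (Suc (ntapes M)))"
    "\<And>x T. Sym ` set x \<subseteq> alph b \<Longrightarrow>
      bounded_steps cstep (prog, init_tapes x (Suc (ntapes M))) T \<Longrightarrow> time_bounded D x T"
    by (rule compile[OF _ finite_alph _ _ wf]) (auto simp: init_tapes_def accepting_def)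
  \<comment> \<open>\<open>8\<close> is \<open>5 + 3\<close> per letter, and \<open>14\<close> is
    the constant \<open>10\<close> of \<open>loop_bounded\<close> plus the four steps of
    \<open>prog_start\<close>.\<close>
  define r where "r = p + [:14, 8:]"
  have "time_bounded D x (poly r (length x)) \<and> (accepts D x \<longleftrightarrow> (\<exists>z\<in>L. map (\<lambda>v. v div 4) z = x))"
    if x: "x \<in> lists \<Sigma>" for x
  proof -
    have "set x \<subseteq> \<Sigma>" using x by auto
    then have alx: "Sym ` set x \<subseteq> alph b" using b3 al(2) by blast
    have tb: "time_bounded M w (poly p (length x))" if "map (\<lambda>v. v div 4) w = map (\<lambda>v. v div 4) [] @ x" for w
      using HM(2)[of w] x that annotated_lists[of w \<Sigma>] by auto
    have "bounded_steps cstep (guess_loop ;; run, tapes [] x []) (5 * length x + 3 * (length ([] :: nat list) + length x) + poly p (length x) + 10)"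
      by (rule loop_bounded) (use x tb in auto)
    from bounded_steps_dsteps[OF prog_start this]
    have "bounded_steps cstep (prog, init_tapes x (Suc (ntapes M))) (poly r (length x))"
      by (rule bounded_steps_mono) (simp add: r_def)
    moreover have "accepting (prog, init_tapes x (Suc (ntapes M))) \<longleftrightarrow> (\<exists>w. map (\<lambda>v. v div 4) w = x \<and> accepts M w)"
      unfolding accepting_dsteps[OF prog_start] using loop_accepting[of x "[]" "[]"] x by auto
    moreover have "\<dots> \<longleftrightarrow> (\<exists>z\<in>L. map (\<lambda>v. v div 4) z = x)"
    proof -
      have "w \<in> lists (annotated \<Sigma>)" if "map (\<lambda>v. v div 4) w = x" for w
        using annotated_lists[of w \<Sigma>] x that by simp
      then show ?thesis using HM(2) by blast
    qed
    ultimately show ?thesis using D(2,3)[OF alx] by simp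
  qed
  then show ?thesis
    using D(1) fin by (auto simp: NP_def is_language_def intro!: exI[of _ D] exI[of _ r])
qed

section \<open>Closure of PSPACE under letter-to-letter projection\<close>

text \<open>
  Machine \<open>M\<close> is run on all annotations of the input in turn, so its tapes have to be cleared after
  each run. To this end the simulation never writes a blank: symbols below \<open>B\<close> stand for
  themselves, and \<open>B + 2 * code s\<close> stands for \<open>s\<close>, with \<open>1\<close> added in cell 0. Hence the visited cells
  are found by going right to the first blank and back to the cell with the mark.
\<close>

fun code :: "symbol \<Rightarrow> nat" where
  "code Blank = 0"
| "code LeftEnd = 1"
| "code (Sym n) = n + 2"

definition decode :: "nat \<Rightarrow> symbol" where
  "decode n = (if n = 0 then Blank else if n = 1 then LeftEnd else Sym (n - 2))"

text \<open>\<open>LeftEnd\<close> can be trusted: initially it stands in cell 0 only, and when the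
  simulated machine writes it elsewhere it appears as an encoded \<open>Sym\<close>.\<close>

fun in_cell0 :: "nat \<Rightarrow> symbol \<Rightarrow> bool" where
  "in_cell0 B Blank = False"
| "in_cell0 B LeftEnd = True"
| "in_cell0 B (Sym n) = (B \<le> n \<and> odd (n - B))"

definition mark :: "nat \<Rightarrow> symbol \<Rightarrow> symbol \<Rightarrow> symbol" where
  "mark B r s = Sym (B + 2 * code s + (if in_cell0 B r then 1 else 0))"

fun unmark :: "nat \<Rightarrow> symbol \<Rightarrow> symbol" where
  "unmark B (Sym n) = (if n < B then Sym n else decode ((n - B) div 2))"
| "unmark B s = s"

lemma decode_code [simp]: "decode (code s) = s"
  by (cases s) (auto simp: decode_def)

lemma unmark_mark [simp]: "unmark B (mark B r s) = s"
  by (simp add: mark_def)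

lemma in_cell0_mark [simp]: "in_cell0 B (mark B r s) = in_cell0 B r"
  by (simp add: mark_def)

lemma mark_not_Blank [simp]: "mark B r s \<noteq> Blank"
  by (simp add: mark_def)

lemma act_tape_at:
  "p < length xs \<Longrightarrow> act (s, m) (tape_at xs p) = tape_at (xs[p := s]) (move_head m p)"
  "p = length xs \<Longrightarrow> act (s, m) (tape_at xs p) = tape_at (xs @ [s]) (move_head m p)"
  by (auto simp: tape_at_def fun_eq_iff nth_append)

text \<open>The head is at most one cell beyond the written ones, so a write either replaces a cell
  or appends one and never leaves a gap.\<close>

definition clearable :: "nat \<Rightarrow> nat \<Rightarrow> tape \<Rightarrow> bool" where
  "clearable B S \<tau> \<longleftrightarrow> (\<exists>c cs p. \<tau> = tape_at (c # cs) p \<and> length cs \<le> S \<and> p \<le> Suc (length cs) \<and>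
     in_cell0 B c \<and> (\<forall>s\<in>set cs. s \<noteq> Blank \<and> \<not> in_cell0 B s))"

lemma move_head_le: "move_head m p \<le> Suc p"
  by (cases m) auto

text \<open>An encoded write is never blank and keeps the mark of the cell
  (\<open>in_cell0_mark\<close>). It appends a cell only at a position up to \<open>S\<close>, which
  preserves the length bound.\<close>

lemma clearable_act:
  assumes "clearable B S \<tau>" "snd \<tau> \<le> S"
  shows "clearable B S (act (mark B (read \<tau>) s, m) \<tau>)"
proof -
  obtain c cs p where \<tau>: "\<tau> = tape_at (c # cs) p" "length cs \<le> S" "p \<le> Suc (length cs)"
     "in_cell0 B c" and cs: "\<And>s. s \<in> set cs \<Longrightarrow> s \<noteq> Blank \<and> \<not> in_cell0 B s"
    using assms(1) by (auto simp: clearable_def)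
  have p: "p \<le> S" using assms(2) \<tau>(1) by (simp add: tape_at_def)
  let ?w = "mark B (read \<tau>) s"
  consider "p = 0" | q where "p = Suc q" "q < length cs" | "p = Suc (length cs)"
    using \<tau>(3) by (cases p) force+
  then show ?thesis
  proof cases
    case 1
    then have "act (?w, m) \<tau> = tape_at (?w # cs) (move_head m 0)"
      by (simp add: \<tau>(1) act_tape_at)
    moreover have "in_cell0 B ?w" using 1 \<tau> by (simp add: read_tape_at)
    ultimately show ?thesis
      unfolding clearable_def using \<tau>(2) cs move_head_le[of m 0]
      by (intro exI[of _ ?w] exI[of _ cs] exI[of _ "move_head m 0"]) auto
  next
    case 2
    then have "act (?w, m) \<tau> = tape_at (c # cs[q := ?w]) (move_head m p)"
      by (simp add: \<tau>(1) act_tape_at)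
    moreover have "\<not> in_cell0 B ?w" using 2 \<tau> cs by (simp add: read_tape_at)
    moreover have "\<forall>s'\<in>set (cs[q := ?w]). s' \<noteq> Blank \<and> \<not> in_cell0 B s'"
    proof
      fix s' assume "s' \<in> set (cs[q := ?w])"
      then have "s' = ?w \<or> s' \<in> set cs" using set_update_subset_insert[of cs q ?w] by blast
      then show "s' \<noteq> Blank \<and> \<not> in_cell0 B s'"
        using cs mark_not_Blank[of B "read \<tau>" s] \<open>\<not> in_cell0 B ?w\<close> by auto
    qed
    ultimately show ?thesis
      unfolding clearable_def using \<tau>(2,4) move_head_le[of m p] 2
      by (intro exI[of _ c] exI[of _ "cs[q := ?w]"] exI[of _ "move_head m p"]) auto
  next
    case 3
    then have "act (?w, m) \<tau> = tape_at (c # cs @ [?w]) (move_head m p)"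
      by (simp add: \<tau>(1) act_tape_at)
    moreover have "\<not> in_cell0 B ?w" using 3 \<tau> by (simp add: read_tape_at)
    ultimately show ?thesis
      unfolding clearable_def using \<tau>(2,4) cs move_head_le[of m p] 3 p
      by (intro exI[of _ c] exI[of _ "cs @ [?w]"] exI[of _ "move_head m p"]) auto
  qed
qed

lemma clearable_init:
  assumes "length y \<le> S" "\<And>v. v \<in> set y \<Longrightarrow> v < B"
  shows "clearable B S (init_tape y)"
  unfolding clearable_def
  by (intro exI[of _ LeftEnd] exI[of _ "map Sym y"] exI[of _ 0])
    (use assms in \<open>auto simp: init_tape_eq zip_tape_def not_le\<close>)

lemma init_tape_Nil: "init_tape [] = tape_at [LeftEnd] 0"
  by (simp add: init_tape_eq zip_tape_def)

section \<open>Erasing the work tapes between two attempts\<close>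

fun clear_tapes :: "nat \<Rightarrow> nat \<Rightarrow> nat \<Rightarrow> com" where
  "clear_tapes B off 0 = Skip"
| "clear_tapes B off (Suc j) = clear_tapes B off j ;; Clean (in_cell0 B) (off + j)"

lemma wf_com_clear_tapes [simp]: "off + j \<le> k \<Longrightarrow> wf_com (alph b) k (clear_tapes B off j)"
  and det_com_clear_tapes [simp]: "det_com (clear_tapes B off j)"
  by (induction j) auto

lemma exec_clear_tapes:
  assumes "\<forall>\<tau>\<in>set \<sigma>s. clearable B S \<tau>" "j \<le> length \<sigma>s"
  shows "\<exists>t \<le> j * (12 * S + 30). exec (clear_tapes B (length front) j) (front @ \<sigma>s) t
     (Some (front @ replicate j (init_tape []) @ drop j \<sigma>s))"
  using assms(2)
proof (induction j)
  case 0
  show ?case by (auto intro: exec_Skip)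
next
  case (Suc j)
  then obtain t where t: "t \<le> j * (12 * S + 30)" "exec (clear_tapes B (length front) j) (front @ \<sigma>s) t
     (Some (front @ replicate j (init_tape []) @ drop j \<sigma>s))" by auto
  have "clearable B S (\<sigma>s ! j)" using assms Suc.prems by auto
  then obtain c cs p where *: "\<sigma>s ! j = tape_at (c # cs) p" "length cs \<le> S" "p \<le> Suc (length cs)"
     "in_cell0 B c" "\<forall>s\<in>set cs. s \<noteq> Blank \<and> \<not> in_cell0 B s" by (auto simp: clearable_def)
  let ?\<sigma> = "front @ replicate j (init_tape []) @ drop j \<sigma>s"
  have d: "drop j \<sigma>s = \<sigma>s ! j # drop (Suc j) \<sigma>s" using Suc.prems by (simp add: Cons_nth_drop_Suc)
  have "c \<noteq> Blank" using * by auto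
  then have "\<exists>u \<le> 6 * (length cs + p) + 20. exec (Clean (in_cell0 B) (length front + j)) ?\<sigma> u
      (Some (?\<sigma>[length front + j := tape_at [LeftEnd] 0]))"
    by (intro exec_Clean[where c = c]) (use * d Suc.prems in \<open>auto simp: nth_append\<close>)
  moreover have "?\<sigma>[length front + j := tape_at [LeftEnd] 0] = front @ replicate (Suc j) (init_tape []) @ drop (Suc j) \<sigma>s"
    unfolding d by (simp add: list_update_append init_tape_Nil replicate_app_Cons_same)
  ultimately obtain u where u: "u \<le> 6 * (length cs + p) + 20" "exec (Clean (in_cell0 B) (length front + j)) ?\<sigma> u
      (Some (front @ replicate (Suc j) (init_tape []) @ drop (Suc j) \<sigma>s))" by auto
  have "exec (clear_tapes B (length front) (Suc j)) (front @ \<sigma>s) (t + 1 + u)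
      (Some (front @ replicate (Suc j) (init_tape []) @ drop (Suc j) \<sigma>s))"
    unfolding clear_tapes.simps by (rule exec_Seq_Some[OF t(2) u(2)])
  moreover have "t + 1 + u \<le> Suc j * (12 * S + 30)" using t(1) u(1) *(2,3) by simp
  ultimately show ?case by blast
qed

subsection \<open>Counting through the annotations\<close>

text \<open>A base 4 counter on the digits \<open>v mod 4\<close>, least significant digit first so
  that it starts at the left end of the tape. The boolean reports overflow.\<close>

fun increment :: "nat list \<Rightarrow> bool \<times> nat list" where
  "increment [] = (True, [])"
| "increment (v # vs) = (if v mod 4 = 3 then map_prod id ((#) (v - 3)) (increment vs) else (False, (v + 1) # vs))"

fun annot_val :: "nat list \<Rightarrow> nat" where
  "annot_val [] = 0"
| "annot_val (v # vs) = v mod 4 + 4 * annot_val vs"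

lemma annot_val_less: "annot_val vs < 4 ^ length vs"
proof (induction vs)
  case (Cons v vs)
  have "v mod 4 < 4" by simp
  moreover have "annot_val vs + 1 \<le> 4 ^ length vs" using Cons by simp
  ultimately show ?case unfolding annot_val.simps length_Cons power_Suc by linarith
qed simp

lemma mod4_3:
  assumes "v mod 4 = (3 :: nat)"
  shows "(v - 3) div 4 = v div 4" "(v - 3) mod 4 = 0"
proof -
  have v: "v = 4 * (v div 4) + 3" using assms by (metis mult_div_mod_eq)
  then have "v - 3 = 4 * (v div 4)" by simp
  then show "(v - 3) div 4 = v div 4" "(v - 3) mod 4 = 0" by simp_all
qed

lemma mod4_less: "v mod 4 \<noteq> (3 :: nat) \<Longrightarrow> Suc v div 4 = v div 4 \<and> Suc v mod 4 = Suc (v mod 4)"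
  by (simp add: div_Suc mod_Suc)

lemma increment_div: "map (\<lambda>v. v div 4) (snd (increment vs)) = map (\<lambda>v. v div 4) vs"
  by (induction vs) (auto simp: mod4_3 mod4_less)

lemma increment_val:
  "if fst (increment vs) then Suc (annot_val vs) = 4 ^ length vs
   else annot_val (snd (increment vs)) = Suc (annot_val vs)"
  by (induction vs) (auto simp: mod4_3 mod4_less)

text \<open>Base 4 digits are unique, so fixed letters leave one word per counter value; counting
  through the values is therefore exhaustive.\<close>

lemma annot_val_inj:
  "map (\<lambda>v. v div 4) vs = map (\<lambda>v. v div 4) ws \<Longrightarrow> annot_val vs = annot_val ws \<Longrightarrow> vs = ws"
proof (induction vs arbitrary: ws)
  case (Cons v vs)
  then obtain w ws' where ws: "ws = w # ws'" "v div 4 = w div 4" "map (\<lambda>v. v div 4) vs = map (\<lambda>v. v div 4) ws'"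
    by (auto simp: Cons_eq_map_conv)
  have "v mod 4 + 4 * annot_val vs = w mod 4 + 4 * annot_val ws'" using Cons.prems ws by simp
  moreover have "a = b \<and> x = y" if "a + 4 * x = b + 4 * y" "a < 4" "b < 4" for a b x y :: nat
    using that by presburger
  ultimately have "v mod 4 = w mod 4" "annot_val vs = annot_val ws'" by (metis mod_less_divisor zero_less_numeral)+
  then show ?case using Cons.IH[of ws'] ws by (metis div_mult_mod_eq)
qed simp

lemma annot_val_zero: "annot_val (map (\<lambda>a. 4 * a) x) = 0"
  by (induction x) auto

lemma increment_append:
  assumes "\<forall>v\<in>set xs. v mod 4 = 3" "ys = [] \<or> hd ys mod 4 \<noteq> 3"
  shows "increment (xs @ ys) = (ys = [], map (\<lambda>v. v - 3) xs @ (if ys = [] then [] else (hd ys + 1) # tl ys))"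
  using assms
proof (induction xs)
  case Nil
  then show ?case by (cases ys) auto
qed auto

fun carries :: "symbol \<Rightarrow> bool" where
  "carries (Sym v) = (v mod 4 = 3)"
| "carries _ = False"

definition carry_loop :: "nat \<Rightarrow> com" where
  "carry_loop B = While (\<lambda>rs. carries (rs ! 1)) (Put 1 (\<lambda>rs. lift_sym B (\<lambda>v. v - 3) (rs ! 1)) GoRight)"

text \<open>A blank after the carries means overflow. The flag value 1 is kept in that case, so that
  running out of annotations does not erase an acceptance just recorded.\<close>

definition Increment :: "nat \<Rightarrow> com" where
  "Increment B = goR 1 ;; carry_loop B ;;
     Cond (\<lambda>rs. rs ! 1 = Blank)
       (Put 0 (\<lambda>rs. if rs ! 0 = Sym 1 then Sym 1 else Sym 2) Stay)
       (Put 1 (\<lambda>rs. lift_sym B (\<lambda>v. v + 1) (rs ! 1)) Stay) ;;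
     Rew 1"

lemmas wp_carry_loop = wp_While[of "\<lambda>rs. carries (rs ! 1)"
  "Put 1 (\<lambda>rs. lift_sym B (\<lambda>v. v - 3) (rs ! 1)) GoRight" for B, folded carry_loop_def]

lemma exec_carry_loop:
  assumes "\<forall>v\<in>set xs. v mod 4 = 3 \<and> v < B" "ys = [] \<or> hd ys mod 4 \<noteq> 3"
  shows "exec (carry_loop B) (\<tau> # zip_tape l (map Sym (xs @ ys)) # rest) (3 * length xs + 1)
    (Some (\<tau> # zip_tape (map Sym (rev (map (\<lambda>v. v - 3) xs)) @ l) (map Sym ys) # rest))"
  using assms(1)
proof (induction xs arbitrary: l)
  case Nil
  then show ?case unfolding wp_exec[symmetric] using assms(2)
    by (subst wp_carry_loop) (cases ys; simp)
next
  case (Cons v xs)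
  have "exec (carry_loop B) (\<tau> # zip_tape (Sym (v - 3) # l) (map Sym (xs @ ys)) # rest) (3 * length xs + 1)
    (Some (\<tau> # zip_tape (map Sym (rev (map (\<lambda>v. v - 3) xs)) @ Sym (v - 3) # l) (map Sym ys) # rest))"
    by (rule Cons.IH) (use Cons.prems in simp)
  note e = exec_wp[OF this]
  have l: "lift_sym B (\<lambda>v. v - 3) (Sym v) = Sym (v - 3)"
    using Cons.prems by (intro lift_sym_Sym) auto
  show ?case unfolding wp_exec[symmetric]
    by (subst wp_carry_loop) (use Cons.prems in \<open>simp add: e[simplified] l\<close>)
qed

lemma exec_Increment:
  assumes "\<forall>v\<in>set z. v < B \<and> (v mod 4 < 3 \<longrightarrow> v + 1 < B)"
  shows "\<exists>t \<le> 6 * length z + 20. exec (Increment B) (\<tau> # init_tape z # rest) t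
    (Some ((if fst (increment z) then act (if read \<tau> = Sym 1 then Sym 1 else Sym 2, Stay) \<tau> else \<tau>)
       # init_tape (snd (increment z)) # rest))"
proof -
  define xs where "xs = takeWhile (\<lambda>v. v mod 4 = 3) z"
  define ys where "ys = dropWhile (\<lambda>v. v mod 4 = 3) z"
  define xs' where "xs' = map (\<lambda>v. v - 3) xs"
  have z: "z = xs @ ys" by (simp add: xs_def ys_def)
  have xs: "\<forall>v\<in>set xs. v mod 4 = 3 \<and> v < B" using assms by (auto simp: xs_def dest: set_takeWhileD)
  have ys: "ys = [] \<or> hd ys mod 4 \<noteq> 3" using hd_dropWhile[of "\<lambda>v. v mod 4 = 3" z] by (auto simp: ys_def)
  have inc: "increment z = (ys = [], xs' @ (if ys = [] then [] else (hd ys + 1) # tl ys))"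
    unfolding z xs'_def by (rule increment_append) (use xs ys in auto)
  have len: "length xs \<le> length z" "length xs' = length xs" by (simp_all add: z xs'_def)
  note e1 = exec_wp[OF exec_carry_loop[OF xs ys, of \<tau> "[LeftEnd]" rest, folded z xs'_def]]
  show ?thesis
  proof (cases ys)
    case Nil
    let ?\<tau> = "act (if read \<tau> = Sym 1 then Sym 1 else Sym 2, Stay) \<tau>"
    have "exec (Rew 1) (?\<tau> # zip_tape (map Sym (rev xs') @ [LeftEnd]) [] # rest) (3 * length (map Sym (rev xs')) + 4)
       (Some ((?\<tau> # zip_tape (map Sym (rev xs') @ [LeftEnd]) [] # rest)[1 := zip_tape [] (LeftEnd # rev (map Sym (rev xs')) @ [])]))"
      by (rule exec_Rew_zip) auto
    note e2 = exec_wp[OF this]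
    have "exec (Increment B) (\<tau> # init_tape z # rest) (6 * length xs + 11) (Some (?\<tau> # init_tape xs' # rest))"
      unfolding wp_exec[symmetric] Increment_def
      using Nil by (simp add: init_tape_eq e1[simplified] e2[simplified] rev_map len)
    then show ?thesis using inc Nil len by (intro exI[of _ "6 * length xs + 11"]) auto
  next
    case (Cons y ys')
    have y: "y + 1 < B" using assms ys Cons by (auto simp: z)
    have "exec (Rew 1) (\<tau> # zip_tape (map Sym (rev xs') @ [LeftEnd]) (map Sym ((y + 1) # ys')) # rest) (3 * length (map Sym (rev xs')) + 4)
       (Some ((\<tau> # zip_tape (map Sym (rev xs') @ [LeftEnd]) (map Sym ((y + 1) # ys')) # rest)[1 := zip_tape [] (LeftEnd # rev (map Sym (rev xs')) @ map Sym ((y + 1) # ys'))]))"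
      by (rule exec_Rew_zip) auto
    note e2 = exec_wp[OF this]
    have "exec (Increment B) (\<tau> # init_tape z # rest) (6 * length xs + 11) (Some (\<tau> # init_tape (xs' @ (y + 1) # ys') # rest))"
      unfolding wp_exec[symmetric] Increment_def
      using Cons y by (simp add: init_tape_eq e1[simplified] e2[simplified] rev_map len)
    then show ?thesis using inc Cons len by (intro exI[of _ "6 * length xs + 11"]) auto
  qed
qed

lemma dsteps_exec:
  assumes "exec c \<sigma> t (Some \<sigma>')" "heads_le A \<sigma>" "A + t \<le> S"
  shows "dsteps cstep (\<lambda>x. heads_le S (snd x)) (c, \<sigma>) t (Skip, \<sigma>')"
  using dsteps_heads_le[of "\<lambda>_. True" "(c, \<sigma>)" t "(Skip, \<sigma>')" A S] exec_dsteps[OF assms(1)] assms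
  by simp

section \<open>Exhaustive search through the annotations\<close>

locale pspace_projection =
  fixes \<Sigma> :: "nat set" and M :: tm and B :: nat
  assumes mach: "machine M" and B: "\<And>v. v \<in> annotated \<Sigma> \<Longrightarrow> v < B" and det: "deterministic M"
begin

sublocale simulation M "unmark B" "mark B" 0 2
  using mach by unfold_locales auto

text \<open>
  Tape 0 is the flag of the simulation, extended by the value 2 when there is no further annotation.
\<close>

definition attempt :: com where
  "attempt = Transfer 1 2 (\<lambda>s. s) ;; SIM (start_state M) ;; clear_tapes B 2 (ntapes M) ;; Increment B"

definition search :: com where
  "search = While (\<lambda>rs. rs ! 0 \<noteq> Sym 1 \<and> rs ! 0 \<noteq> Sym 2) attempt"

definition prog :: com where
  "prog = Transfer 0 1 (lift_sym B (\<lambda>a. 4 * a)) ;; search ;; accept_test"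

definition tapes :: "tape \<Rightarrow> nat list \<Rightarrow> tape list" where
  "tapes \<tau> z = \<tau> # init_tape z # replicate (ntapes M) (init_tape [])"

lemma rel_init:
  assumes "z \<in> lists (annotated \<Sigma>)"
  shows "rel (init_tapes z (ntapes M)) (init_tapes z (ntapes M))"
proof -
  have "z ! j < B" if "j < length z" for j
    using assms B that by (metis in_listsD nth_mem)
  then have "\<forall>j. unmark B (fst (init_tape z) j) = fst (init_tape z) j" by (auto simp: init_tape_fst)
  moreover have "\<forall>j. unmark B (fst (init_tape []) j) = fst (init_tape []) j" by (auto simp: init_tape_fst)
  ultimately show ?thesis
    using mach by (auto simp: rel_def init_tapes_def machine_def list_all2_conv_all_nth nth_Cons split: nat.split)
qed

lemma init_config_eq: "init_config M y = (start_state M, init_tapes y (ntapes M))"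
  by (simp add: init_config_def init_tapes_def)

lemma heads_le_tapes: "snd \<tau> = 0 \<Longrightarrow> heads_le 0 (tapes \<tau> z)"
  by (auto simp: tapes_def heads_le_def init_tape_def)

text \<open>A round begins and ends with all heads in cell 0 and empty work tapes, so the next one
  reuses the space. Copying, clearing and counting are short enough for their running times to bound
  the heads; the simulation may take exponential time and is controlled by the space bound of
  \<open>M\<close>. \<open>S'\<close> generously covers all of this.\<close>

lemma attempt_run:
  assumes z: "z \<in> lists (annotated \<Sigma>)" and \<tau>: "snd \<tau> = 0" and halt: "halts M z"
    and sp: "space_bounded M z S" and S: "length z \<le> S"
    and S': "40 * S + ntapes M * (12 * S + 31) + 100 \<le> S'"
  shows "\<exists>t \<tau>'. dsteps cstep (\<lambda>x. heads_le S' (snd x)) (attempt, tapes \<tau> z) t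
      (Skip, tapes \<tau>' (snd (increment z))) \<and> snd \<tau>' = 0 \<and>
      (read \<tau>' = Sym 1 \<longleftrightarrow> accepts M z) \<and> (read \<tau>' = Sym 2 \<longleftrightarrow> \<not> accepts M z \<and> fst (increment z))"
proof -
  have zB: "v < B" if "v \<in> set z" for v using z B that by auto
  have "exec (Transfer 1 2 (\<lambda>s. s)) (tapes \<tau> z) (11 * length z + 15)
      (Some ((tapes \<tau> z)[2 := init_tape (map (\<lambda>a. a) z)]))"
    by (rule exec_Transfer) (use mach in \<open>auto simp: tapes_def machine_def\<close>)
  moreover have "(tapes \<tau> z)[2 := init_tape (map (\<lambda>a. a) z)] = [\<tau>, init_tape z] @ init_tapes z (ntapes M)"
    using mach by (cases "ntapes M") (auto simp: tapes_def init_tapes_def machine_def)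
  ultimately have "exec (Transfer 1 2 (\<lambda>s. s)) (tapes \<tau> z) (11 * length z + 15)
      (Some ([\<tau>, init_tape z] @ init_tapes z (ntapes M)))" by simp
  from dsteps_exec[OF this heads_le_tapes[OF \<tau>]] have 1: "dsteps cstep (\<lambda>x. heads_le S' (snd x))
      (Transfer 1 2 (\<lambda>s. s), tapes \<tau> z) (11 * length z + 15) (Skip, [\<tau>, init_tape z] @ init_tapes z (ntapes M))"
    using S S' by simp
  let ?c = "(start_state M, init_tapes z (ntapes M))"
  have hS: "heads_le S (snd c1)" if "(step M)\<^sup>*\<^sup>* ?c c1" for c1
  proof -
    have "\<forall>(g, i)\<in>set (snd c1). i < S"
      using sp that unfolding space_bounded_def reaches_def init_config_eq by blast
    then show ?thesis by (force simp: heads_le_def)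
  qed
  obtain c' where c': "(step M)\<^sup>*\<^sup>* ?c c'" "stuck (step M) c'"
    using halt by (auto simp: halts_def reaches_def init_config_eq stuck_def)
  have acc: "accepts M z \<longleftrightarrow> fst c' = accept_state M"
    using deterministic_accepts[OF mach det, of z c'] c' by (simp add: reaches_def init_config_eq)
  have hf: "heads_le S [\<tau>, init_tape z]" using \<tau> by (simp add: heads_le_def init_tape_def)
  have "\<exists>t \<sigma>s'. dsteps cstep (\<lambda>x. heads_le S (snd x)) (SIM (fst ?c), [\<tau>, init_tape z] @ init_tapes z (ntapes M)) t
      (Skip, flag (fst c') [\<tau>, init_tape z] @ \<sigma>s') \<and> rel (snd c') \<sigma>s' \<and> (\<forall>\<sigma>\<in>set \<sigma>s'. clearable B S \<sigma>)"
  proof (rule SIM_deterministic[OF det c'])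
    show "rel (snd ?c) (init_tapes z (ntapes M))" using rel_init[OF z] by simp
    show "\<forall>\<sigma>\<in>set (init_tapes z (ntapes M)). clearable B S \<sigma>"
      using clearable_init[OF S, of B] clearable_init[of "[]" S B] zB by (auto simp: init_tapes_def)
  qed (use hf hS in \<open>auto intro: clearable_act\<close>)
  then obtain t2 \<sigma>s' where 2: "dsteps cstep (\<lambda>x. heads_le S (snd x))
      (SIM (start_state M), [\<tau>, init_tape z] @ init_tapes z (ntapes M)) t2
      (Skip, flag (fst c') [\<tau>, init_tape z] @ \<sigma>s')" "rel (snd c') \<sigma>s'" "\<forall>\<sigma>\<in>set \<sigma>s'. clearable B S \<sigma>"
    by auto
  define \<tau>1 where "\<tau>1 = act (if fst c' = accept_state M then Sym 1 else Sym 0, Stay) \<tau>"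
  have fl1: "flag (fst c') [\<tau>, init_tape z] = [\<tau>1, init_tape z]"
    by (simp add: flag_def \<tau>1_def)
  have \<tau>1: "snd \<tau>1 = 0" "read \<tau>1 = (if accepts M z then Sym 1 else Sym 0)"
    using \<tau> by (cases \<tau>; simp add: \<tau>1_def acc)+
  have len: "length \<sigma>s' = ntapes M" using 2(2) by (auto simp: rel_def dest: list_all2_lengthD)
  have h2: "heads_le S ([\<tau>1, init_tape z] @ \<sigma>s')" using dsteps_end[OF 2(1)] fl1 by simp
  have run2: "dsteps cstep (\<lambda>x. heads_le S' (snd x))
      (SIM (start_state M), [\<tau>, init_tape z] @ init_tapes z (ntapes M)) t2 (Skip, [\<tau>1, init_tape z] @ \<sigma>s')"
    using dsteps_mono[OF 2(1)[unfolded fl1], of "\<lambda>x. heads_le S' (snd x)"] S' heads_le_mono[of S _ S'] by simp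
  obtain t3 where t3: "t3 \<le> ntapes M * (12 * S + 30)"
     "exec (clear_tapes B 2 (ntapes M)) ([\<tau>1, init_tape z] @ \<sigma>s') t3 (Some (tapes \<tau>1 z))"
    using exec_clear_tapes[OF 2(3), of "ntapes M" "[\<tau>1, init_tape z]"] len
    by (auto simp: tapes_def numeral_2_eq_2)
  have 3: "dsteps cstep (\<lambda>x. heads_le S' (snd x)) (clear_tapes B 2 (ntapes M), [\<tau>1, init_tape z] @ \<sigma>s') t3 (Skip, tapes \<tau>1 z)"
    by (rule dsteps_exec[OF t3(2) h2]) (use t3(1) S' in \<open>simp add: algebra_simps\<close>)
  have inB: "\<forall>v\<in>set z. v < B \<and> (v mod 4 < 3 \<longrightarrow> v + 1 < B)"
  proof safe
    fix v assume v: "v \<in> set z"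
    then show "v < B" by (rule zB)
    assume "v mod 4 < 3"
    then have "(v + 1) div 4 = v div 4" using mod4_less[of v] by simp
    moreover have "v \<in> annotated \<Sigma>" using v z by auto
    ultimately show "v + 1 < B" by (intro B) (simp add: annotated_def)
  qed
  define \<tau>2 where "\<tau>2 = (if fst (increment z) then act (if read \<tau>1 = Sym 1 then Sym 1 else Sym 2, Stay) \<tau>1 else \<tau>1)"
  obtain t4 where t4: "t4 \<le> 6 * length z + 20" "exec (Increment B) (tapes \<tau>1 z) t4 (Some (tapes \<tau>2 (snd (increment z))))"
    using exec_Increment[OF inB, of \<tau>1 "replicate (ntapes M) (init_tape [])"] unfolding tapes_def \<tau>2_def by blast
  have 4: "dsteps cstep (\<lambda>x. heads_le S' (snd x)) (Increment B, tapes \<tau>1 z) t4 (Skip, tapes \<tau>2 (snd (increment z)))"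
    by (rule dsteps_exec[OF t4(2) heads_le_tapes[OF \<tau>1(1)]]) (use t4(1) S S' in simp)
  have "snd \<tau>2 = 0" "read \<tau>2 = Sym 1 \<longleftrightarrow> accepts M z" "read \<tau>2 = Sym 2 \<longleftrightarrow> \<not> accepts M z \<and> fst (increment z)"
    using \<tau>1 by (cases \<tau>1; auto simp: \<tau>2_def)+
  moreover note dsteps_Seq[OF 1 dsteps_Seq[OF run2 dsteps_Seq[OF 3 4]], folded attempt_def]
  ultimately show ?thesis by blast
qed

lemma search_step:
  "cstep (search, tapes \<tau> z) c \<longleftrightarrow> c =
    (if read \<tau> \<noteq> Sym 1 \<and> read \<tau> \<noteq> Sym 2 then attempt ;; search else Skip, tapes \<tau> z)"
  by (simp add: search_def tapes_def)

text \<open>Induction on the number of annotations left, the current one included. Only annotations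
  of value at least that of \<open>z\<close> are claimed to be searched; a start with all digits 0
  then covers all of them.\<close>

lemma search_run:
  assumes "z \<in> lists (annotated \<Sigma>)" "snd \<tau> = 0" "read \<tau> \<noteq> Sym 1" "read \<tau> \<noteq> Sym 2"
    and "\<And>w. length w = length z \<Longrightarrow> w \<in> lists (annotated \<Sigma>) \<Longrightarrow> halts M w \<and> space_bounded M w S"
    and "length z \<le> S" "40 * S + ntapes M * (12 * S + 31) + 100 \<le> S'"
  shows "\<exists>t \<tau>' z'. dsteps cstep (\<lambda>x. heads_le S' (snd x)) (search, tapes \<tau> z) t (Skip, tapes \<tau>' z') \<and>
    (read \<tau>' = Sym 1 \<longleftrightarrow>
      (\<exists>w. map (\<lambda>v. v div 4) w = map (\<lambda>v. v div 4) z \<and> annot_val z \<le> annot_val w \<and> accepts M w))"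
  using assms(1-6)
proof (induction "4 ^ length z - annot_val z" arbitrary: z \<tau> rule: less_induct)
  case less
  let ?z' = "snd (increment z)"
  let ?D = "dsteps cstep (\<lambda>x. heads_le S' (snd x))"
  obtain t \<tau>' where 1: "?D (attempt, tapes \<tau> z) t (Skip, tapes \<tau>' ?z')" and \<tau>': "snd \<tau>' = 0"
    "read \<tau>' = Sym 1 \<longleftrightarrow> accepts M z" "read \<tau>' = Sym 2 \<longleftrightarrow> \<not> accepts M z \<and> fst (increment z)"
    using attempt_run[OF less.prems(1,2) _ _ less.prems(6) assms(7)] less.prems(1,5) by blast
  have start: "heads_le S' (tapes \<tau> z)" using dsteps_start[OF 1] by simp
  have mid: "heads_le S' (tapes \<tau>' ?z')" using dsteps_end[OF 1] by simp
  have first: "?D (search, tapes \<tau> z) (Suc (t + 1 + u)) y" if "?D (search, tapes \<tau>' ?z') u y" for u y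
    using dsteps_Seq[OF 1 that] start less.prems(3,4)
    by (intro dsteps_Suc[where ?c1.0 = "(attempt ;; search, tapes \<tau> z)"]) (simp_all add: search_step)
  have inj: "w = z" if "map (\<lambda>v. v div 4) w = map (\<lambda>v. v div 4) z" "annot_val w = annot_val z" for w
    using annot_val_inj that by blast
  show ?case
  proof (cases "accepts M z \<or> fst (increment z)")
    case True
    have "?D (search, tapes \<tau>' ?z') 1 (Skip, tapes \<tau>' ?z')"
      by (rule dsteps_1) (use mid True \<tau>' in \<open>auto simp: search_step\<close>)
    note d = first[OF this]
    have "accepts M z \<longleftrightarrow> (\<exists>w. map (\<lambda>v. v div 4) w = map (\<lambda>v. v div 4) z \<and> annot_val z \<le> annot_val w \<and> accepts M w)"
    proof (cases "accepts M z")
      case False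
      \<comment> \<open>Rejection together with overflow: \<open>z\<close> has the largest value, so
        no other candidate is left.\<close>
      then have "Suc (annot_val z) = 4 ^ length z" using True increment_val[of z] by simp
      moreover have "annot_val w < 4 ^ length z" if "map (\<lambda>v. v div 4) w = map (\<lambda>v. v div 4) z" for w
        using annot_val_less[of w] map_eq_imp_length_eq[OF that] by simp
      ultimately have "annot_val w = annot_val z"
        if "map (\<lambda>v. v div 4) w = map (\<lambda>v. v div 4) z" "annot_val z \<le> annot_val w" for w
        using that by (metis le_antisym less_Suc_eq_le)
      then show ?thesis using False inj by blast
    qed blast
    then show ?thesis using d \<tau>'(2) by blast
  next
    case False
    then have val: "annot_val ?z' = Suc (annot_val z)" using increment_val[of z] by simp
    note dv = increment_div[of z]
    have len: "length ?z' = length z" using map_eq_imp_length_eq[OF dv] .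
    have z': "?z' \<in> lists (annotated \<Sigma>)" using less.prems(1) dv annotated_lists by metis
    have "\<exists>t \<tau>'' z'. ?D (search, tapes \<tau>' ?z') t (Skip, tapes \<tau>'' z') \<and>
      (read \<tau>'' = Sym 1 \<longleftrightarrow>
        (\<exists>w. map (\<lambda>v. v div 4) w = map (\<lambda>v. v div 4) ?z' \<and> annot_val ?z' \<le> annot_val w \<and> accepts M w))"
    proof (rule less.hyps[OF _ z' \<tau>'(1)])
      show "4 ^ length ?z' - annot_val ?z' < 4 ^ length z - annot_val z"
        using val len annot_val_less[of z] by simp
    qed (use \<tau>' False less.prems len in auto)
    then obtain u \<tau>'' z'' where u: "?D (search, tapes \<tau>' ?z') u (Skip, tapes \<tau>'' z'')"
      "read \<tau>'' = Sym 1 \<longleftrightarrow>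
        (\<exists>w. map (\<lambda>v. v div 4) w = map (\<lambda>v. v div 4) z \<and> Suc (annot_val z) \<le> annot_val w \<and> accepts M w)"
      unfolding dv val by blast
    have "(\<exists>w. map (\<lambda>v. v div 4) w = map (\<lambda>v. v div 4) z \<and> Suc (annot_val z) \<le> annot_val w \<and> accepts M w) \<longleftrightarrow>
       (\<exists>w. map (\<lambda>v. v div 4) w = map (\<lambda>v. v div 4) z \<and> annot_val z \<le> annot_val w \<and> accepts M w)"
      using False inj by (metis Suc_leD le_antisym not_less_eq_eq)
    then show ?thesis using first[OF u(1)] u(2) by blast
  qed
qed

lemma prog_run:
  assumes x: "x \<in> lists \<Sigma>"
    and "\<And>w. length w = length x \<Longrightarrow> w \<in> lists (annotated \<Sigma>) \<Longrightarrow> halts M w \<and> space_bounded M w S"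
    and "length x \<le> S" "40 * S + ntapes M * (12 * S + 31) + 100 \<le> S'"
  shows "\<exists>t c. dsteps cstep (\<lambda>x. heads_le S' (snd x)) (prog, init_tapes x (2 + ntapes M)) t c \<and>
    stuck cstep c \<and> (fst c = Skip \<longleftrightarrow> (\<exists>w. map (\<lambda>v. v div 4) w = x \<and> accepts M w))"
proof -
  let ?z = "map (\<lambda>a. 4 * a) x"
  let ?D = "dsteps cstep (\<lambda>x. heads_le S' (snd x))"
  have dz: "map (\<lambda>v. v div 4) ?z = x" by (induction x) auto
  have z: "?z \<in> lists (annotated \<Sigma>)" using annotated_lists[of ?z \<Sigma>] x dz by simp
  have "exec (Transfer 0 1 (lift_sym B (\<lambda>a. 4 * a))) (init_tapes x (2 + ntapes M)) (11 * length x + 15)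
      (Some ((init_tapes x (2 + ntapes M))[1 := init_tape ?z]))"
  proof (rule exec_Transfer)
    show "lift_sym B (\<lambda>a. 4 * a) (Sym a) = Sym (4 * a)" if "a \<in> set x" for a
      using B[of "4 * a"] x that by (auto simp: annotated_def)
  qed (auto simp: init_tapes_def)
  moreover have "(init_tapes x (2 + ntapes M))[1 := init_tape ?z] = tapes (init_tape x) ?z"
    by (simp add: init_tapes_def tapes_def)
  ultimately have "exec (Transfer 0 1 (lift_sym B (\<lambda>a. 4 * a))) (init_tapes x (2 + ntapes M)) (11 * length x + 15)
      (Some (tapes (init_tape x) ?z))" by simp
  from dsteps_exec[OF this heads_le_init_tapes]
  have 1: "?D (Transfer 0 1 (lift_sym B (\<lambda>a. 4 * a)), init_tapes x (2 + ntapes M)) (11 * length x + 15) (Skip, tapes (init_tape x) ?z)"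
    using assms(3,4) by simp
  have "\<exists>t \<tau>' z'. ?D (search, tapes (init_tape x) ?z) t (Skip, tapes \<tau>' z') \<and>
    (read \<tau>' = Sym 1 \<longleftrightarrow>
      (\<exists>w. map (\<lambda>v. v div 4) w = map (\<lambda>v. v div 4) ?z \<and> annot_val ?z \<le> annot_val w \<and> accepts M w))"
    by (rule search_run[OF z]) (use assms in \<open>auto simp: init_tape_def\<close>)
  then obtain t \<tau>' z' where 2: "?D (search, tapes (init_tape x) ?z) t (Skip, tapes \<tau>' z')"
    "read \<tau>' = Sym 1 \<longleftrightarrow> (\<exists>w. map (\<lambda>v. v div 4) w = x \<and> accepts M w)"
    unfolding dz annot_val_zero by (simp only: le0 simp_thms) blast
  let ?c = "(if read \<tau>' = Sym 1 then Skip else Fail, tapes \<tau>' z')"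
  have "?D (accept_test, tapes \<tau>' z') 1 ?c"
    by (rule dsteps_1) (use dsteps_end[OF 2(1)] in \<open>auto simp: accept_test_def tapes_def\<close>)
  from dsteps_Seq[OF 1 dsteps_Seq[OF 2(1) this], folded prog_def] 2(2)
  show ?thesis by (intro exI[of _ ?c] exI conjI) auto
qed

end

theorem PSPACE_projection:
  assumes L: "(annotated \<Sigma>, L) \<in> PSPACE" and fin: "finite \<Sigma>"
  shows "(\<Sigma>, {x \<in> lists \<Sigma>. \<exists>z\<in>L. map (\<lambda>v. v div 4) z = x}) \<in> PSPACE"
proof -
  obtain M p where HM: "machine M" "deterministic M"
    "\<And>y. y \<in> lists (annotated \<Sigma>) \<Longrightarrow> halts M y \<and> space_bounded M y (poly p (length y)) \<and> (accepts M y \<longleftrightarrow> y \<in> L)"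
    using L by (auto simp: PSPACE_def)
  have Lsub: "L \<subseteq> lists (annotated \<Sigma>)" using L by (auto simp: PSPACE_def is_language_def)
  obtain b1 where b1: "Sym ` (annotated \<Sigma>) \<subseteq> alph b1"
    using finite_symbols_alph[of "Sym ` annotated \<Sigma>"] finite_annotated[OF fin] by blast
  interpret pspace_projection \<Sigma> M b1
    by unfold_locales (use HM b1 in auto)
  obtain b2 where b2: "\<And>q rs q' as a. (q, rs, q', as) \<in> delta M \<Longrightarrow> a \<in> set as \<Longrightarrow> fst a \<in> alph b2"
    using machine_alph[OF HM(1)] by blast
  obtain b3 where b3: "Sym ` \<Sigma> \<subseteq> alph b3" using finite_symbols_alph[of "Sym ` \<Sigma>"] fin by blast
  \<comment> \<open>Symbols of \<open>alph b2\<close> have codes at most \<open>b2 + 1\<close>, so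
    \<open>mark\<close> yields numbers up to \<open>b1 + 2 * (b2 + 1) + 1\<close>.\<close>
  define b where "b = b1 + 2 * b2 + b3 + 10"
  have al: "alph b3 \<subseteq> alph b" by (auto intro!: alph_mono simp: b_def)
  have code: "code s < b2 + 2" if "s \<in> alph b2" for s
    using that by (cases s) auto
  have mark: "mark b1 r s \<in> alph b" if "s \<in> alph b2" for r s
    using code[OF that] by (auto simp: mark_def b_def)
  have wf: "wf_com (alph b) (2 + ntapes M) prog"
  proof -
    have "wf_com (alph b) (2 + ntapes M) (SIM (start_state M))"
      using b2 HM(1) mark by (fastforce simp: b_def)
    moreover have "0 < ntapes M" using HM(1) by (simp add: machine_def)
    ultimately show ?thesis
      by (auto simp: prog_def attempt_def search_def accept_test_def Increment_def carry_loop_def b_def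
          simp: lift_sym_alph simp del: wf_com.simps(8))
  qed
  have dp: "det_com prog"
    using HM(2) by (simp add: prog_def attempt_def search_def accept_test_def Increment_def carry_loop_def)
  let ?k = "2 + ntapes M"
  have k: "?k \<ge> 1" by simp
  obtain D where D: "machine D" "deterministic D" "\<And>x. Sym ` set x \<subseteq> alph b \<Longrightarrow>
      accepts D x \<longleftrightarrow> accepting (prog, init_tapes x ?k)"
    "\<And>x S. Sym ` set x \<subseteq> alph b \<Longrightarrow> (\<And>c \<sigma>. cstep\<^sup>*\<^sup>* (prog, init_tapes x ?k) (c, \<sigma>) \<Longrightarrow> heads_le S \<sigma>) \<Longrightarrow>
      space_bounded D x (Suc S)"
    "\<And>x c. Sym ` set x \<subseteq> alph b \<Longrightarrow>
      cstep\<^sup>*\<^sup>* (prog, init_tapes x ?k) c \<Longrightarrow> stuck cstep c \<Longrightarrow> halts D x"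
    by (rule compile[OF k finite_alph _ _ wf]) (use dp in \<open>auto simp: init_tapes_def accepting_def\<close>)
  \<comment> \<open>The added identity makes \<open>S\<close> bound the length of the input as well,
    as copying and counting require.\<close>
  define s where "s = p + [:0, 1:]"
  \<comment> \<open>\<open>S'\<close> of \<open>prog_run\<close> with \<open>s\<close> for
    \<open>S\<close>, plus one because \<open>space_bounded\<close> is strict.\<close>
  define r where "r = smult 40 s + smult (ntapes M) (smult 12 s + [:31:]) + [:101:]"
  have "halts D x \<and> space_bounded D x (poly r (length x)) \<and> (accepts D x \<longleftrightarrow> (\<exists>z\<in>L. map (\<lambda>v. v div 4) z = x))"
    if x: "x \<in> lists \<Sigma>" for x
  proof -
    have "set x \<subseteq> \<Sigma>" using x by auto
    then have alx: "Sym ` set x \<subseteq> alph b" using b3 al by blast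
    define S where "S = poly s (length x)"
    have sp: "space_bounded M w S" if "length w = length x" "w \<in> lists (annotated \<Sigma>)" for w
      using HM(3)[OF that(2)] that(1) by (fastforce simp: space_bounded_def S_def s_def)
    let ?S' = "40 * S + ntapes M * (12 * S + 31) + 100"
    have "\<exists>t c. dsteps cstep (\<lambda>x. heads_le ?S' (snd x)) (prog, init_tapes x ?k) t c \<and>
      stuck cstep c \<and> (fst c = Skip \<longleftrightarrow> (\<exists>w. map (\<lambda>v. v div 4) w = x \<and> accepts M w))"
      by (rule prog_run[OF x]) (use HM(3) sp in \<open>auto simp: S_def s_def\<close>)
    then obtain t c where c: "dsteps cstep (\<lambda>x. heads_le ?S' (snd x)) (prog, init_tapes x ?k) t c"
      "stuck cstep c" "fst c = Skip \<longleftrightarrow> (\<exists>w. map (\<lambda>v. v div 4) w = x \<and> accepts M w)" by blast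
    have "halts D x" using D(5)[OF alx dsteps_imp_rtranclp[OF c(1)] c(2)] .
    moreover have "space_bounded D x (Suc ?S')"
      using dsteps_deterministic_space[OF c(1,2)] by (intro D(4)[OF alx]) fastforce
    then have "space_bounded D x (poly r (length x))"
      by (simp add: r_def S_def algebra_simps)
    moreover have "accepting (prog, init_tapes x ?k) \<longleftrightarrow> fst c = Skip"
    proof -
      have "accepting c \<longleftrightarrow> fst c = Skip"
        using c(2) unfolding accepting_def stuck_def
        by (cases c) (auto elim: converse_rtranclpE)
      then show ?thesis using accepting_dsteps[OF c(1)] by simp
    qed
    moreover have "(\<exists>w. map (\<lambda>v. v div 4) w = x \<and> accepts M w) \<longleftrightarrow> (\<exists>z\<in>L. map (\<lambda>v. v div 4) z = x)"
    proof -
      have "w \<in> lists (annotated \<Sigma>)" if "map (\<lambda>v. v div 4) w = x" for w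
        using annotated_lists[of w \<Sigma>] x that by simp
      then show ?thesis using HM(3) by blast
    qed
    ultimately show ?thesis using D(3)[OF alx] c(3) by simp
  qed
  then show ?thesis
    using D(1,2) fin by (auto simp: PSPACE_def is_language_def intro!: exI[of _ D] exI[of _ r])
qed

section \<open>Reducing a language to reachability in paths\<close>

fun path_arcs :: "nat \<Rightarrow> nat list \<Rightarrow> (nat \<times> nat \<times> nat) list" where
  "path_arcs i [] = []"
| "path_arcs i (a # x) = (i, a, Suc i) # path_arcs (Suc i) x"

definition path_encoding :: "nat list \<Rightarrow> nat list" where
  "path_encoding x = encode (Suc (length x)) (path_arcs 0 x) 0 (length x)"

text \<open>Tape 1 holds the tail of the next arc in unary, tape 2 receives the output.\<close>

definition write_tail :: com where
  "write_tail = While (\<lambda>rs. rs ! 1 = Sym 1) (put 2 (Sym 1) GoRight ;; goR 1)"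

definition write_head :: com where
  "write_head = While (\<lambda>rs. rs ! 1 = Sym 1) (put 2 (Sym 1) GoRight ;; goL 1)"

text \<open>Writing the tail takes the counter head to the first free cell, where one more digit
  turns the counter into the head of the arc. This is written on the way back, which also rewinds
  the counter.\<close>

definition write_arcs :: "nat \<Rightarrow> com" where
  "write_arcs b = While (\<lambda>rs. rs ! 0 \<noteq> Blank)
     (goR 1 ;; write_tail ;; put 1 (Sym 1) Stay ;; Put 2 (\<lambda>rs. lift_sym b (\<lambda>a. a + 2) (rs ! 0)) GoRight ;;
      write_head ;; put 2 (Sym 0) GoRight ;; goR 0)"

text \<open>The source is vertex 0 with empty unary representation, so two separators stand in a
  row. The first copied block gets an extra one because there is one vertex more than
  letters.\<close>

definition write_path :: "nat \<Rightarrow> com" where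
  "write_path b = goR 0 ;; goR 2 ;; Copy 0 2 (\<lambda>s. Sym 1) ;; put 2 (Sym 1) GoRight ;; put 2 (Sym 0) GoRight ;;
     put 2 (Sym 0) GoRight ;; Rew 0 ;; goR 0 ;; Copy 0 2 (\<lambda>s. Sym 1) ;; put 2 (Sym 0) GoRight ;;
     Rew 0 ;; goR 0 ;; write_arcs b ;; Rew 2"

lemmas wp_write_tail = wp_While[of "\<lambda>rs. rs ! 1 = Sym 1" "put 2 (Sym 1) GoRight ;; goR 1", folded write_tail_def]
lemmas wp_write_head = wp_While[of "\<lambda>rs. rs ! 1 = Sym 1" "put 2 (Sym 1) GoRight ;; goL 1", folded write_head_def]
lemmas wp_write_arcs = wp_While[of "\<lambda>rs. rs ! 0 \<noteq> Blank" "goR 1 ;; write_tail ;; put 1 (Sym 1) Stay ;;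
    Put 2 (\<lambda>rs. lift_sym b (\<lambda>a. a + 2) (rs ! 0)) GoRight ;; write_head ;; put 2 (Sym 0) GoRight ;; goR 0"
  for b, folded write_arcs_def]

lemma exec_write_tail:
  "exec write_tail (\<tau> # zip_tape m (replicate i (Sym 1)) # zip_tape l [] # rest) (5 * i + 1)
     (Some (\<tau> # zip_tape (replicate i (Sym 1) @ m) [] # zip_tape (replicate i (Sym 1) @ l) [] # rest))"
proof (induction i arbitrary: m l)
  case 0
  show ?case unfolding wp_exec[symmetric] by (subst wp_write_tail) simp
next
  case (Suc i)
  note e = exec_wp[OF Suc.IH[of "Sym 1 # m" "Sym 1 # l"]]
  show ?case unfolding wp_exec[symmetric]
    by (subst wp_write_tail) (simp add: e[simplified] replicate_app_Cons_same)
qed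

lemma exec_write_head:
  "exec write_head (\<tau> # zip_tape (replicate i (Sym 1) @ [LeftEnd]) (Sym 1 # r) # zip_tape l [] # rest) (5 * i + 6)
     (Some (\<tau> # zip_tape [] (LeftEnd # replicate (Suc i) (Sym 1) @ r) # zip_tape (replicate (Suc i) (Sym 1) @ l) [] # rest))"
proof (induction i arbitrary: r l)
  case 0
  show ?case unfolding wp_exec[symmetric]
    by (subst wp_write_head, simp, subst wp_write_head[unfolded One_nat_def], simp)
next
  case (Suc i)
  note e = exec_wp[OF Suc.IH[of "Sym 1 # r" "Sym 1 # l"]]
  show ?case unfolding wp_exec[symmetric]
    by (subst wp_write_head) (simp add: e[simplified] replicate_app_Cons_same)
qed

lemma exec_write_arcs:
  assumes "\<And>a. a \<in> set x \<Longrightarrow> a + 2 < b"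
  shows "\<exists>t \<le> length x * (10 * (i + length x) + 30) + 1.
    exec (write_arcs b) (zip_tape l (map Sym x) # init_tape (replicate i 1) # zip_tape m [] # rest) t
     (Some (zip_tape (map Sym (rev x) @ l) [] # init_tape (replicate (i + length x) 1) #
        zip_tape (rev (map Sym (concat (map encode_arc (path_arcs i x)))) @ m) [] # rest))"
  using assms
proof (induction x arbitrary: i l m)
  case Nil
  show ?case
    by (rule exI[of _ 1], unfold wp_exec[symmetric], subst wp_write_arcs) simp
next
  case (Cons a x)
  let ?m = "rev (map Sym (encode_arc (i, a, Suc i))) @ m"
  have "\<exists>t \<le> length x * (10 * (Suc i + length x) + 30) + 1.
    exec (write_arcs b) (zip_tape (Sym a # l) (map Sym x) # init_tape (replicate (Suc i) 1) # zip_tape ?m [] # rest) t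
     (Some (zip_tape (map Sym (rev x) @ Sym a # l) [] # init_tape (replicate (Suc i + length x) 1) #
        zip_tape (rev (map Sym (concat (map encode_arc (path_arcs (Suc i) x)))) @ ?m) [] # rest))"
    by (rule Cons.IH) (use Cons.prems in auto)
  then obtain t where t: "t \<le> length x * (10 * (Suc i + length x) + 30) + 1"
    "exec (write_arcs b) (zip_tape (Sym a # l) (map Sym x) # init_tape (replicate (Suc i) 1) # zip_tape ?m [] # rest) t
     (Some (zip_tape (map Sym (rev x) @ Sym a # l) [] # init_tape (replicate (Suc i + length x) 1) #
        zip_tape (rev (map Sym (concat (map encode_arc (path_arcs (Suc i) x)))) @ ?m) [] # rest))" by blast
  have m: "?m = Sym 0 # replicate (Suc i) (Sym 1) @ Sym (a + 2) # replicate i (Sym 1) @ m"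
    by (simp add: encode_arc_def unary_def replicate_append_same)
  note e1 = exec_wp[OF exec_write_tail[of "zip_tape l (Sym a # map Sym x)" "[LeftEnd]" i m rest]]
  note e2 = exec_wp[OF exec_write_head[of "zip_tape l (Sym a # map Sym x)" i "[]" "Sym (a + 2) # replicate i (Sym 1) @ m" rest]]
  note e3 = exec_wp[OF t(2)[unfolded m]]
  have a: "lift_sym b (\<lambda>a. a + 2) (Sym a) = Sym (a + 2)" using Cons.prems by (intro lift_sym_Sym) simp
  have "exec (write_arcs b) (zip_tape l (map Sym (a # x)) # init_tape (replicate i 1) # zip_tape m [] # rest)
     (10 * i + 20 + t)
     (Some (zip_tape (map Sym (rev (a # x)) @ l) [] # init_tape (replicate (i + length (a # x)) 1) #
        zip_tape (rev (map Sym (concat (map encode_arc (path_arcs i (a # x))))) @ m) [] # rest))"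
    unfolding wp_exec[symmetric]
    by (subst wp_write_arcs)
      (use a in \<open>simp add: init_tape_eq e1[simplified] e2[simplified] e3[simplified, unfolded init_tape_eq, simplified]
        encode_arc_def unary_def replicate_append_same\<close>)
  moreover have "10 * i + 20 + t \<le> length (a # x) * (10 * (i + length (a # x)) + 30) + 1"
    using t(1) by (simp add: algebra_simps)
  ultimately show ?case by blast
qed

lemma length_path_arcs: "length (concat (map encode_arc (path_arcs i x))) \<le> length x * (2 * (i + length x) + 3)"
proof (induction x arbitrary: i)
  case (Cons a x)
  from Cons[of "Suc i"] show ?case
    by (simp add: encode_arc_def unary_def algebra_simps)
qed simp

lemma path_arcs_set: "(u, a, v) \<in> set (path_arcs i x) \<Longrightarrow> i \<le> u \<and> u < i + length x \<and> v = Suc u \<and> a = x ! (u - i)"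
proof (induction x arbitrary: i)
  case (Cons c x)
  then show ?case by (cases "u = i") (fastforce simp: nth_Cons' Suc_diff_Suc dest: Cons.IH)+
qed simp

lemma computes_path_encoding:
  assumes fin: "finite \<Sigma>"
  shows "\<exists>b. computes (write_path b) 2 \<Sigma> ({0, 1} \<union> (\<lambda>a. a + 2) ` \<Sigma>) (\<lambda>x. Some (path_encoding x))"
proof -
  obtain b where b: "Sym ` (\<lambda>a. a + 2) ` \<Sigma> \<subseteq> alph b"
    using finite_symbols_alph[of "Sym ` (\<lambda>a. a + 2) ` \<Sigma>"] fin by blast
  have "wf_com (alph b') k (write_path b)" if "b + 2 \<le> b'" "k > 2" for b' k
    using that by (auto simp: write_path_def write_arcs_def write_tail_def write_head_def Copy_def lift_sym_alph subset_iff)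
  then have wf: "\<exists>b0. \<forall>b'\<ge>b0. \<forall>k>2. wf_com (alph b') k (write_path b)" by blast
  have det: "det_com (write_path b)"
    by (simp add: write_path_def write_arcs_def write_tail_def write_head_def Copy_def)
  define q :: "nat poly" where "q = [:0, 1:] * ([:30, 10:]) + [:60, 40:] + [:0, 1:] * [:9, 6:] * [:3:] + [:60, 40:]"
  have "\<exists>t\<le>poly q (length x). path_encoding x \<in> lists ({0, 1} \<union> (\<lambda>a. a + 2) ` \<Sigma>) \<and>
      length (path_encoding x) \<le> poly q (length x) \<and>
      (\<exists>front. length front = 2 \<and> exec (write_path b) (init_tapes x k) t (Some (front @ init_tapes (path_encoding x) (k - 2))))"
    if k: "k > 2" and x: "x \<in> lists \<Sigma>" for k x
  proof -
    let ?n = "length x" and ?arcs = "concat (map encode_arc (path_arcs 0 x))"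
    define rest where "rest = replicate (k - 3) (init_tape [])"
    have it: "init_tapes x k = init_tape x # init_tape [] # init_tape [] # rest"
    proof -
      have "k - 1 = Suc (Suc (k - 3))" using k by simp
      then show ?thesis by (simp add: init_tapes_def rest_def)
    qed
    have it2: "init_tapes y (k - 2) = init_tape y # rest" for y
      by (simp add: init_tapes_def rest_def)
    have x': "a + 2 < b" if "a \<in> set x" for a
    proof -
      have "Sym (a + 2) \<in> Sym ` (\<lambda>a. a + 2) ` \<Sigma>" using x that by blast
      then have "Sym (a + 2) \<in> alph b" using b by blast
      then show ?thesis by simp
    qed
    have xe: "path_encoding x \<in> lists ({0, 1} \<union> (\<lambda>a. a + 2) ` \<Sigma>)"
    proof -
      have "set (encode_arc e) \<subseteq> {0, 1} \<union> (\<lambda>a. a + 2) ` \<Sigma>" if "e \<in> set (path_arcs 0 x)" for e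
      proof -
        obtain u a v where e: "e = (u, a, v)" by (cases e)
        then have "a \<in> set x" using path_arcs_set[of u a v 0 x] that by auto
        then show ?thesis using x e by (auto simp: encode_arc_def unary_def)
      qed
      then have "set ?arcs \<subseteq> {0, 1} \<union> (\<lambda>a. a + 2) ` \<Sigma>" unfolding set_concat set_map by blast
      then show ?thesis
        by (auto simp: path_encoding_def encode_def unary_def in_lists_conv_set simp del: set_concat set_map)
    qed
    have le: "length (path_encoding x) = 2 * ?n + 4 + length ?arcs"
      by (simp add: path_encoding_def encode_def unary_def)
    have len: "length (path_encoding x) \<le> ?n * (2 * ?n + 3) + 2 * ?n + 4"
      unfolding le using length_path_arcs[of 0 x] by simp
    let ?one = "Sym 1" and ?zero = "Sym 0"
    let ?o1 = "replicate ?n ?one @ [LeftEnd]"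
    let ?o2 = "?zero # ?zero # ?one # ?o1"
    let ?o3 = "?zero # replicate ?n ?one @ ?o2"
    let ?o4 = "rev (map Sym ?arcs) @ ?o3"
    have o4: "?o4 = map Sym (rev (path_encoding x)) @ [LeftEnd]"
      by (simp add: path_encoding_def encode_def unary_def rev_map replicate_append_same)
    have cp: "exec (Copy 0 2 (\<lambda>s. Sym 1)) (zip_tape [LeftEnd] (map Sym x) # init_tape [] # zip_tape l [] # rest) (5 * ?n + 1)
       (Some (zip_tape (map Sym (rev x) @ [LeftEnd]) [] # init_tape [] # zip_tape (replicate ?n ?one @ l) [] # rest))" for l
    proof -
      have "exec (Copy 0 2 (\<lambda>s. Sym 1)) (zip_tape [LeftEnd] (map Sym x) # init_tape [] # zip_tape l [] # rest) (5 * ?n + 1)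
         (Some ((zip_tape [LeftEnd] (map Sym x) # init_tape [] # zip_tape l [] # rest)
           [0 := zip_tape (map Sym (rev x) @ [LeftEnd]) [], 2 := zip_tape (map Sym (rev (map (\<lambda>_. 1) x)) @ l) []]))"
        by (rule exec_Copy) auto
      then show ?thesis by (simp add: map_replicate_const)
    qed
    have rw: "exec (Rew 0) (zip_tape (map Sym (rev x) @ [LeftEnd]) [] # ts) (3 * ?n + 4) (Some (init_tape x # ts))" for ts
      using exec_Rew_zip[of 0 "zip_tape (map Sym (rev x) @ [LeftEnd]) [] # ts" "map Sym (rev x)" "[]"]
      by (auto simp: rev_map init_tape_eq)
    obtain t where t: "t \<le> ?n * (10 * ?n + 30) + 1"
      "exec (write_arcs b) (zip_tape [LeftEnd] (map Sym x) # init_tape [] # zip_tape ?o3 [] # rest) t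
        (Some (zip_tape (map Sym (rev x) @ [LeftEnd]) [] # init_tape (replicate ?n 1) # zip_tape ?o4 [] # rest))"
      using exec_write_arcs[of x b 0 "[LeftEnd]" ?o3 rest] x' by auto
    have rw2: "exec (Rew 2) (\<tau> # \<tau>' # zip_tape ?o4 [] # rest) (3 * length (path_encoding x) + 4)
       (Some (\<tau> # \<tau>' # init_tape (path_encoding x) # rest))" for \<tau> \<tau>'
      unfolding o4
      using exec_Rew_zip[of 2 "\<tau> # \<tau>' # zip_tape (map Sym (rev (path_encoding x)) @ [LeftEnd]) [] # rest" "map Sym (rev (path_encoding x))" "[]"]
      by (auto simp: rev_map init_tape_eq)
    let ?front = "[zip_tape (map Sym (rev x) @ [LeftEnd]) [], init_tape (replicate ?n 1)]"
    let ?t = "16 * ?n + 35 + t + 3 * length (path_encoding x)"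
    have "exec (write_path b) (init_tapes x k) ?t (Some (?front @ init_tapes (path_encoding x) (k - 2)))"
      unfolding wp_exec[symmetric] write_path_def it it2
      by (simp add: init_tape_eq exec_wp[OF cp[unfolded init_tape_eq, simplified]]
          exec_wp[OF rw[unfolded init_tape_eq, simplified]] exec_wp[OF t(2)[unfolded init_tape_eq, simplified]]
          exec_wp[OF rw2[unfolded init_tape_eq, simplified]])
    moreover have "?t \<le> poly q ?n"
      using t(1) len by (simp add: q_def algebra_simps)
    moreover have "length (path_encoding x) \<le> poly q ?n"
      using len by (simp add: q_def algebra_simps)
    ultimately show ?thesis using xe by (intro exI[of _ ?t] conjI exI[of _ ?front]) auto
  qed
  then have "computes (write_path b) 2 \<Sigma> ({0, 1} \<union> (\<lambda>a. a + 2) ` \<Sigma>) (\<lambda>x. Some (path_encoding x))"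
    unfolding computes_def option.case by (intro conjI det wf exI[of _ q] allI impI ballI zero_less_numeral)
  then show ?thesis by blast
qed

section \<open>Verifying a certificate for reachability\<close>

text \<open>
  Tape 0 holds the annotated instance, tape 1 its bits for the topological order and tape 2 the number
  of vertices. Tapes 3 and 4 hold the current vertex of the walk and the target, tapes 5 and 6 the end
  points of the arc being checked, and tape 7 receives the yield.
\<close>

fun is0 :: "symbol \<Rightarrow> bool" where
  "is0 (Sym v) = (v div 4 = 0)"
| "is0 _ = False"

fun is1 :: "symbol \<Rightarrow> bool" where
  "is1 (Sym v) = (v div 4 = 1)"
| "is1 _ = False"

fun is_label :: "symbol \<Rightarrow> bool" where
  "is_label (Sym v) = (v div 4 \<ge> 2)"
| "is_label _ = False"

fun is_marked :: "symbol \<Rightarrow> bool" where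
  "is_marked (Sym v) = (v mod 4 \<ge> 2)"
| "is_marked _ = False"

text \<open>From here on times are only bounded, since the exact ones depend on how far comparisons
  run.\<close>

definition ex :: "com \<Rightarrow> tape list \<Rightarrow> nat \<Rightarrow> tape list option \<Rightarrow> bool" where
  "ex c \<sigma> T r \<longleftrightarrow> (\<exists>t\<le>T. exec c \<sigma> t r)"

lemma ex_wp: "ex c \<sigma> T r \<longleftrightarrow> wp c \<sigma> (\<lambda>t r'. t \<le> T \<and> r' = r)"
  by (auto simp: ex_def wp_def)

lemma ex_Seq: "ex a \<sigma> T1 (Some \<sigma>') \<Longrightarrow> ex b \<sigma>' T2 r \<Longrightarrow> T1 + 1 + T2 \<le> T \<Longrightarrow> ex (a ;; b) \<sigma> T r"
  unfolding ex_def by (meson add_le_mono exec_Seq_Some le_refl le_trans)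

lemma ex_Seq_None: "ex a \<sigma> T1 None \<Longrightarrow> T1 \<le> T \<Longrightarrow> ex (a ;; b) \<sigma> T None"
  unfolding ex_def by (meson exec_Seq_None le_trans)

lemma ex_mono: "ex c \<sigma> T r \<Longrightarrow> T \<le> T' \<Longrightarrow> ex c \<sigma> T' r"
  unfolding ex_def by (meson le_trans)

lemma exec_ex: "exec c \<sigma> t r \<Longrightarrow> t \<le> T \<Longrightarrow> ex c \<sigma> T r"
  by (auto simp: ex_def)

section \<open>Copying and comparing unary numbers\<close>

definition Fill :: "nat \<Rightarrow> com" where
  "Fill i = While (\<lambda>rs. is1 (rs ! 0)) (put i (Sym 1) GoRight ;; goR 0)"

text \<open>Compares unary numbers: afterwards the longer one still shows a one under its
  head.\<close>

definition Match :: "(symbol \<Rightarrow> bool) \<Rightarrow> nat \<Rightarrow> nat \<Rightarrow> com" where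
  "Match P i j = While (\<lambda>rs. P (rs ! i) \<and> rs ! j = Sym 1) (goR i ;; goR j)"

definition Seek0 :: com where
  "Seek0 = While (\<lambda>rs. \<not> is0 (rs ! 0)) (goR 0)"

lemmas wp_Fill = wp_While[of "\<lambda>rs. is1 (rs ! 0)" "put i (Sym 1) GoRight ;; goR 0" for i, folded Fill_def]
lemmas wp_Match = wp_While[of "\<lambda>rs. P (rs ! i) \<and> rs ! j = Sym 1" "goR i ;; goR j" for P i j, folded Match_def]
lemmas wp_Seek0 = wp_While[of "\<lambda>rs. \<not> is0 (rs ! 0)" "goR 0", folded Seek0_def]

lemma exec_Fill:
  assumes "0 < i" "i < length \<sigma>" "\<sigma> ! 0 = zip_tape l (map Sym (xs @ ys))" "\<sigma> ! i = zip_tape m []"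
    "\<forall>x\<in>set xs. x div 4 = 1" "ys = [] \<or> hd ys div 4 \<noteq> 1"
  shows "exec (Fill i) \<sigma> (5 * length xs + 1)
    (Some (\<sigma>[0 := zip_tape (map Sym (rev xs) @ l) (map Sym ys), i := zip_tape (replicate (length xs) (Sym 1) @ m) []]))"
  using assms(1-5)
proof (induction xs arbitrary: \<sigma> l m)
  case Nil
  have "\<sigma>[0 := zip_tape l (map Sym ys), i := zip_tape m []] = \<sigma>"
    using Nil by (metis append_Nil list_update_id)
  moreover have "\<not> is1 (read (zip_tape l (map Sym ys)))" using assms(6) by (cases ys) auto
  moreover have "\<sigma> \<noteq> []" using Nil by auto
  then have "map read \<sigma> ! 0 = read (\<sigma> ! 0)" by simp
  ultimately show ?case unfolding wp_exec[symmetric] using Nil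
    by (subst wp_Fill) simp
next
  case (Cons x xs)
  let ?\<sigma> = "\<sigma>[i := zip_tape (Sym 1 # m) [], 0 := zip_tape (Sym x # l) (map Sym (xs @ ys))]"
  have ne: "\<sigma> \<noteq> []" using Cons.prems by auto
  have u: "\<sigma>[i := a, 0 := b, 0 := c, i := d] = \<sigma>[0 := c, i := d]" for a b c d
    using \<open>0 < i\<close> by (simp add: list_update_swap[of 0 i])
  have "exec (Fill i) ?\<sigma> (5 * length xs + 1) (Some (?\<sigma>[0 := zip_tape (map Sym (rev xs) @ Sym x # l) (map Sym ys),
      i := zip_tape (replicate (length xs) (Sym 1) @ Sym 1 # m) []]))"
    by (rule Cons.IH) (use Cons.prems ne in auto)
  note e = exec_wp[OF this[unfolded u]]
  have "map read \<sigma> ! 0 = Sym x" using Cons.prems ne by simp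
  then show ?case
    unfolding wp_exec[symmetric]
    by (subst wp_Fill) (use Cons.prems ne in \<open>simp add: e[simplified] replicate_app_Cons_same\<close>)
qed

lemma exec_Match:
  assumes "i < length \<sigma>" "j < length \<sigma>" "i \<noteq> j" "\<not> P Blank"
    "\<sigma> ! i = zip_tape l (xs @ ys)" "\<sigma> ! j = zip_tape m (replicate c (Sym 1) @ zs)"
    "\<forall>x\<in>set xs. P x" "ys = [] \<or> \<not> P (hd ys)" "zs = [] \<or> hd zs \<noteq> Sym 1"
  shows "exec (Match P i j) \<sigma> (5 * min (length xs) c + 1)
    (Some (\<sigma>[i := zip_tape (rev (take c xs) @ l) (drop c xs @ ys),
       j := zip_tape (replicate (min (length xs) c) (Sym 1) @ m) (replicate (c - length xs) (Sym 1) @ zs)]))"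
  using assms(1-3,5-7)
proof (induction xs arbitrary: \<sigma> l m c)
  case Nil
  have "\<sigma>[i := zip_tape l ys, j := zip_tape m (replicate c (Sym 1) @ zs)] = \<sigma>"
    using Nil by (metis append_Nil list_update_id)
  moreover have "\<not> P (read (zip_tape l ys))" using assms(4,8) by (cases ys) auto
  ultimately show ?case unfolding wp_exec[symmetric] using Nil
    by (subst wp_Match) simp
next
  case (Cons x xs)
  show ?case
  proof (cases c)
    case 0
    have "\<sigma>[i := zip_tape l (x # xs @ ys), j := zip_tape m zs] = \<sigma>"
      using Cons.prems 0 by (metis append_Cons append_Nil list_update_id replicate_0)
    moreover have "read (zip_tape m zs) \<noteq> Sym 1" using assms(9) by (cases zs) auto
    ultimately show ?thesis unfolding wp_exec[symmetric] using Cons.prems 0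
      by (subst wp_Match) simp
  next
    case (Suc c')
    let ?\<sigma> = "\<sigma>[i := zip_tape (x # l) (xs @ ys), j := zip_tape (Sym 1 # m) (replicate c' (Sym 1) @ zs)]"
    have u: "\<sigma>[i := a, j := b, i := c, j := d] = \<sigma>[i := c, j := d]" for a b c d
      using \<open>i \<noteq> j\<close> by (simp add: list_update_swap[of j i])
    have "exec (Match P i j) ?\<sigma> (5 * min (length xs) c' + 1) (Some (?\<sigma>[i := zip_tape (rev (take c' xs) @ x # l) (drop c' xs @ ys),
       j := zip_tape (replicate (min (length xs) c') (Sym 1) @ Sym 1 # m) (replicate (c' - length xs) (Sym 1) @ zs)]))"
      by (rule Cons.IH) (use Cons.prems in auto)
    note e = exec_wp[OF this[unfolded u]]
    show ?thesis
      unfolding wp_exec[symmetric]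
      by (subst wp_Match) (use Cons.prems Suc in \<open>simp add: e[simplified] replicate_app_Cons_same\<close>)
  qed
qed

lemma exec_Seek0:
  assumes "\<forall>x\<in>set xs. x div 4 \<noteq> 0" "y div 4 = 0"
  shows "exec Seek0 (zip_tape l (map Sym (xs @ y # ys)) # rest) (3 * length xs + 1)
    (Some (zip_tape (map Sym (rev xs) @ l) (map Sym (y # ys)) # rest))"
  using assms(1)
proof (induction xs arbitrary: l)
  case Nil
  then show ?case unfolding wp_exec[symmetric] using assms(2) by (subst wp_Seek0) simp
next
  case (Cons x xs)
  have "exec Seek0 (zip_tape (Sym x # l) (map Sym (xs @ y # ys)) # rest) (3 * length xs + 1)
    (Some (zip_tape (map Sym (rev xs) @ Sym x # l) (map Sym (y # ys)) # rest))"
    by (rule Cons.IH) (use Cons.prems in simp)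
  note e = exec_wp[OF this]
  show ?case unfolding wp_exec[symmetric]
    by (subst wp_Seek0) (use Cons.prems in \<open>simp add: e[simplified]\<close>)
qed

subsection \<open>Reading a vertex number\<close>

definition ones :: "nat list \<Rightarrow> nat" where
  "ones zs = length (takeWhile (\<lambda>v. v div 4 = 1) zs)"

definition after :: "nat list \<Rightarrow> nat list" where
  "after zs = dropWhile (\<lambda>v. v div 4 = 1) zs"

lemma ones_after: "\<exists>xs. zs = xs @ after zs \<and> length xs = ones zs \<and> (\<forall>x\<in>set xs. x div 4 = 1) \<and>
    (after zs = [] \<or> hd (after zs) div 4 \<noteq> 1)"
  using hd_dropWhile[of "\<lambda>v. v div 4 = 1" zs]
  by (intro exI[of _ "takeWhile (\<lambda>v. v div 4 = 1) zs"])
    (auto simp only: ones_def after_def takeWhile_dropWhile_id dest: set_takeWhileD)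

text \<open>Functional counterpart of \<open>Block\<close>. The terminating symbol is returned
  because behind a tail it is the label of the arc together with its mark.\<close>

definition block :: "(nat \<Rightarrow> bool) \<Rightarrow> nat \<Rightarrow> nat list \<Rightarrow> (nat \<times> nat \<times> nat list) option" where
  "block Q n zs = (if ones zs < n \<and> after zs \<noteq> [] \<and> Q (hd (after zs) div 4)
     then Some (ones zs, hd (after zs), tl (after zs)) else None)"

lemma block_SomeD:
  assumes "block Q n zs = Some (u, c, r)"
  shows "\<exists>xs. zs = xs @ c # r \<and> length xs = u \<and> (\<forall>x\<in>set xs. x div 4 = 1) \<and> u < n \<and> Q (c div 4)"
proof -
  have *: "ones zs < n" "after zs = c # r" "Q (c div 4)" "u = ones zs"
    using assms by (auto simp: block_def split: if_splits)
  with ones_after[of zs] show ?thesis by auto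
qed

lemma block_eqI:
  assumes "zs = xs @ c # r" "\<forall>x\<in>set xs. x div 4 = 1" "length xs < n" "Q (c div 4)" "c div 4 \<noteq> 1"
  shows "block Q n zs = Some (length xs, c, r)"
proof -
  have "takeWhile (\<lambda>v. v div 4 = 1) zs = xs" "dropWhile (\<lambda>v. v div 4 = 1) zs = c # r"
    using assms(2,5) unfolding assms(1) by (simp_all add: takeWhile_append dropWhile_append)
  then show ?thesis using assms(3,4) by (simp add: block_def ones_def after_def)
qed

text \<open>The \<open>Sym 0\<close> behind the copied ones lets later comparisons see the end of
  the number. After matching against the \<open>n\<close> ones of tape 2, a one is left under the
  head there exactly if the number is below \<open>n\<close>.\<close>

definition Block :: "(symbol \<Rightarrow> bool) \<Rightarrow> nat \<Rightarrow> com" where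
  "Block P i = goR i ;; Fill i ;; put i (Sym 0) Stay ;; Rew i ;; goR i ;; Match (\<lambda>s. s = Sym 1) i 2 ;;
     Cond (\<lambda>rs. rs ! 2 = Sym 1 \<and> P (rs ! 0)) (goR 0) Fail ;; Rew i ;; goR i ;; Rew 2 ;; goR 2"

definition vertex_tape :: "nat \<Rightarrow> tape" where
  "vertex_tape u = zip_tape [LeftEnd] (replicate u (Sym 1) @ [Sym 0])"

text \<open>The \<open>19\<close> is \<open>5 + 5\<close> for \<open>Fill\<close> and
  \<open>Match\<close> and three times \<open>3\<close> for the rewinds, per digit.\<close>

lemma ex_Block:
  assumes i: "0 < i" "i \<noteq> 2" "i < length \<sigma>" "2 < length \<sigma>"
    and \<sigma>: "\<sigma> ! 0 = zip_tape l (map Sym zs)" "\<sigma> ! 2 = zip_tape [LeftEnd] (replicate n (Sym 1))" "\<sigma> ! i = init_tape []"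
    and P: "\<And>v. P (Sym v) \<longleftrightarrow> Q (v div 4)" "\<not> P Blank"
  shows "ex (Block P i) \<sigma> (19 * length zs + 60) (case block Q n zs of None \<Rightarrow> None
     | Some (u, c, r) \<Rightarrow> Some (\<sigma>[0 := zip_tape (map Sym (rev (take (Suc u) zs)) @ l) (map Sym r), i := vertex_tape u]))"
proof -
  \<comment> \<open>Names for the three tapes in play, so that updates in any order reduce to the
    same normal form.\<close>
  define st where "st A B D = \<sigma>[0 := A, i := B, 2 := D]" for A B D
  have ne: "\<sigma> \<noteq> []" using i by auto
  have st_nth: "st A B D ! 0 = A" "st A B D ! i = B" "st A B D ! 2 = D" for A B D
    using i ne by (simp_all add: st_def)
  have st_upd: "(st A B D)[0 := X] = st X B D" "(st A B D)[i := X] = st A X D" "(st A B D)[2 := X] = st A B X" for A B D X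
    unfolding st_def by (rule nth_equalityI; use i ne in \<open>simp add: nth_list_update\<close>)+
  have st_len: "length (st A B D) = length \<sigma>" "st A B D \<noteq> []" for A B D using ne by (simp_all add: st_def)
  have st_rd: "map read (st A B D) ! 0 = read A" "map read (st A B D) ! i = read B" "map read (st A B D) ! 2 = read D" for A B D
    using i ne by (simp_all add: nth_map st_len st_nth)
  note st = st_nth st_upd st_len st_rd
  let ?N = "zip_tape [LeftEnd] (replicate n (Sym 1))"
  let ?one = "Sym 1"
  have \<sigma>_st: "\<sigma> = st (zip_tape l (map Sym zs)) (zip_tape [] [LeftEnd]) ?N"
    unfolding st_def \<sigma>(1,2)[symmetric] using \<sigma>(3) by (simp add: init_tape_eq) (metis list_update_id)
  obtain xs where xs: "zs = xs @ after zs" "length xs = ones zs" "\<forall>x\<in>set xs. x div 4 = 1"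
    "after zs = [] \<or> hd (after zs) div 4 \<noteq> 1" using ones_after[of zs] by blast
  let ?u = "ones zs" and ?r = "after zs"
  let ?l = "map Sym (rev xs) @ l"
  have f1: "exec (Fill i) (st (zip_tape l (map Sym zs)) (zip_tape [LeftEnd] []) ?N) (5 * ?u + 1)
     (Some (st (zip_tape ?l (map Sym ?r)) (zip_tape (replicate ?u ?one @ [LeftEnd]) []) ?N))"
    using exec_Fill[of i "st (zip_tape l (map Sym zs)) (zip_tape [LeftEnd] []) ?N" l xs "?r" "[LeftEnd]"] xs i
    by (simp add: st)
  have f2: "exec (Rew i) (st A (zip_tape (replicate ?u ?one @ [LeftEnd]) [Sym 0]) D) (3 * ?u + 4)
     (Some (st A (zip_tape [] (LeftEnd # replicate ?u ?one @ [Sym 0])) D))" for A D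
    using exec_Rew_zip[of i "st A (zip_tape (replicate ?u ?one @ [LeftEnd]) [Sym 0]) D" "replicate ?u ?one" "[Sym 0]"] i
    by (simp add: st)
  let ?k = "min ?u n"
  let ?B = "zip_tape (replicate ?k ?one @ [LeftEnd]) (replicate (?u - n) ?one @ [Sym 0])"
  let ?D = "zip_tape (replicate ?k ?one @ [LeftEnd]) (replicate (n - ?u) ?one)"
  have f3: "exec (Match (\<lambda>s. s = Sym 1) i 2) (st A (vertex_tape ?u) ?N) (5 * ?k + 1) (Some (st A ?B ?D))" for A
    using exec_Match[of i "st A (vertex_tape ?u) ?N" 2 "\<lambda>s. s = Sym 1" "[LeftEnd]" "replicate ?u ?one" "[Sym 0]" "[LeftEnd]" n "[]"] i
    by (simp add: st vertex_tape_def min.commute)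
  have f4: "exec (Rew i) (st A ?B ?D) (3 * ?k + 4)
     (Some (st A (zip_tape [] (LeftEnd # replicate ?u ?one @ [Sym 0])) ?D))" for A
  proof -
    have "replicate ?k ?one @ replicate (?u - n) ?one = replicate ?u ?one"
      by (simp flip: replicate_add)
    then have rr: "replicate ?k ?one @ replicate (?u - n) ?one @ [Sym 0] = replicate ?u ?one @ [Sym 0]"
      by (metis append_assoc)
    have "exec (Rew i) (st A ?B ?D) (3 * length (replicate ?k ?one) + 4)
        (Some ((st A ?B ?D)[i := zip_tape [] (LeftEnd # rev (replicate ?k ?one) @ replicate (?u - n) ?one @ [Sym 0])]))"
      by (rule exec_Rew_zip) (use i in \<open>auto simp: st\<close>)
    then show ?thesis unfolding rev_replicate length_replicate rr st(5) .
  qed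
  have f5: "exec (Rew 2) (st A B ?D) (3 * ?k + 4)
     (Some (st A B (zip_tape [] (LeftEnd # replicate n ?one))))" for A B
  proof -
    have "replicate ?k ?one @ replicate (n - ?u) ?one = replicate n ?one"
      by (simp flip: replicate_add)
    then show ?thesis
      using exec_Rew_zip[of 2 "st A B ?D" "replicate ?k ?one" "replicate (n - ?u) ?one"] i
      by (simp add: st)
  qed
  have ul: "?u \<le> length zs" "?k \<le> ?u" using xs(1,2) by (metis le_add1 length_append, simp)
  define B where "B = ?B"
  define D where "D = ?D"
  have rD: "read D = (if ?u < n then ?one else Blank)"
    by (cases "n - ?u") (auto simp: D_def)
  note e1 = exec_wp[OF f1[folded One_nat_def]]
    and e2 = exec_wp[OF f2] and e3 = exec_wp[OF f3[folded B_def D_def, unfolded vertex_tape_def]]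
    and e4 = exec_wp[OF f4[folded B_def D_def]] and e5 = exec_wp[OF f5[folded D_def]]
  note e = e1[simplified] e2[simplified] e3[simplified] e4[simplified] e5[simplified]
  show ?thesis
  proof (cases "?u < n \<and> ?r \<noteq> [] \<and> Q (hd ?r div 4)")
    case True
    then obtain c r where r: "?r = c # r" "Q (c div 4)" by (cases ?r) auto
    have t: "take (Suc ?u) zs = xs @ [c]"
      using xs(2) by (subst xs(1)) (simp add: r)
    have "ex (Block P i) \<sigma> (19 * length zs + 60) (Some (st (zip_tape (Sym c # ?l) (map Sym r)) (vertex_tape ?u) ?N))"
      unfolding ex_wp Block_def
      by (subst \<sigma>_st) (use ul True in \<open>simp add: st e P r rD vertex_tape_def\<close>)
    moreover have "st (zip_tape (Sym c # ?l) (map Sym r)) (vertex_tape ?u) ?N =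
        \<sigma>[0 := zip_tape (Sym c # ?l) (map Sym r), i := vertex_tape ?u]"
      unfolding st_def \<sigma>(2)[symmetric] by (rule nth_equalityI; use i ne in \<open>simp add: nth_list_update\<close>)
    ultimately show ?thesis using True r by (simp add: block_def t)
  next
    case False
    have "\<not> (?u < n \<and> P (read (zip_tape ?l (map Sym ?r))))"
      using False P by (cases ?r) auto
    then have "ex (Block P i) \<sigma> (19 * length zs + 60) None"
      unfolding ex_wp Block_def
      by (subst \<sigma>_st) (use ul in \<open>auto simp add: st e rD\<close>)
    moreover have "block Q n zs = None" using False by (simp add: block_def)
    ultimately show ?thesis by simp
  qed
qed

subsection \<open>Checking a topological order\<close>

text \<open>
  The bits \<open>w\<close> list vertices in unary, each followed by 0. Then \<open>found u v 0 w\<close> states that \<open>u\<close>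
  occurs in the list and that no earlier entry is \<open>v\<close>.
\<close>

fun found :: "nat \<Rightarrow> nat \<Rightarrow> nat \<Rightarrow> nat list \<Rightarrow> bool" where
  "found u v k [] = False"
| "found u v k (b # w) =
     (if b = 1 then found u v (Suc k) w else k = u \<or> k \<noteq> v \<and> found u v 0 w)"

text \<open>Head position \<open>Suc k\<close> stands for \<open>k\<close> digits compared so far.
  The end marker is then visible exactly if the vertex is \<open>k\<close>
  (\<open>read_vt\<close>).\<close>

definition vt :: "nat \<Rightarrow> nat \<Rightarrow> tape" where
  "vt u p = tape_at (LeftEnd # replicate u (Sym 1) @ [Sym 0]) p"

lemma vertex_tape_vt: "vertex_tape u = vt u (Suc 0)"
  by (simp add: vertex_tape_def vt_def zip_tape_def)

lemma act_vt [simp]: "act (read (vt u p), m) (vt u p) = vt u (move_head m p)"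
  unfolding vt_def by (rule act_tape_at_keep)

lemma read_vt [simp]: "read (vt u (Suc k)) = Sym 0 \<longleftrightarrow> k = u"
  by (auto simp: vt_def read_tape_at nth_append)

lemma exec_Rew_vt: "i < length \<sigma> \<Longrightarrow> \<sigma> ! i = vt u p \<Longrightarrow> exec (Rew i) \<sigma> (3 * p + 1) (Some (\<sigma>[i := vt u 0]))"
  unfolding vt_def by (rule exec_Rew) auto

text \<open>A one advances both comparisons. At a separator the loop test has already ruled out the
  entry \<open>u\<close>; the entry \<open>v\<close> or the end of the list means failure, and after
  any other entry both vertices are rewound.\<close>

definition search_step :: com where
  "search_step = Cond (\<lambda>rs. rs ! 1 = Sym 1) (goR 1 ;; goR 5 ;; goR 6)
     (Cond (\<lambda>rs. rs ! 1 = Sym 0 \<and> rs ! 6 \<noteq> Sym 0) (goR 1 ;; Rew 5 ;; goR 5 ;; Rew 6 ;; goR 6) Fail)"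

definition search_loop :: com where
  "search_loop = While (\<lambda>rs. \<not> (rs ! 1 = Sym 0 \<and> rs ! 5 = Sym 0)) search_step"

lemmas wp_search_loop = wp_While[of "\<lambda>rs. \<not> (rs ! 1 = Sym 0 \<and> rs ! 5 = Sym 0)" search_step, folded search_loop_def]

definition order_tape :: "nat list \<Rightarrow> nat list \<Rightarrow> tape" where
  "order_tape w1 w2 = zip_tape (map Sym (rev w1) @ [LeftEnd]) (map Sym w2)"

lemma order_tape_simps [simp]:
  "read (order_tape w1 []) = Blank" "read (order_tape w1 (b # w2)) = Sym b"
  "act (Sym b, GoRight) (order_tape w1 (b # w2)) = order_tape (w1 @ [b]) w2"
  by (simp_all add: order_tape_def)

lemma ex_While:
  assumes "b (map read \<sigma>)" "ex (c ;; While b c) \<sigma> T r" "T + 1 \<le> T'"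
  shows "ex (While b c) \<sigma> T' r"
proof -
  obtain t where "t \<le> T" "exec (c ;; While b c) \<sigma> t r" using assms(2) by (auto simp: ex_def)
  then show ?thesis using assms(1,3) by (intro exec_ex[OF exec_While[of b \<sigma> c t r]]) auto
qed

text \<open>On success tape 6 stands at \<open>Suc u\<close> too, so whether it shows its end marker
  tells later if \<open>u = v\<close>. The \<open>6 * m\<close> pays for rewinding two vertices at
  three steps per cell.\<close>

lemma ex_search_loop:
  assumes "set w2 \<subseteq> {0, 1}" "k \<le> length w1" "length w1 + length w2 = m"
  shows "if found u v k w2
     then \<exists>w1' w2'. w1' @ w2' = w1 @ w2 \<and>
       ex search_loop (t0 # order_tape w1 w2 # t2 # t3 # t4 # vt u (Suc k) # vt v (Suc k) # rest)
         (length w2 * (6 * m + 40) + 10)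
         (Some (t0 # order_tape w1' w2' # t2 # t3 # t4 # vt u (Suc u) # vt v (Suc u) # rest))
     else ex search_loop (t0 # order_tape w1 w2 # t2 # t3 # t4 # vt u (Suc k) # vt v (Suc k) # rest)
         (length w2 * (6 * m + 40) + 10) None"
  using assms
proof (induction w2 arbitrary: w1 k)
  case Nil
  have "ex search_loop (t0 # order_tape w1 [] # t2 # t3 # t4 # vt u (Suc k) # vt v (Suc k) # rest) 10 None"
    unfolding ex_wp by (subst wp_search_loop) (simp add: search_step_def)
  then show ?case by simp
next
  case (Cons b w2)
  let ?s = "t0 # order_tape w1 (b # w2) # t2 # t3 # t4 # vt u (Suc k) # vt v (Suc k) # rest"
  let ?s' = "\<lambda>k. t0 # order_tape (w1 @ [b]) w2 # t2 # t3 # t4 # vt u (Suc k) # vt v (Suc k) # rest"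
  have rec: "ex search_loop ?s (length (b # w2) * (6 * m + 40) + 10) r"
    if e: "exec search_step ?s t (Some (?s' k'))" and t: "t \<le> 6 * m + 30"
      and nf: "\<not> (b = 0 \<and> k = u)" and x: "ex search_loop (?s' k') (length w2 * (6 * m + 40) + 10) r" for t k' r
  proof -
    obtain t2 where t2: "t2 \<le> length w2 * (6 * m + 40) + 10" "exec search_loop (?s' k') t2 r"
      using x by (auto simp: ex_def)
    have "exec search_loop ?s (t + t2 + 2) r"
      unfolding wp_exec[symmetric]
      by (subst wp_search_loop) (use nf Cons.prems(1) in \<open>auto simp: exec_wp[OF e] exec_wp[OF t2(2)] split: option.splits\<close>)
    then show ?thesis by (rule exec_ex) (use t2(1) t in simp)
  qed
  consider "b = 1" | "b = 0" "k = u" | "b = 0" "k \<noteq> u" "k = v" | "b = 0" "k \<noteq> u" "k \<noteq> v"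
    using Cons.prems(1) by auto
  then show ?case
  proof cases
    case 1
    have e: "exec search_step ?s 6 (Some (?s' (Suc k)))"
      unfolding wp_exec[symmetric] search_step_def using 1 by simp
    show ?thesis
      using rec[OF e] Cons.IH[of "Suc k" "w1 @ [b]"] Cons.prems 1 by (auto split: if_splits)
  next
    case 2
    have "ex search_loop ?s (length (b # w2) * (6 * m + 40) + 10) (Some ?s)"
      unfolding ex_wp by (subst wp_search_loop) (use 2 in simp)
    then show ?thesis using 2 by auto
  next
    case 3
    have "ex search_loop ?s (length (b # w2) * (6 * m + 40) + 10) None"
      unfolding ex_wp by (subst wp_search_loop) (use 3 in \<open>simp add: search_step_def\<close>)
    then show ?thesis using 3 by auto
  next
    case 4
    note r5 = exec_wp[OF exec_Rew_vt[of 5 "t0 # order_tape (w1 @ [0]) w2 # t2 # t3 # t4 # vt u (Suc k) # vt v (Suc k) # rest" u "Suc k"]]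
    note r6 = exec_wp[OF exec_Rew_vt[of 6 "t0 # order_tape (w1 @ [0]) w2 # t2 # t3 # t4 # vt u (Suc 0) # vt v (Suc k) # rest" v "Suc k"]]
    have e: "exec search_step ?s (6 * k + 17) (Some (?s' 0))"
      unfolding wp_exec[symmetric] search_step_def using 4 by (simp add: r5[simplified] r6[simplified])
    have "6 * k + 17 \<le> 6 * m + 30" using Cons.prems by simp
    then show ?thesis
      using rec[OF e] Cons.IH[of 0 "w1 @ [b]"] Cons.prems 4 by (auto split: if_splits)
  qed
qed

text \<open>The test \<open>u \<noteq> v\<close> excludes self-loops, which \<open>found\<close>
  would accept for every listed \<open>u\<close>.\<close>

function check_arcs :: "nat \<Rightarrow> nat list \<Rightarrow> nat list \<Rightarrow> ((nat \<times> nat \<times> nat) \<times> bool) list option" where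
  "check_arcs n w zs = (if zs = [] then Some [] else
     (case block (\<lambda>d. d \<ge> 2) n zs of None \<Rightarrow> None | Some (u, c, r) \<Rightarrow>
     (case block (\<lambda>d. d = 0) n r of None \<Rightarrow> None | Some (v, c', r') \<Rightarrow>
       if u \<noteq> v \<and> found u v 0 w
       then map_option ((#) ((u, c div 4 - 2, v), c mod 4 \<ge> 2)) (check_arcs n w r')
       else None)))"
  by pat_completeness auto
termination
  by (relation "measure (\<lambda>(n, w, zs). length zs)") (auto dest!: block_SomeD)

declare check_arcs.simps [simp del]

abbreviation clear :: "nat \<Rightarrow> com" where
  "clear \<equiv> Clean (\<lambda>s. s = LeftEnd)"

lemma ex_clear_vt:
  assumes "i < length \<sigma>" "\<sigma> ! i = vt u p" "u \<le> m" "p \<le> Suc m"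
  shows "ex (clear i) \<sigma> (12 * m + 40) (Some (\<sigma>[i := init_tape []]))"
proof -
  obtain t where "t \<le> 6 * (length (replicate u (Sym 1) @ [Sym 0]) + p) + 20"
    "exec (clear i) \<sigma> t (Some (\<sigma>[i := tape_at [LeftEnd] 0]))"
    using exec_Clean[OF assms(1,2)[unfolded vt_def], of "\<lambda>s. s = LeftEnd"] by auto
  then show ?thesis using assms(3,4) by (intro exec_ex[of _ _ t]) (auto simp: init_tape_Nil)
qed

definition check_arc :: com where
  "check_arc = Block is_label 5 ;; Block is0 6 ;; search_loop ;; Cond (\<lambda>rs. rs ! 6 = Sym 0) Fail Skip ;;
     Rew 1 ;; goR 1 ;; clear 5 ;; clear 6"

definition check_loop :: com where
  "check_loop = While (\<lambda>rs. rs ! 0 \<noteq> Blank) check_arc"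

lemmas wp_check_loop = wp_While[of "\<lambda>rs. rs ! 0 \<noteq> Blank" check_arc, folded check_loop_def]

lemmas ex_check_loop_step = ex_While[of "\<lambda>rs. rs ! 0 \<noteq> Blank" _ check_arc, folded check_loop_def]

lemma ex_check_arc:
  assumes w: "set w \<subseteq> {0, 1}" and m: "length w \<le> m" "n \<le> m" "length zs \<le> m"
  shows "ex check_arc (zip_tape l (map Sym zs) # order_tape [] w # zip_tape [LeftEnd] (replicate n (Sym 1)) #
      t3 # t4 # init_tape [] # init_tape [] # rest) (6 * m * m + 200 * m + 400)
    (case block (\<lambda>d. d \<ge> 2) n zs of None \<Rightarrow> None | Some (u, c, r) \<Rightarrow>
     (case block (\<lambda>d. d = 0) n r of None \<Rightarrow> None | Some (v, c', r') \<Rightarrow>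
       if u \<noteq> v \<and> found u v 0 w then Some (zip_tape (map Sym (rev (take (Suc v) r)) @ map Sym (rev (take (Suc u) zs)) @ l)
          (map Sym r') # order_tape [] w # zip_tape [LeftEnd] (replicate n (Sym 1)) #
          t3 # t4 # init_tape [] # init_tape [] # rest) else None))"
proof -
  let ?N = "zip_tape [LeftEnd] (replicate n (Sym 1))" and ?W = "order_tape [] w"
  let ?s0 = "zip_tape l (map Sym zs) # ?W # ?N # t3 # t4 # init_tape [] # init_tape [] # rest"
  have b1: "ex (Block is_label 5) ?s0 (19 * m + 60) (case block (\<lambda>d. d \<ge> 2) n zs of None \<Rightarrow> None
     | Some (u, c, r) \<Rightarrow> Some (zip_tape (map Sym (rev (take (Suc u) zs)) @ l) (map Sym r) # ?W # ?N # t3 # t4 # vertex_tape u # init_tape [] # rest))"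
    using ex_Block[of 5 ?s0 l zs n is_label "\<lambda>d. d \<ge> 2"] m
    by (auto split: option.splits elim!: ex_mono)
  show ?thesis
  proof (cases "block (\<lambda>d. d \<ge> 2) n zs")
    case None
    then show ?thesis unfolding check_arc_def using b1 by (auto intro: ex_Seq_None)
  next
    case (Some ucr)
    then obtain u c r where ucr: "block (\<lambda>d. d \<ge> 2) n zs = Some (u, c, r)" by (cases ucr) auto
    obtain xs where xs: "zs = xs @ c # r" "length xs = u" "u < n" using block_SomeD[OF ucr] by auto
    let ?l1 = "map Sym (rev (take (Suc u) zs)) @ l"
    let ?s1 = "zip_tape ?l1 (map Sym r) # ?W # ?N # t3 # t4 # vertex_tape u # init_tape [] # rest"
    have b1': "ex (Block is_label 5) ?s0 (19 * m + 60) (Some ?s1)" using b1 ucr by simp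
    have b2: "ex (Block is0 6) ?s1 (19 * m + 60) (case block (\<lambda>d. d = 0) n r of None \<Rightarrow> None
       | Some (v, c, r') \<Rightarrow> Some (zip_tape (map Sym (rev (take (Suc v) r)) @ ?l1) (map Sym r') # ?W # ?N # t3 # t4 # vertex_tape u # vertex_tape v # rest))"
      using ex_Block[of 6 ?s1 ?l1 r n is0 "\<lambda>d. d = 0"] m xs
      by (auto split: option.splits elim!: ex_mono)
    show ?thesis
    proof (cases "block (\<lambda>d. d = 0) n r")
      case None
      have "ex check_arc ?s0 (6 * m * m + 200 * m + 400) None"
        unfolding check_arc_def using b2 None
        by (intro ex_Seq[OF b1'] ex_Seq_None[where ?T1.0 = "19 * m + 60"]) auto
      then show ?thesis using None ucr by simp
    next
      case (Some vcr)
      then obtain v c' r' where vcr: "block (\<lambda>d. d = 0) n r = Some (v, c', r')" by (cases vcr) auto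
      obtain ys where ys: "r = ys @ c' # r'" "length ys = v" "v < n" using block_SomeD[OF vcr] by auto
      let ?t0 = "zip_tape (map Sym (rev (take (Suc v) r)) @ ?l1) (map Sym r')"
      let ?s2 = "?t0 # ?W # ?N # t3 # t4 # vt u (Suc 0) # vt v (Suc 0) # rest"
      have b2': "ex (Block is0 6) ?s1 (19 * m + 60) (Some ?s2)" using b2 vcr by (simp add: vertex_tape_vt)
      have lw: "length w * (6 * length w + 40) + 10 \<le> m * (6 * m + 40) + 10"
        using m by (intro add_mono mult_le_mono) auto
      note s = ex_search_loop[OF w, of 0 "[]" "length w" u v ?t0 ?N t3 t4 rest, simplified]
      show ?thesis
      proof (cases "found u v 0 w")
        case False
        then have b3: "ex search_loop ?s2 (m * (6 * m + 40) + 10) None" using s lw by (auto elim: ex_mono)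
        have "ex check_arc ?s0 (6 * m * m + 200 * m + 400) None"
          unfolding check_arc_def
          by (rule ex_Seq[OF b1' ex_Seq[OF b2' ex_Seq_None[OF b3 le_refl] le_refl]]) (simp add: algebra_simps)
        then show ?thesis using vcr ucr False by simp
      next
        case True
        then have "\<exists>w1 w2. w1 @ w2 = w \<and> ex search_loop ?s2 (length w * (6 * length w + 40) + 10)
            (Some (?t0 # order_tape w1 w2 # ?N # t3 # t4 # vt u (Suc u) # vt v (Suc u) # rest))"
          using s by simp
        then obtain w1 w2 where w12: "w1 @ w2 = w" and "ex search_loop ?s2 (length w * (6 * length w + 40) + 10)
            (Some (?t0 # order_tape w1 w2 # ?N # t3 # t4 # vt u (Suc u) # vt v (Suc u) # rest))" by blast
        from ex_mono[OF this(2) lw] have b3: "ex search_loop ?s2 (m * (6 * m + 40) + 10)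
            (Some (?t0 # order_tape w1 w2 # ?N # t3 # t4 # vt u (Suc u) # vt v (Suc u) # rest))" .
        let ?s3 = "?t0 # order_tape w1 w2 # ?N # t3 # t4 # vt u (Suc u) # vt v (Suc u) # rest"
        show ?thesis
        proof (cases "u = v")
          case True
          have b4: "ex (Cond (\<lambda>rs. rs ! 6 = Sym 0) Fail Skip) ?s3 1 None"
            unfolding ex_wp using True by simp
          have "ex check_arc ?s0 (6 * m * m + 200 * m + 400) None"
            unfolding check_arc_def
            by (rule ex_Seq[OF b1' ex_Seq[OF b2' ex_Seq[OF b3 ex_Seq_None[OF b4 le_refl] le_refl] le_refl]])
              (simp add: algebra_simps)
          then show ?thesis using vcr ucr True by simp
        next
          case False
          have b4: "ex (Cond (\<lambda>rs. rs ! 6 = Sym 0) Fail Skip) ?s3 1 (Some ?s3)"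
            unfolding ex_wp using False by simp
          let ?s4 = "?t0 # zip_tape [] (LeftEnd # map Sym w) # ?N # t3 # t4 # vt u (Suc u) # vt v (Suc u) # rest"
          have "exec (Rew 1) ?s3 (3 * length (map Sym (rev w1)) + 4) (Some (?s3[1 := zip_tape [] (LeftEnd # rev (map Sym (rev w1)) @ map Sym w2)]))"
            by (rule exec_Rew_zip) (auto simp: order_tape_def)
          moreover have "?s3[1 := zip_tape [] (LeftEnd # rev (map Sym (rev w1)) @ map Sym w2)] = ?s4"
            by (simp add: rev_map flip: w12)
          moreover have "length w1 \<le> m" using m w12 by auto
          ultimately have b5: "ex (Rew 1) ?s3 (3 * m + 4) (Some ?s4)" by (auto intro: exec_ex)
          let ?s5 = "?t0 # ?W # ?N # t3 # t4 # vt u (Suc u) # vt v (Suc u) # rest"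
          have b6: "ex (goR 1) ?s4 1 (Some ?s5)"
            unfolding ex_wp by (simp add: order_tape_def)
          have b7: "ex (clear 5) ?s5 (12 * m + 40) (Some (?s5[5 := init_tape []]))"
            by (rule ex_clear_vt[where u = u and p = "Suc u"]) (use xs m in auto)
          have b8: "ex (clear 6) (?s5[5 := init_tape []]) (12 * m + 40) (Some ((?s5[5 := init_tape []])[6 := init_tape []]))"
            by (rule ex_clear_vt[where u = v and p = "Suc u"]) (use xs ys m in auto)
          have "ex check_arc ?s0 (6 * m * m + 200 * m + 400) (Some ((?s5[5 := init_tape []])[6 := init_tape []]))"
            unfolding check_arc_def
            by (rule ex_Seq[OF b1' ex_Seq[OF b2' ex_Seq[OF b3 ex_Seq[OF b4 ex_Seq[OF b5 ex_Seq[OF b6 ex_Seq[OF b7 b8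
                  le_refl] le_refl] le_refl] le_refl] le_refl] le_refl]])
              (simp add: algebra_simps)
          then show ?thesis using vcr ucr True False by simp
        qed
      qed
    qed
  qed
qed

lemma ex_check_loop:
  assumes w: "set w \<subseteq> {0, 1}" and m: "length w \<le> m" "n \<le> m" "length zs \<le> m"
  shows "ex check_loop (zip_tape l (map Sym zs) # order_tape [] w # zip_tape [LeftEnd] (replicate n (Sym 1)) #
      t3 # t4 # init_tape [] # init_tape [] # rest) (Suc (length zs) * (6 * m * m + 200 * m + 410))
    (map_option (\<lambda>_. zip_tape (map Sym (rev zs) @ l) [] # order_tape [] w # zip_tape [LeftEnd] (replicate n (Sym 1)) #
      t3 # t4 # init_tape [] # init_tape [] # rest) (check_arcs n w zs))"
  using m(3)
proof (induction "length zs" arbitrary: l zs rule: less_induct)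
  case less
  define s where "s A = A # order_tape [] w # zip_tape [LeftEnd] (replicate n (Sym 1)) #
      t3 # t4 # init_tape [] # init_tape [] # rest" for A
  let ?D = "6 * m * m + 200 * m + 400"
  show ?case
  proof (cases "zs = []")
    case True
    then show ?thesis unfolding ex_wp by (subst wp_check_loop) (simp add: check_arcs.simps)
  next
    case False
    then obtain z zs' where z: "zs = z # zs'" by (cases zs) auto
    have b: "map read (s (zip_tape l (map Sym zs))) ! 0 \<noteq> Blank" by (simp add: s_def z)
    note arc = ex_check_arc[OF w m(1,2) less.prems, of l t3 t4 rest, folded s_def]
    have None: ?thesis if "ex check_arc (s (zip_tape l (map Sym zs))) ?D None" "check_arcs n w zs = None"
    proof -
      have "ex check_loop (s (zip_tape l (map Sym zs))) (Suc (length zs) * (6 * m * m + 200 * m + 410)) None"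
        by (rule ex_check_loop_step[OF b ex_Seq_None[OF that(1) le_refl]]) simp
      then show ?thesis using that(2) by (simp add: s_def)
    qed
    show ?thesis
    proof (cases "block (\<lambda>d. d \<ge> 2) n zs")
      case None1: None
      then show ?thesis using arc False by (intro None) (auto simp: check_arcs.simps)
    next
      case (Some ucr)
      then obtain u c r where ucr: "block (\<lambda>d. d \<ge> 2) n zs = Some (u, c, r)" by (cases ucr) auto
      obtain xs where xs: "zs = xs @ c # r" "length xs = u" "u < n" using block_SomeD[OF ucr] by auto
      show ?thesis
      proof (cases "block (\<lambda>d. d = 0) n r")
        case None2: None
        then show ?thesis using arc ucr False by (intro None) (auto simp: check_arcs.simps)
      next
        case (Some vcr)
        then obtain v c' r' where vcr: "block (\<lambda>d. d = 0) n r = Some (v, c', r')" by (cases vcr) auto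
        obtain ys where ys: "r = ys @ c' # r'" "length ys = v" "v < n" using block_SomeD[OF vcr] by auto
        show ?thesis
        proof (cases "u \<noteq> v \<and> found u v 0 w")
          case False2: False
          then have "check_arcs n w zs = None" using ucr vcr by (subst check_arcs.simps) (auto simp: z)
          then show ?thesis using arc ucr vcr False2 by (intro None) auto
        next
          case True
          let ?l = "map Sym (rev (take (Suc v) r)) @ map Sym (rev (take (Suc u) zs)) @ l"
          have l: "map Sym (rev r') @ ?l = map Sym (rev zs) @ l"
            using xs ys by simp
          have 1: "ex check_arc (s (zip_tape l (map Sym zs))) ?D (Some (s (zip_tape ?l (map Sym r'))))"
            using arc ucr vcr True by simp
          have 2: "ex check_loop (s (zip_tape ?l (map Sym r'))) (Suc (length r') * (6 * m * m + 200 * m + 410))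
            (map_option (\<lambda>_. s (zip_tape (map Sym (rev zs) @ l) [])) (check_arcs n w r'))"
            using less.hyps[of r' ?l] less.prems xs ys unfolding l by (simp add: s_def)
          have "ex check_loop (s (zip_tape l (map Sym zs))) (Suc (length zs) * (6 * m * m + 200 * m + 410))
            (map_option (\<lambda>_. s (zip_tape (map Sym (rev zs) @ l) [])) (check_arcs n w r'))"
          proof (rule ex_check_loop_step[OF b ex_Seq[OF 1 2 le_refl]])
            have "Suc (length r') * K \<le> length zs * K" for K
              by (rule mult_le_mono1) (simp add: xs(1) ys(1))
            from this[of "(6 * m * m + 200 * m + 410)"]
            show "?D + 1 + Suc (length r') * (6 * m * m + 200 * m + 410) + 1 \<le> Suc (length zs) * (6 * m * m + 200 * m + 410)"
              unfolding mult_Suc[of "length zs"] by linarith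
          qed
          moreover have "check_arcs n w zs = map_option ((#) ((u, c div 4 - 2, v), c mod 4 \<ge> 2)) (check_arcs n w r')"
            using ucr vcr True by (subst check_arcs.simps) (simp add: z)
          ultimately show ?thesis by (simp add: s_def option.map_comp comp_def)
        qed
      qed
    qed
  qed
qed

subsection \<open>Following the marked arcs\<close>

fun walk_step :: "nat \<times> nat list \<Rightarrow> (nat \<times> nat \<times> nat) \<times> bool \<Rightarrow> nat \<times> nat list" where
  "walk_step (c, y) ((u, a, v), marked) = (if marked \<and> u = c then (v, y @ [a]) else (c, y))"

text \<open>
  The arcs of the path may be encoded in any order, but each pass over them follows at least one.
\<close>

definition walk :: "((nat \<times> nat \<times> nat) \<times> bool) list \<Rightarrow> nat \<Rightarrow> nat \<times> nat list \<Rightarrow> nat \<times> nat list" where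
  "walk ems k = (\<lambda>cy. foldl walk_step cy ems) ^^ k"

text \<open>After the match, tape 3 shows its end marker and tape 0 a label exactly if the tail is
  the current vertex. If the arc is also marked, its head replaces the current vertex; otherwise the
  tape is advanced to the separator of the arc.\<close>

definition follow :: "nat \<Rightarrow> com" where
  "follow b = Match is1 0 3 ;;
     Cond (\<lambda>rs. rs ! 3 = Sym 0 \<and> is_label (rs ! 0) \<and> is_marked (rs ! 0))
       (Put 7 (\<lambda>rs. lift_sym b (\<lambda>v. v div 4 - 2) (rs ! 0)) GoRight ;; goR 0 ;; clear 3 ;; goR 3 ;;
        Fill 3 ;; put 3 (Sym 0) Stay)
       Seek0 ;;
     goR 0 ;; Rew 3 ;; goR 3"

definition pass :: "nat \<Rightarrow> com" where
  "pass b = While (\<lambda>rs. rs ! 0 \<noteq> Blank) (follow b)"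

lemmas wp_pass = wp_While[of "\<lambda>rs. rs ! 0 \<noteq> Blank" "follow b" for b, folded pass_def]
lemmas ex_pass_step = ex_While[of "\<lambda>rs. rs ! 0 \<noteq> Blank" _ "follow b" for b, folded pass_def]

definition output_tape :: "nat list \<Rightarrow> tape" where
  "output_tape y = zip_tape (map Sym (rev y) @ [LeftEnd]) []"

lemma act_output_tape [simp]: "act (Sym a, GoRight) (output_tape y) = output_tape (y @ [a])"
  by (simp add: output_tape_def)

lemma zip_tape_vt: "zip_tape (replicate u (Sym 1) @ [LeftEnd]) [Sym 0] = vt u (Suc u)"
  by (simp add: vt_def zip_tape_def)

lemma ex_follow:
  assumes zs: "zs = xs @ c # ys @ c' # r" "\<forall>x\<in>set xs. x div 4 = 1" "\<forall>x\<in>set ys. x div 4 = 1"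
    "c div 4 \<ge> 2" "c' div 4 = 0" "c div 4 - 2 < b" and m: "length zs \<le> m" "p \<le> m"
  shows "ex (follow b) (zip_tape l (map Sym zs) # t1 # t2 # vertex_tape p # t4 # t5 # t6 # output_tape y # rest) (50 * m + 100)
    (case walk_step (p, y) ((length xs, c div 4 - 2, length ys), c mod 4 \<ge> 2) of (p', y') \<Rightarrow>
      Some (zip_tape (map Sym (rev (xs @ c # ys @ [c'])) @ l) (map Sym r) # t1 # t2 # vertex_tape p' # t4 # t5 # t6 # output_tape y' # rest))"
proof -
  let ?u = "length xs" and ?v = "length ys" and ?one = "Sym 1"
  let ?s = "\<lambda>A C y. A # t1 # t2 # C # t4 # t5 # t6 # output_tape y # rest"
  let ?tail = "map Sym (c # ys @ c' # r)"
  let ?C = "zip_tape (replicate (min ?u p) ?one @ [LeftEnd]) (replicate (p - ?u) ?one @ [Sym 0])"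
  let ?A = "zip_tape (rev (take p (map Sym xs)) @ l) (drop p (map Sym xs) @ ?tail)"
  have "exec (Match is1 0 3) (?s (zip_tape l (map Sym zs)) (vertex_tape p) y) (5 * min (length (map Sym xs)) p + 1)
     (Some ((?s (zip_tape l (map Sym zs)) (vertex_tape p) y)
       [0 := zip_tape (rev (take p (map Sym xs)) @ l) (drop p (map Sym xs) @ ?tail),
        3 := zip_tape (replicate (min (length (map Sym xs)) p) ?one @ [LeftEnd]) (replicate (p - length (map Sym xs)) ?one @ [Sym 0])]))"
    by (rule exec_Match) (use zs in \<open>auto simp: vertex_tape_def\<close>)
  then have e1: "exec (Match is1 0 3) (?s (zip_tape l (map Sym zs)) (vertex_tape p) y) (5 * min ?u p + 1) (Some (?s ?A ?C y))"
    by simp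
  let ?l = "map Sym (rev (xs @ c # ys)) @ l"
  have u: "?u + ?v \<le> m" using m by (simp add: zs(1))
  show ?thesis
  proof (cases "c mod 4 \<ge> 2 \<and> ?u = p")
    case True
    have A: "?A = zip_tape (map Sym (rev xs) @ l) ?tail" and C: "?C = vt p (Suc p)"
      using True by (simp_all add: rev_map zip_tape_vt[unfolded One_nat_def])
    obtain t where t: "t \<le> 12 * m + 40" "exec (clear 3) (?s (zip_tape (Sym c # map Sym (rev xs) @ l) (map Sym (ys @ c' # r))) (vt p (Suc p)) (y @ [c div 4 - 2])) t
       (Some (?s (zip_tape (Sym c # map Sym (rev xs) @ l) (map Sym (ys @ c' # r))) (init_tape []) (y @ [c div 4 - 2])))"
      using ex_clear_vt[of 3 "?s (zip_tape (Sym c # map Sym (rev xs) @ l) (map Sym (ys @ c' # r))) (vt p (Suc p)) (y @ [c div 4 - 2])" p "Suc p" m] m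
      by (auto simp: ex_def)
    have "exec (Fill 3) (?s (zip_tape (Sym c # map Sym (rev xs) @ l) (map Sym (ys @ c' # r))) (zip_tape [LeftEnd] []) (y @ [c div 4 - 2])) (5 * ?v + 1)
       (Some ((?s (zip_tape (Sym c # map Sym (rev xs) @ l) (map Sym (ys @ c' # r))) (zip_tape [LeftEnd] []) (y @ [c div 4 - 2]))
         [0 := zip_tape (map Sym (rev ys) @ Sym c # map Sym (rev xs) @ l) (map Sym (c' # r)), 3 := zip_tape (replicate ?v ?one @ [LeftEnd]) []]))"
      by (rule exec_Fill) (use zs in auto)
    then have e3: "exec (Fill 3) (?s (zip_tape (Sym c # map Sym (rev xs) @ l) (map Sym (ys @ c' # r))) (zip_tape [LeftEnd] []) (y @ [c div 4 - 2])) (5 * ?v + 1)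
       (Some (?s (zip_tape ?l (map Sym (c' # r))) (zip_tape (replicate ?v ?one @ [LeftEnd]) []) (y @ [c div 4 - 2])))"
      by simp
    have "exec (Rew 3) (?s (zip_tape (Sym c' # ?l) (map Sym r)) (vt ?v (Suc ?v)) (y @ [c div 4 - 2])) (3 * Suc ?v + 1)
       (Some ((?s (zip_tape (Sym c' # ?l) (map Sym r)) (vt ?v (Suc ?v)) (y @ [c div 4 - 2]))[3 := vt ?v 0]))"
      by (rule exec_Rew_vt) auto
    then have e4: "exec (Rew 3) (?s (zip_tape (Sym c' # ?l) (map Sym r)) (vt ?v (Suc ?v)) (y @ [c div 4 - 2])) (3 * ?v + 4)
       (Some (?s (zip_tape (Sym c' # ?l) (map Sym r)) (vt ?v 0) (y @ [c div 4 - 2])))" by (simp add: add.commute)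
    have lab: "lift_sym b (\<lambda>v. v div 4 - 2) (Sym c) = Sym (c div 4 - 2)" using zs(6) by (rule lift_sym_Sym)
    have "ex (follow b) (?s (zip_tape l (map Sym zs)) (vertex_tape p) y) (50 * m + 100)
      (Some (?s (zip_tape (Sym c' # ?l) (map Sym r)) (vertex_tape ?v) (y @ [c div 4 - 2])))"
      unfolding ex_wp follow_def
      using t(1) u True zs(4) m
      by (simp add: exec_wp[OF e1[unfolded A C vertex_tape_vt], simplified] exec_wp[OF t(2), simplified] exec_wp[OF e3, simplified]
          exec_wp[OF e4, simplified] lab init_tape_eq zip_tape_vt[unfolded One_nat_def] vertex_tape_vt
          exec_wp[OF t(2)[unfolded init_tape_eq], simplified])
    then show ?thesis using True by simp
  next
    case False
    \<comment> \<open>If the two numbers differ, the longer one still shows a one; if they agree,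
      the mark is missing.\<close>
    have nt: "\<not> (read ?C = Sym 0 \<and> is_label (read ?A) \<and> is_marked (read ?A))"
    proof (cases "p < ?u")
      case True
      then obtain x xs' where d: "drop p xs = x # xs'" by (metis Cons_nth_drop_Suc)
      then have "x div 4 = 1" using zs(2) by (metis in_set_dropD list.set_intros(1))
      then show ?thesis by (simp add: drop_map d)
    next
      case np: False
      show ?thesis
      proof (cases "p = ?u")
        case True
        then show ?thesis using False by simp
      next
        case nu: False
        then obtain k where "p - ?u = Suc k" using np by (metis Suc_diff_Suc linorder_neqE_nat)
        then show ?thesis by simp
      qed
    qed
    have sk: "exec Seek0 (?s (zip_tape (rev (take p (map Sym xs)) @ l) (map Sym ((drop p xs @ c # ys) @ c' # r))) ?C y)
       (3 * length (drop p xs @ c # ys) + 1)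
       (Some (?s (zip_tape (map Sym (rev (drop p xs @ c # ys)) @ rev (take p (map Sym xs)) @ l) (map Sym (c' # r))) ?C y))"
      by (rule exec_Seek0) (use zs in \<open>auto dest: in_set_dropD\<close>)
    have leq: "map Sym (rev (drop p xs @ c # ys)) @ rev (take p (map Sym xs)) @ l = ?l"
    proof -
      have "take p xs @ drop p xs @ c # ys = xs @ c # ys" by (metis append_assoc append_take_drop_id)
      moreover have "map Sym (rev (drop p xs @ c # ys)) @ rev (take p (map Sym xs)) =
          map Sym (rev (take p xs @ drop p xs @ c # ys))" by (simp add: take_map rev_map del: append_take_drop_id)
      ultimately show ?thesis by (metis append_assoc)
    qed
    from sk[unfolded leq] have e2: "exec Seek0 (?s ?A ?C y) (3 * length (drop p xs @ c # ys) + 1) (Some (?s (zip_tape ?l (map Sym (c' # r))) ?C y))"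
      by (simp add: drop_map)
    have rr: "replicate (min ?u p) ?one @ replicate (p - ?u) ?one @ [Sym 0] = replicate p ?one @ [Sym 0]"
    proof -
      have "replicate (min ?u p) ?one @ replicate (p - ?u) ?one = replicate p ?one" by (simp flip: replicate_add)
      then show ?thesis by (metis append_assoc)
    qed
    have "exec (Rew 3) (?s (zip_tape (Sym c' # ?l) (map Sym r)) ?C y) (3 * length (replicate (min ?u p) ?one) + 4)
       (Some ((?s (zip_tape (Sym c' # ?l) (map Sym r)) ?C y)[3 := zip_tape [] (LeftEnd # rev (replicate (min ?u p) ?one) @ replicate (p - ?u) ?one @ [Sym 0])]))"
      by (rule exec_Rew_zip) auto
    then have e4: "exec (Rew 3) (?s (zip_tape (Sym c' # ?l) (map Sym r)) ?C y) (3 * min ?u p + 4)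
       (Some (?s (zip_tape (Sym c' # ?l) (map Sym r)) (zip_tape [] (LeftEnd # replicate p ?one @ [Sym 0])) y))"
      unfolding rev_replicate length_replicate rr by simp
    define A where "A = ?A"
    define C where "C = ?C"
    have nt': "(read C = Sym 0 \<and> is_label (read A) \<and> is_marked (read A)) = False"
      using nt unfolding A_def C_def by blast
    have "ex (follow b) (?s (zip_tape l (map Sym zs)) (vertex_tape p) y) (50 * m + 100)
      (Some (?s (zip_tape (Sym c' # ?l) (map Sym r)) (vertex_tape p) y))"
      unfolding ex_wp follow_def
      using u
      by (simp add: nt' exec_wp[OF e1[folded A_def C_def, unfolded vertex_tape_def], simplified] exec_wp[OF e2[folded A_def C_def], simplified]
          exec_wp[OF e4[folded A_def C_def], simplified] vertex_tape_def)
    then show ?thesis using False by (auto simp: vertex_tape_def)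
  qed
qed

lemma check_arcs_Cons:
  assumes "check_arcs n w zs = Some ems" "zs \<noteq> []"
  obtains xs c ys c' r ems' where "zs = xs @ c # ys @ c' # r" "\<forall>x\<in>set xs. x div 4 = 1" "\<forall>x\<in>set ys. x div 4 = 1"
    "c div 4 \<ge> 2" "c' div 4 = 0" "length xs < n" "length ys < n" "length xs \<noteq> length ys"
    "found (length xs) (length ys) 0 w" "check_arcs n w r = Some ems'"
    "ems = ((length xs, c div 4 - 2, length ys), c mod 4 \<ge> 2) # ems'"
proof -
  obtain u c r where ucr: "block (\<lambda>d. d \<ge> 2) n zs = Some (u, c, r)"
    using assms by (subst (asm) check_arcs.simps) (auto split: option.splits)
  obtain v c' r' where vcr: "block (\<lambda>d. d = 0) n r = Some (v, c', r')"
    using assms ucr by (subst (asm) check_arcs.simps) (auto split: option.splits)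
  have *: "u \<noteq> v" "found u v 0 w" "map_option ((#) ((u, c div 4 - 2, v), c mod 4 \<ge> 2)) (check_arcs n w r') = Some ems"
    using assms ucr vcr by (subst (asm) check_arcs.simps; simp split: if_splits)+
  from block_SomeD[OF ucr] block_SomeD[OF vcr] * show ?thesis
    by (auto intro!: that)
qed

lemma ex_pass:
  assumes "check_arcs n w zs = Some ems" "\<forall>z\<in>set zs. z div 4 - 2 < b" "length zs \<le> m" "n \<le> m" "p \<le> m"
  shows "ex (pass b) (zip_tape l (map Sym zs) # t1 # t2 # vertex_tape p # t4 # t5 # t6 # output_tape y # rest)
     (Suc (length zs) * (50 * m + 110))
    (case foldl walk_step (p, y) ems of (p', y') \<Rightarrow>
      Some (zip_tape (map Sym (rev zs) @ l) [] # t1 # t2 # vertex_tape p' # t4 # t5 # t6 # output_tape y' # rest))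
    \<and> fst (foldl walk_step (p, y) ems) \<le> m"
  using assms
proof (induction "length zs" arbitrary: zs l p y ems rule: less_induct)
  case less
  let ?s = "\<lambda>A p y. A # t1 # t2 # vertex_tape p # t4 # t5 # t6 # output_tape y # rest"
  show ?case
  proof (cases "zs = []")
    case True
    then have "ems = []" using less.prems by (simp add: check_arcs.simps)
    moreover have "ex (pass b) (?s (zip_tape l []) p y) (50 * m + 110) (Some (?s (zip_tape l []) p y))"
      unfolding ex_wp by (subst wp_pass) simp
    ultimately show ?thesis using True less.prems by simp
  next
    case False
    from less.prems(1) False obtain xs c ys c' r ems' where d: "zs = xs @ c # ys @ c' # r"
      "\<forall>x\<in>set xs. x div 4 = 1" "\<forall>x\<in>set ys. x div 4 = 1"
      "c div 4 \<ge> 2" "c' div 4 = 0" "length xs < n" "length ys < n" "check_arcs n w r = Some ems'"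
      "ems = ((length xs, c div 4 - 2, length ys), c mod 4 \<ge> 2) # ems'"
      by (rule check_arcs_Cons)
    obtain p1 y1 where w1: "walk_step (p, y) ((length xs, c div 4 - 2, length ys), c mod 4 \<ge> 2) = (p1, y1)"
      by fastforce
    have p1: "p1 \<le> m" using w1 less.prems d by (auto split: if_splits)
    obtain z zs' where "zs = z # zs'" using False by (cases zs) auto
    then have b: "map read (?s (zip_tape l (map Sym zs)) p y) ! 0 \<noteq> Blank" by simp
    let ?l = "map Sym (rev (xs @ c # ys @ [c'])) @ l"
    have l: "map Sym (rev r) @ ?l = map Sym (rev zs) @ l" by (simp add: d(1))
    have "c div 4 - 2 < b" using less.prems(2) d(1) by auto
    from ex_follow[OF d(1-5) this less.prems(3,5), of l t1 t2 t4 t5 t6 y rest]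
    have 1: "ex (follow b) (?s (zip_tape l (map Sym zs)) p y) (50 * m + 100) (Some (?s (zip_tape ?l (map Sym r)) p1 y1))"
      by (simp add: w1 del: walk_step.simps)
    have r: "length r < length zs" "\<forall>z\<in>set r. z div 4 - 2 < b" "length r \<le> m"
      using d(1) less.prems by auto
    obtain p2 y2 where w2: "foldl walk_step (p1, y1) ems' = (p2, y2)" by fastforce
    from less.hyps[OF r(1) d(8) r(2,3) less.prems(4) p1, of ?l y1]
    have 2: "ex (pass b) (?s (zip_tape ?l (map Sym r)) p1 y1) (Suc (length r) * (50 * m + 110))
        (Some (?s (zip_tape (map Sym (rev zs) @ l) []) p2 y2)) \<and> p2 \<le> m"
      unfolding l w2 by simp
    have f: "foldl walk_step (p, y) ems = (p2, y2)" using w1 w2 d(9) by (simp del: walk_step.simps)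
    have "ex (pass b) (?s (zip_tape l (map Sym zs)) p y) (Suc (length zs) * (50 * m + 110))
        (Some (?s (zip_tape (map Sym (rev zs) @ l) []) p2 y2))"
    proof (rule ex_pass_step[OF b ex_Seq[OF 1 conjunct1[OF 2] le_refl]])
      have "Suc (length r) * (50 * m + 110) \<le> length zs * (50 * m + 110)"
        using r(1) by (intro mult_le_mono1) simp
      then show "50 * m + 100 + 1 + Suc (length r) * (50 * m + 110) + 1 \<le> Suc (length zs) * (50 * m + 110)"
        unfolding mult_Suc[of "length zs"] by linarith
    qed
    then show ?thesis using f 2 by simp
  qed
qed

text \<open>The three separators passed are those behind the number of vertices, the source and the
  target.\<close>

definition restart :: com where
  "restart = Rew 0 ;; goR 0 ;; Seek0 ;; goR 0 ;; Seek0 ;; goR 0 ;; Seek0 ;; goR 0"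

lemma ex_restart:
  assumes z: "z = xs1 @ c1 # xs2 @ c2 # xs3 @ c3 # zs"
    and "\<forall>x\<in>set xs1 \<union> set xs2 \<union> set xs3. x div 4 = 1" "c1 div 4 = 0" "c2 div 4 = 0" "c3 div 4 = 0"
    and m: "length z \<le> m"
  shows "\<exists>l. map Sym (rev zs) @ l = map Sym (rev z) @ [LeftEnd] \<and>
    ex restart (zip_tape (map Sym (rev z) @ [LeftEnd]) [] # ts) (20 * m + 50) (Some (zip_tape l (map Sym zs) # ts))"
proof -
  have "exec (Rew 0) (zip_tape (map Sym (rev z) @ [LeftEnd]) [] # ts) (3 * length (map Sym (rev z)) + 4)
     (Some ((zip_tape (map Sym (rev z) @ [LeftEnd]) [] # ts)[0 := zip_tape [] (LeftEnd # rev (map Sym (rev z)) @ [])]))"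
    by (rule exec_Rew_zip) auto
  then have e0: "exec (Rew 0) (zip_tape (map Sym (rev z) @ [LeftEnd]) [] # ts) (3 * length z + 4)
     (Some (zip_tape [] (LeftEnd # map Sym z) # ts))"
    by (simp add: rev_map)
  let ?l1 = "Sym c1 # map Sym (rev xs1) @ [LeftEnd]"
  let ?l2 = "Sym c2 # map Sym (rev xs2) @ ?l1"
  let ?l3 = "Sym c3 # map Sym (rev xs3) @ ?l2"
  have e1: "exec Seek0 (zip_tape [LeftEnd] (map Sym (xs1 @ c1 # xs2 @ c2 # xs3 @ c3 # zs)) # ts) (3 * length xs1 + 1)
     (Some (zip_tape (map Sym (rev xs1) @ [LeftEnd]) (map Sym (c1 # xs2 @ c2 # xs3 @ c3 # zs)) # ts))"
    by (rule exec_Seek0) (use assms in auto)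
  have e2: "exec Seek0 (zip_tape ?l1 (map Sym (xs2 @ c2 # xs3 @ c3 # zs)) # ts) (3 * length xs2 + 1)
     (Some (zip_tape (map Sym (rev xs2) @ ?l1) (map Sym (c2 # xs3 @ c3 # zs)) # ts))"
    by (rule exec_Seek0) (use assms in auto)
  have e3: "exec Seek0 (zip_tape ?l2 (map Sym (xs3 @ c3 # zs)) # ts) (3 * length xs3 + 1)
     (Some (zip_tape (map Sym (rev xs3) @ ?l2) (map Sym (c3 # zs)) # ts))"
    by (rule exec_Seek0) (use assms in auto)
  have "ex restart (zip_tape (map Sym (rev z) @ [LeftEnd]) [] # ts) (20 * m + 50) (Some (zip_tape ?l3 (map Sym zs) # ts))"
    unfolding ex_wp restart_def using m
    by (simp add: exec_wp[OF e0] z exec_wp[OF e0[unfolded z], simplified] exec_wp[OF e1, simplified] exec_wp[OF e2, simplified] exec_wp[OF e3, simplified])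
  then show ?thesis by (intro exI[of _ ?l3]) (simp add: z)
qed

text \<open>The \<open>n\<close> ones on tape 2, until now used for comparisons, become the counter
  of the passes.\<close>

definition walk_loop :: "nat \<Rightarrow> com" where
  "walk_loop b = While (\<lambda>rs. rs ! 2 = Sym 1) (restart ;; pass b ;; goR 2)"

lemmas wp_walk_loop = wp_While[of "\<lambda>rs. rs ! 2 = Sym 1" "restart ;; pass b ;; goR 2" for b, folded walk_loop_def]
lemmas ex_walk_loop_step = ex_While[of "\<lambda>rs. rs ! 2 = Sym 1" _ "restart ;; pass b ;; goR 2" for b, folded walk_loop_def]

lemma ex_walk_loop:
  assumes z: "z = xs1 @ c1 # xs2 @ c2 # xs3 @ c3 # zs"
    and ones: "\<forall>x\<in>set xs1 \<union> set xs2 \<union> set xs3. x div 4 = 1" "c1 div 4 = 0" "c2 div 4 = 0" "c3 div 4 = 0"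
    and m: "length z \<le> m" "n \<le> m" and ems: "check_arcs n w zs = Some ems" "\<forall>z\<in>set zs. z div 4 - 2 < b"
    and "p \<le> m"
  shows "\<exists>t2'. ex (walk_loop b) (zip_tape (map Sym (rev z) @ [LeftEnd]) [] # t1 # zip_tape lN (replicate k (Sym 1)) #
        vertex_tape p # t4 # t5 # t6 # output_tape y # rest) (Suc k * (Suc m * (50 * m + 110) + 20 * m + 60))
      (case walk ems k (p, y) of (p', y') \<Rightarrow>
        Some (zip_tape (map Sym (rev z) @ [LeftEnd]) [] # t1 # t2' # vertex_tape p' # t4 # t5 # t6 # output_tape y' # rest))"
  using \<open>p \<le> m\<close>
proof (induction k arbitrary: lN p y)
  case 0
  have "ex (walk_loop b) (zip_tape (map Sym (rev z) @ [LeftEnd]) [] # t1 # zip_tape lN [] #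
        vertex_tape p # t4 # t5 # t6 # output_tape y # rest) (Suc 0 * (Suc m * (50 * m + 110) + 20 * m + 60))
      (Some (zip_tape (map Sym (rev z) @ [LeftEnd]) [] # t1 # zip_tape lN [] # vertex_tape p # t4 # t5 # t6 # output_tape y # rest))"
    unfolding ex_wp by (subst wp_walk_loop) simp
  then show ?case by (intro exI[of _ "zip_tape lN []"]) (simp add: walk_def)
next
  case (Suc k)
  let ?s = "\<lambda>A B p y. A # t1 # B # vertex_tape p # t4 # t5 # t6 # output_tape y # rest"
  let ?Z = "zip_tape (map Sym (rev z) @ [LeftEnd]) []"
  let ?N = "zip_tape lN (replicate (Suc k) (Sym 1))"
  obtain p1 y1 where w1: "foldl walk_step (p, y) ems = (p1, y1)" by fastforce
  obtain l where l: "map Sym (rev zs) @ l = map Sym (rev z) @ [LeftEnd]" and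
    1: "ex restart (?s ?Z ?N p y) (20 * m + 50) (Some (?s (zip_tape l (map Sym zs)) ?N p y))"
    using ex_restart[OF z ones m(1)] by blast
  have zs: "length zs \<le> m" using m(1) by (simp add: z)
  from ex_pass[OF ems zs m(2) Suc.prems, of l t1 ?N t4 t5 t6 y rest]
  have "ex (pass b) (?s (zip_tape l (map Sym zs)) ?N p y) (Suc (length zs) * (50 * m + 110)) (Some (?s ?Z ?N p1 y1)) \<and> p1 \<le> m"
    unfolding w1 l by simp
  then have 2: "ex (pass b) (?s (zip_tape l (map Sym zs)) ?N p y) (Suc m * (50 * m + 110)) (Some (?s ?Z ?N p1 y1))"
    and p1: "p1 \<le> m" using zs by (auto elim!: ex_mono intro!: mult_le_mono1)
  have 3: "ex (goR 2) (?s ?Z ?N p1 y1) 1 (Some (?s ?Z (zip_tape (Sym 1 # lN) (replicate k (Sym 1))) p1 y1))"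
    unfolding ex_wp by simp
  obtain t2' where 4: "ex (walk_loop b) (?s ?Z (zip_tape (Sym 1 # lN) (replicate k (Sym 1))) p1 y1)
      (Suc k * (Suc m * (50 * m + 110) + 20 * m + 60))
      (case walk ems k (p1, y1) of (p', y') \<Rightarrow> Some (?s ?Z t2' p' y'))"
    using Suc.IH[OF p1, of "Sym 1 # lN" y1] by blast
  have w: "walk ems (Suc k) (p, y) = walk ems k (p1, y1)"
    unfolding walk_def funpow_Suc_right by (simp add: w1)
  have "ex (walk_loop b) (?s ?Z ?N p y) (Suc (Suc k) * (Suc m * (50 * m + 110) + 20 * m + 60))
      (case walk ems (Suc k) (p, y) of (p', y') \<Rightarrow> Some (?s ?Z t2' p' y'))"
    unfolding w
    by (rule ex_walk_loop_step[OF _ ex_Seq[OF ex_Seq[OF 1 ex_Seq[OF 2 3 le_refl] le_refl] 4 le_refl]]) simp_all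
  then show ?case by blast
qed

subsection \<open>The verifier\<close>

text \<open>As many passes as vertices suffice, because a path without repetition has fewer arcs.
  The order bits are taken from the whole word, header included, so every letter offers one.\<close>

definition verify :: "nat list \<Rightarrow> nat list option" where
  "verify z = (case after z of [] \<Rightarrow> None | c0 # r0 \<Rightarrow> if c0 div 4 \<noteq> 0 then None else
     (case block (\<lambda>d. d = 0) (ones z) r0 of None \<Rightarrow> None | Some (s, _, r1) \<Rightarrow>
     (case block (\<lambda>d. d = 0) (ones z) r1 of None \<Rightarrow> None | Some (t, _, r2) \<Rightarrow>
     (case check_arcs (ones z) (map (\<lambda>v. v mod 2) z) r2 of None \<Rightarrow> None | Some ems \<Rightarrow>
       (case walk ems (ones z) (s, []) of (c, y) \<Rightarrow> if c = t then Some y else None)))))"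

definition Verify :: "nat \<Rightarrow> com" where
  "Verify b = Transfer 0 1 (lift_sym 2 (\<lambda>v. v mod 2)) ;; goR 1 ;; goR 0 ;; goR 2 ;; Fill 2 ;;
     Cond (\<lambda>rs. is0 (rs ! 0)) (goR 0) Fail ;; Rew 2 ;; goR 2 ;; Block is0 3 ;; Block is0 4 ;; check_loop ;;
     goR 7 ;; walk_loop b ;; Match (\<lambda>s. s = Sym 1) 3 4 ;;
     Cond (\<lambda>rs. rs ! 3 = Sym 0 \<and> rs ! 4 = Sym 0) Skip Fail ;; Rew 7"

lemma length_check_arcs: "check_arcs n w zs = Some ems \<Longrightarrow> length ems \<le> length zs"
proof (induction "length zs" arbitrary: zs ems rule: less_induct)
  case less
  show ?case
  proof (cases "zs = []")
    case True
    then show ?thesis using less.prems by (simp add: check_arcs.simps)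
  next
    case False
    from less.prems False obtain xs c ys c' r ems' where d: "zs = xs @ c # ys @ c' # r"
      "check_arcs n w r = Some ems'" "ems = ((length xs, c div 4 - 2, length ys), c mod 4 \<ge> 2) # ems'"
      by (rule check_arcs_Cons)
    from less.hyps[OF _ d(2)] show ?thesis by (simp add: d(1,3))
  qed
qed

lemma labels_check_arcs:
  "check_arcs n w zs = Some ems \<Longrightarrow> ((u, a, v), mk) \<in> set ems \<Longrightarrow> \<exists>c\<in>set zs. c div 4 \<ge> 2 \<and> a = c div 4 - 2"
proof (induction "length zs" arbitrary: zs ems rule: less_induct)
  case less
  have "zs \<noteq> []" using less.prems by (auto simp: check_arcs.simps)
  from less.prems(1) this obtain xs c ys c' r ems' where d: "zs = xs @ c # ys @ c' # r" "c div 4 \<ge> 2"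
      "check_arcs n w r = Some ems'" "ems = ((length xs, c div 4 - 2, length ys), c mod 4 \<ge> 2) # ems'"
    by (rule check_arcs_Cons)
  show ?case
  proof (cases "((u, a, v), mk) \<in> set ems'")
    case True
    from less.hyps[OF _ d(3) True] show ?thesis by (auto simp: d(1))
  next
    case False
    then show ?thesis using less.prems(2) d by auto
  qed
qed

lemma foldl_walk_step:
  "length (snd (foldl walk_step cy ems)) \<le> length (snd cy) + length ems \<and>
   set (snd (foldl walk_step cy ems)) \<subseteq> set (snd cy) \<union> (\<lambda>((u, a, v), mk). a) ` set ems"
proof (induction ems arbitrary: cy)
  case (Cons e ems)
  obtain u a v mk where e: "e = ((u, a, v), mk)" by (metis surj_pair)
  obtain c y where cy: "cy = (c, y)" by (cases cy)
  from Cons.IH[of "walk_step cy e"] show ?case by (auto simp: e cy split: if_splits)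
qed simp

lemma walk_output:
  "length (snd (walk ems k (c, y))) \<le> length y + k * length ems \<and>
   set (snd (walk ems k (c, y))) \<subseteq> set y \<union> (\<lambda>((u, a, v), mk). a) ` set ems"
proof (induction k)
  case (Suc k)
  then show ?case using foldl_walk_step[of "walk ems k (c, y)" ems] by (auto simp: walk_def)
qed (simp add: walk_def)

text \<open>A pass emits at most one letter per arc, and both passes and arcs number at most
  \<open>length z\<close>. Emitted letters are labels read from the text.\<close>

lemma verify_SomeD:
  assumes "verify z = Some y"
  shows "length y \<le> length z * length z \<and> set y \<subseteq> {c div 4 - 2 | c. c \<in> set z \<and> c div 4 \<ge> 2}"
proof -
  obtain xs where xs: "z = xs @ after z" "length xs = ones z" using ones_after by blast
  from assms obtain c0 r0 where 0: "after z = c0 # r0" "c0 div 4 = 0"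
    by (auto simp: verify_def split: list.splits if_splits)
  from assms 0 obtain s c1 r1 where 1: "block (\<lambda>d. d = 0) (ones z) r0 = Some (s, c1, r1)"
    by (auto simp: verify_def split: option.splits)
  from assms 0 1 obtain t c2 r2 where 2: "block (\<lambda>d. d = 0) (ones z) r1 = Some (t, c2, r2)"
    by (auto simp: verify_def split: option.splits)
  from assms 0 1 2 obtain ems c where 3: "check_arcs (ones z) (map (\<lambda>v. v mod 2) z) r2 = Some ems"
    "walk ems (ones z) (s, []) = (c, y)"
    by (auto simp: verify_def split: option.splits prod.splits if_splits)
  obtain xs1 xs2 where "r0 = xs1 @ c1 # r1" "r1 = xs2 @ c2 # r2"
    using block_SomeD[OF 1] block_SomeD[OF 2] by blast
  then have sub: "set r2 \<subseteq> set z" "length r2 \<le> length z" "ones z \<le> length z"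
    using xs 0 by (metis (no_types, lifting) Un_iff list.set_intros(2) set_append subsetI,
      metis le_add2 le_trans length_Cons length_append lessI less_imp_le, metis le_add1 length_append)
  have "length y \<le> ones z * length ems"
    using walk_output[of ems "ones z" s "[]"] 3(2) by simp
  also have "\<dots> \<le> length z * length z"
    using length_check_arcs[OF 3(1)] sub by (intro mult_le_mono) auto
  finally have "length y \<le> length z * length z" .
  moreover have "set y \<subseteq> {c div 4 - 2 | c. c \<in> set z \<and> c div 4 \<ge> 2}"
  proof
    fix a assume "a \<in> set y"
    then obtain u v mk where "((u, a, v), mk) \<in> set ems"
      using walk_output[of ems "ones z" s "[]"] 3(2) by auto
    from labels_check_arcs[OF 3(1) this] show "a \<in> {c div 4 - 2 | c. c \<in> set z \<and> c div 4 \<ge> 2}"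
      using sub(1) by auto
  qed
  ultimately show ?thesis ..
qed

text \<open>Cubic time: linearly many arcs are checked at quadratic cost each, and linearly many
  passes of quadratic cost follow.\<close>

lemma ex_Verify:
  assumes b: "\<forall>c\<in>set z. c div 4 - 2 < b"
  shows "\<exists>front. length front = 7 \<and> ex (Verify b) (init_tape z # init_tape [] # init_tape [] # init_tape [] # init_tape [] #
      init_tape [] # init_tape [] # init_tape [] # rest) (1000 * Suc (length z) ^ 3)
    (map_option (\<lambda>y. front @ init_tape y # rest) (verify z))"
proof -
  define m where "m = length z"
  define w where "w = map (\<lambda>v. v mod 2) z"
  let ?E = "init_tape []"
  let ?n = "ones z" and ?one = "Sym 1"
  let ?N = "zip_tape [LeftEnd] (replicate ?n ?one)"
  let ?W = "order_tape [] w"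
  have w: "set w \<subseteq> {0, 1}" "length w = m" by (auto simp: w_def m_def)
  define B where "B = 1000 * Suc m ^ 3"
  have B3: "B = 1000 * (m * m * m) + 3000 * (m * m) + 3000 * m + 1000"
    by (simp add: B_def power3_eq_cube algebra_simps)
  have BB: "1000 * Suc (length z) ^ 3 = B" by (simp add: B_def m_def)
  obtain xs where xs: "z = xs @ after z" "length xs = ?n" "\<forall>x\<in>set xs. x div 4 = 1"
    "after z = [] \<or> hd (after z) div 4 \<noteq> 1" using ones_after by blast
  have nm: "?n \<le> m" using xs(1,2) by (metis le_add1 length_append m_def)
  let ?s0 = "init_tape z # ?E # ?E # ?E # ?E # ?E # ?E # ?E # rest"
  let ?s1 = "\<lambda>A. A # ?W # zip_tape [LeftEnd] [] # ?E # ?E # ?E # ?E # ?E # rest"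
  have "exec (Transfer 0 1 (lift_sym 2 (\<lambda>v. v mod 2))) ?s0 (11 * length z + 15)
     (Some (?s0[1 := init_tape (map (\<lambda>v. v mod 2) z)]))"
    by (rule exec_Transfer) (auto intro: lift_sym_Sym)
  then have e1: "exec (Transfer 0 1 (lift_sym 2 (\<lambda>v. v mod 2))) ?s0 (11 * m + 15)
     (Some (init_tape z # init_tape w # ?E # ?E # ?E # ?E # ?E # ?E # rest))"
    by (simp add: w_def m_def)
  let ?l0 = "map Sym (rev xs) @ [LeftEnd]"
  let ?s2 = "zip_tape ?l0 (map Sym (after z)) # ?W # zip_tape (replicate ?n ?one @ [LeftEnd]) [] # ?E # ?E # ?E # ?E # ?E # rest"
  have "exec (Fill 2) (?s1 (zip_tape [LeftEnd] (map Sym (xs @ after z)))) (5 * length xs + 1)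
     (Some ((?s1 (zip_tape [LeftEnd] (map Sym (xs @ after z))))[0 := zip_tape ?l0 (map Sym (after z)),
        2 := zip_tape (replicate (length xs) ?one @ [LeftEnd]) []]))"
    by (rule exec_Fill) (use xs in auto)
  then have e2: "exec (Fill 2) (?s1 (zip_tape [LeftEnd] (map Sym z))) (5 * ?n + 1) (Some ?s2)"
    unfolding xs(1)[symmetric] xs(2) by simp
  \<comment> \<open>The program and its time budget are split at the branching points, so that each
    way of rejecting is settled separately.\<close>
  define rest1 where "rest1 = Cond (\<lambda>rs. is0 (rs ! 0)) (goR 0) Fail ;; Rew 2 ;; goR 2 ;; Block is0 3 ;; Block is0 4 ;;
     check_loop ;; goR 7 ;; walk_loop b ;; Match (\<lambda>s. s = Sym 1) 3 4 ;;
     Cond (\<lambda>rs. rs ! 3 = Sym 0 \<and> rs ! 4 = Sym 0) Skip Fail ;; Rew 7"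
  have V: "ex (Verify b) ?s0 B r" if e: "ex rest1 ?s2 (B - 20 * m - 30) r" for r
  proof -
    obtain t where t: "t \<le> B - 20 * m - 30" "exec rest1 ?s2 t r" using e unfolding ex_def by blast
    have "exec (Verify b) ?s0 (11 * m + 5 * ?n + 24 + t) r"
      unfolding wp_exec[symmetric] Verify_def rest1_def[symmetric]
      by (simp add: exec_wp[OF e1] init_tape_eq exec_wp[OF e1[unfolded init_tape_eq], simplified]
          exec_wp[OF e2[unfolded init_tape_eq order_tape_def], simplified] exec_wp[OF t(2)[unfolded init_tape_eq order_tape_def], simplified])
    then show ?thesis by (rule exec_ex) (use t(1) nm B3 in linarith)
  qed
  show ?thesis
  proof (cases "after z \<noteq> [] \<and> hd (after z) div 4 = 0")
    case False
    then have vN: "verify z = None" by (auto simp: verify_def split: list.splits)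
    have "\<not> is0 (read (zip_tape ?l0 (map Sym (after z))))" using False by (cases "after z") auto
    then have "ex rest1 ?s2 1 None" unfolding ex_wp rest1_def by simp
    then have "ex rest1 ?s2 (B - 20 * m - 30) None" by (rule ex_mono) (use B3 in linarith)
    from V[OF this] show ?thesis unfolding vN BB by (intro exI[of _ "replicate 7 ?E"]) simp
  next
    case True
    then obtain c0 r0 where r0: "after z = c0 # r0" "c0 div 4 = 0" by (cases "after z") auto
    let ?l1 = "Sym c0 # ?l0"
    let ?s3 = "\<lambda>A C T. A # ?W # ?N # C # T # ?E # ?E # ?E # rest"
    define rest2 where "rest2 = Block is0 3 ;; Block is0 4 ;;
       check_loop ;; goR 7 ;; walk_loop b ;; Match (\<lambda>s. s = Sym 1) 3 4 ;;
       Cond (\<lambda>rs. rs ! 3 = Sym 0 \<and> rs ! 4 = Sym 0) Skip Fail ;; Rew 7"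
    have lr0: "length z = ?n + 1 + length r0" using xs(1,2) r0 by (metis length_append length_Cons add.assoc plus_1_eq_Suc)
    have V2: "ex (Verify b) ?s0 B r" if e: "ex rest2 (?s3 (zip_tape ?l1 (map Sym r0)) ?E ?E) (B - 30 * m - 60) r" for r
    proof -
      obtain t where t: "t \<le> B - 30 * m - 60" "exec rest2 (?s3 (zip_tape ?l1 (map Sym r0)) ?E ?E) t r"
        using e unfolding ex_def by blast
      have "exec (Rew 2) (?s2[0 := zip_tape ?l1 (map Sym r0)]) (3 * length (replicate ?n ?one) + 4)
        (Some ((?s2[0 := zip_tape ?l1 (map Sym r0)])[2 := zip_tape [] (LeftEnd # rev (replicate ?n ?one) @ [])]))"
        by (rule exec_Rew_zip) auto
      then have e3: "exec (Rew 2) (zip_tape ?l1 (map Sym r0) # tl ?s2) (3 * ?n + 4)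
        (Some ((?s3 (zip_tape ?l1 (map Sym r0)) ?E ?E)[2 := zip_tape [] (LeftEnd # replicate ?n ?one)]))"
        by simp
      have "ex rest1 ?s2 (3 * m + 11 + t) r"
        unfolding ex_wp rest1_def rest2_def[symmetric]
        using r0 nm by (simp add: exec_wp[OF e3[simplified]] exec_wp[OF t(2), simplified])
      then show ?thesis by (intro V, elim ex_mono) (use t(1) B3 in linarith)
    qed
    define K where "K = 6 * m * m + 200 * m + 410"
    define K2 where "K2 = Suc m * (50 * m + 110) + 20 * m + 60"
    have tot: "100 * m + 300 + Suc m * K + Suc m * K2 + 3 * (m * m) \<le> B - 30 * m - 60"
      unfolding K_def K2_def B3 by (simp add: algebra_simps)
    have None: ?thesis if e: "ex rest2 (?s3 (zip_tape ?l1 (map Sym r0)) ?E ?E) T None" and "verify z = None"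
      and T: "T \<le> 100 * m + 300 + Suc m * K + Suc m * K2 + 3 * (m * m)" for T
    proof -
      have "ex rest2 (?s3 (zip_tape ?l1 (map Sym r0)) ?E ?E) (B - 30 * m - 60) None"
        by (rule ex_mono[OF e]) (use T tot in linarith)
      from V2[OF this] show ?thesis unfolding that(2) BB by (intro exI[of _ "replicate 7 ?E"]) simp
    qed
    have b3: "ex (Block is0 3) (?s3 (zip_tape ?l1 (map Sym r0)) ?E ?E) (19 * m + 60) (case block (\<lambda>d. d = 0) ?n r0 of None \<Rightarrow> None
       | Some (s, c, r) \<Rightarrow> Some (?s3 (zip_tape (map Sym (rev (take (Suc s) r0)) @ ?l1) (map Sym r)) (vertex_tape s) ?E))"
      using ex_Block[of 3 "?s3 (zip_tape ?l1 (map Sym r0)) ?E ?E" ?l1 r0 ?n is0 "\<lambda>d. d = 0"] lr0 m_def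
      by (auto split: option.splits elim!: ex_mono)
    show ?thesis
    proof (cases "block (\<lambda>d. d = 0) ?n r0")
      case b: None
      have "verify z = None" by (simp add: verify_def r0 b)
      moreover have "ex rest2 (?s3 (zip_tape ?l1 (map Sym r0)) ?E ?E) (19 * m + 60) None"
        unfolding rest2_def using b3 b by (intro ex_Seq_None[OF _ le_refl]) simp
      ultimately show ?thesis by (intro None[of "19 * m + 60"]) auto
    next
      case (Some scr)
      then obtain s c1 r1 where bs: "block (\<lambda>d. d = 0) ?n r0 = Some (s, c1, r1)" by (cases scr) auto
      obtain xs1 where xs1: "r0 = xs1 @ c1 # r1" "length xs1 = s" "\<forall>x\<in>set xs1. x div 4 = 1" "s < ?n" "c1 div 4 = 0"
        using block_SomeD[OF bs] by auto
      let ?l2 = "map Sym (rev (take (Suc s) r0)) @ ?l1"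
      have b3': "ex (Block is0 3) (?s3 (zip_tape ?l1 (map Sym r0)) ?E ?E) (19 * m + 60) (Some (?s3 (zip_tape ?l2 (map Sym r1)) (vertex_tape s) ?E))"
        using b3 bs by simp
      have b4: "ex (Block is0 4) (?s3 (zip_tape ?l2 (map Sym r1)) (vertex_tape s) ?E) (19 * m + 60) (case block (\<lambda>d. d = 0) ?n r1 of None \<Rightarrow> None
         | Some (t, c, r) \<Rightarrow> Some (?s3 (zip_tape (map Sym (rev (take (Suc t) r1)) @ ?l2) (map Sym r)) (vertex_tape s) (vertex_tape t)))"
        using ex_Block[of 4 "?s3 (zip_tape ?l2 (map Sym r1)) (vertex_tape s) ?E" ?l2 r1 ?n is0 "\<lambda>d. d = 0"] lr0 m_def xs1(1)
        by (auto split: option.splits elim!: ex_mono)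
      show ?thesis
      proof (cases "block (\<lambda>d. d = 0) ?n r1")
        case b: None
        have "verify z = None" by (simp add: verify_def r0 bs b)
        moreover have "ex rest2 (?s3 (zip_tape ?l1 (map Sym r0)) ?E ?E) (19 * m + 60 + 1 + (19 * m + 60)) None"
          unfolding rest2_def using b4 b by (intro ex_Seq[OF b3' ex_Seq_None[OF _ le_refl] le_refl]) simp
        ultimately show ?thesis by (intro None[of "19 * m + 60 + 1 + (19 * m + 60)"]) auto
      next
        case (Some tcr)
        then obtain t c2 r2 where bt: "block (\<lambda>d. d = 0) ?n r1 = Some (t, c2, r2)" by (cases tcr) auto
        obtain xs2 where xs2: "r1 = xs2 @ c2 # r2" "length xs2 = t" "\<forall>x\<in>set xs2. x div 4 = 1" "t < ?n" "c2 div 4 = 0"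
          using block_SomeD[OF bt] by auto
        let ?l3 = "map Sym (rev (take (Suc t) r1)) @ ?l2"
        have b4': "ex (Block is0 4) (?s3 (zip_tape ?l2 (map Sym r1)) (vertex_tape s) ?E) (19 * m + 60)
            (Some (?s3 (zip_tape ?l3 (map Sym r2)) (vertex_tape s) (vertex_tape t)))"
          using b4 bt by simp
        have z: "z = xs @ c0 # xs1 @ c1 # xs2 @ c2 # r2" using xs(1) r0(1) xs1(1) xs2(1) by simp
        have l3: "map Sym (rev r2) @ ?l3 = map Sym (rev z) @ [LeftEnd]"
          by (subst z) (simp add: xs1(1,2)[symmetric] xs2(1,2)[symmetric], simp add: xs1(1,2) xs2(1,2))
        have lr2: "length r2 \<le> m" by (simp add: m_def, subst z, simp)
        let ?Z = "zip_tape (map Sym (rev z) @ [LeftEnd]) []"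
        have "ex check_loop (?s3 (zip_tape ?l3 (map Sym r2)) (vertex_tape s) (vertex_tape t)) (Suc (length r2) * K)
          (map_option (\<lambda>_. ?s3 ?Z (vertex_tape s) (vertex_tape t)) (check_arcs ?n w r2))"
          using ex_check_loop[OF w(1) _ nm lr2, of ?l3 "vertex_tape s" "vertex_tape t" "?E # rest"] w(2)
          unfolding l3 K_def by simp
        then have b5: "ex check_loop (?s3 (zip_tape ?l3 (map Sym r2)) (vertex_tape s) (vertex_tape t)) (Suc m * K)
          (map_option (\<lambda>_. ?s3 ?Z (vertex_tape s) (vertex_tape t)) (check_arcs ?n w r2))"
          by (rule ex_mono) (use lr2 in \<open>intro mult_le_mono1, simp\<close>)
        show ?thesis
        proof (cases "check_arcs ?n w r2")
          case b: None
          have "verify z = None" by (simp add: verify_def r0 bs bt b flip: w_def)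
          moreover have "ex rest2 (?s3 (zip_tape ?l1 (map Sym r0)) ?E ?E) (19 * m + 60 + 1 + (19 * m + 60 + 1 + Suc m * K)) None"
            unfolding rest2_def using b5 b by (intro ex_Seq[OF b3' ex_Seq[OF b4' ex_Seq_None[OF _ le_refl] le_refl] le_refl]) simp
          ultimately show ?thesis by (intro None[of "19 * m + 60 + 1 + (19 * m + 60 + 1 + Suc m * K)"]) auto
        next
          case (Some ems)
          have b5': "ex check_loop (?s3 (zip_tape ?l3 (map Sym r2)) (vertex_tape s) (vertex_tape t)) (Suc m * K)
            (Some (?s3 ?Z (vertex_tape s) (vertex_tape t)))" using b5 Some by simp
          let ?s4 = "\<lambda>N C y. ?Z # ?W # N # C # vertex_tape t # ?E # ?E # output_tape y # rest"
          have b6: "ex (goR 7) (?s3 ?Z (vertex_tape s) (vertex_tape t)) 1 (Some (?s4 ?N (vertex_tape s) []))"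
            unfolding ex_wp by (simp add: init_tape_eq output_tape_def)
          obtain c y where cy: "walk ems ?n (s, []) = (c, y)" by fastforce
          have "\<forall>c\<in>set r2. c div 4 - 2 < b" using b by (subst (asm) z) auto
          moreover have "\<forall>x\<in>set xs \<union> set xs1 \<union> set xs2. x div 4 = 1" using xs(3) xs1(3) xs2(3) by auto
          moreover have "s \<le> m" using xs1(4) nm by simp
          ultimately obtain N' where "ex (walk_loop b) (?s4 ?N (vertex_tape s) []) (Suc ?n * K2) (Some (?s4 N' (vertex_tape c) y))"
            using ex_walk_loop[OF z _ r0(2) xs1(5) xs2(5) _ nm Some, of b s ?W "[LeftEnd]" ?n "vertex_tape t" ?E ?E "[]" rest] cy
            unfolding K2_def m_def by auto
          then have b7: "ex (walk_loop b) (?s4 ?N (vertex_tape s) []) (Suc m * K2) (Some (?s4 N' (vertex_tape c) y))"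
            by (rule ex_mono) (use nm in \<open>intro mult_le_mono1, simp\<close>)
          let ?C = "zip_tape (rev (take t (replicate c ?one)) @ [LeftEnd]) (drop t (replicate c ?one) @ [Sym 0])"
          let ?T = "zip_tape (replicate (min c t) ?one @ [LeftEnd]) (replicate (t - c) ?one @ [Sym 0])"
          let ?s5 = "\<lambda>Y. ?Z # ?W # N' # ?C # ?T # ?E # ?E # Y # rest"
          have "exec (Match (\<lambda>s. s = Sym 1) 3 4) (?s4 N' (vertex_tape c) y) (5 * min (length (replicate c ?one)) t + 1)
            (Some ((?s4 N' (vertex_tape c) y)[3 := ?C,
              4 := zip_tape (replicate (min (length (replicate c ?one)) t) ?one @ [LeftEnd]) (replicate (t - length (replicate c ?one)) ?one @ [Sym 0])]))"
            by (rule exec_Match) (auto simp: vertex_tape_def)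
          then have b8: "ex (Match (\<lambda>s. s = Sym 1) 3 4) (?s4 N' (vertex_tape c) y) (5 * m + 1) (Some (?s5 (output_tape y)))"
            by (rule_tac exec_ex) (simp, use xs2(4) nm in simp)
          have "read ?C = Sym 0 \<longleftrightarrow> c \<le> t" by (cases "c - t") auto
          moreover have "read ?T = Sym 0 \<longleftrightarrow> t \<le> c" by (cases "t - c") auto
          ultimately have b9: "ex (Cond (\<lambda>rs. rs ! 3 = Sym 0 \<and> rs ! 4 = Sym 0) Skip Fail) (?s5 (output_tape y)) 1
             (if c = t then Some (?s5 (output_tape y)) else None)"
            unfolding ex_wp by (simp del: take_replicate drop_replicate)
          have v: "verify z = (if c = t then Some y else None)"
            by (simp add: verify_def r0 bs bt Some cy flip: w_def)
          show ?thesis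
          proof (cases "c = t")
            case False
            let ?T = "19 * m + 60 + 1 + (19 * m + 60 + 1 + (Suc m * K + 1 + (1 + 1 + (Suc m * K2 + 1 + (5 * m + 1 + 1 + 1)))))"
            have "ex rest2 (?s3 (zip_tape ?l1 (map Sym r0)) ?E ?E) ?T None"
              unfolding rest2_def using b9 False
              by (intro ex_Seq[OF b3' ex_Seq[OF b4' ex_Seq[OF b5' ex_Seq[OF b6 ex_Seq[OF b7 ex_Seq[OF b8
                ex_Seq_None[OF _ le_refl] le_refl] le_refl] le_refl] le_refl] le_refl] le_refl]) simp
            then show ?thesis using v False by (intro None[of ?T]) auto
          next
            case True
            have ly: "length y \<le> m * m" using verify_SomeD[of z y] v True by (simp add: m_def)
            have "exec (Rew 7) (?s5 (output_tape y)) (3 * length (map Sym (rev y)) + 4)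
              (Some ((?s5 (output_tape y))[7 := zip_tape [] (LeftEnd # rev (map Sym (rev y)) @ [])]))"
              by (rule exec_Rew_zip) (auto simp: output_tape_def)
            moreover have "(?s5 (output_tape y))[7 := zip_tape [] (LeftEnd # rev (map Sym (rev y)) @ [])] = ?s5 (init_tape y)"
              by (simp add: init_tape_eq rev_map)
            ultimately have b10: "ex (Rew 7) (?s5 (output_tape y)) (3 * (m * m) + 4) (Some (?s5 (init_tape y)))"
              using ly by (intro exec_ex[of _ _ "3 * length (map Sym (rev y)) + 4"]) auto
            have b9': "ex (Cond (\<lambda>rs. rs ! 3 = Sym 0 \<and> rs ! 4 = Sym 0) Skip Fail) (?s5 (output_tape y)) 1 (Some (?s5 (output_tape y)))"
              using b9 True by simp
            have "ex rest2 (?s3 (zip_tape ?l1 (map Sym r0)) ?E ?E) (B - 30 * m - 60) (Some (?s5 (init_tape y)))"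
              unfolding rest2_def
              by (rule ex_Seq[OF b3' ex_Seq[OF b4' ex_Seq[OF b5' ex_Seq[OF b6 ex_Seq[OF b7 ex_Seq[OF b8
                ex_Seq[OF b9' b10 le_refl] le_refl] le_refl] le_refl] le_refl] le_refl]]) (use tot in linarith)
            from V2[OF this] show ?thesis
              unfolding BB using v True by (intro exI[of _ "[?Z, ?W, N', ?C, ?T, ?E, ?E]"]) simp
          qed
        qed
      qed
    qed
  qed
qed

lemma computes_verify:
  assumes fin: "finite \<Sigma>"
  shows "\<exists>b. computes (Verify b) 7 (annotated ({0, 1} \<union> (\<lambda>a. a + 2) ` \<Sigma>)) \<Sigma> verify"
proof -
  let ?A = "annotated ({0, 1} \<union> (\<lambda>a. a + 2) ` \<Sigma>)"
  obtain b0 where b0: "Sym ` \<Sigma> \<subseteq> alph b0" using finite_symbols_alph[of "Sym ` \<Sigma>"] fin by blast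
  define b where "b = b0 + 1"
  have b: "c div 4 - 2 < b" if "c \<in> ?A" for c
  proof -
    have "c div 4 - 2 \<in> insert 0 \<Sigma>" using that by (auto simp: annotated_def)
    moreover have "a < b0" if "a \<in> \<Sigma>" for a
    proof -
      have "Sym a \<in> alph b0" using b0 that by blast
      then show ?thesis by simp
    qed
    ultimately show ?thesis by (auto simp: b_def less_Suc_eq)
  qed
  have "wf_com (alph b') k (Verify b)" if "b + 2 \<le> b'" "k > 7" for b' k
    using that by (auto simp: Verify_def Fill_def Block_def Match_def check_loop_def check_arc_def search_loop_def
        search_step_def walk_loop_def restart_def Seek0_def pass_def follow_def lift_sym_alph subset_iff)
  then have wf: "\<exists>b0. \<forall>b'\<ge>b0. \<forall>k>7. wf_com (alph b') k (Verify b)" by blast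
  have det: "det_com (Verify b)"
    by (simp add: Verify_def Fill_def Block_def Match_def check_loop_def check_arc_def search_loop_def
        search_step_def walk_loop_def restart_def Seek0_def pass_def follow_def)
  define q :: "nat poly" where "q = smult 1000 ([:1, 1:] ^ 3)"
  have q: "poly q m = 1000 * Suc m ^ 3" for m by (simp add: q_def poly_power)
  have "\<exists>t\<le>poly q (length z). case verify z of
         None \<Rightarrow> exec (Verify b) (init_tapes z k) t None
       | Some y \<Rightarrow> y \<in> lists \<Sigma> \<and> length y \<le> poly q (length z) \<and>
           (\<exists>front. length front = 7 \<and> exec (Verify b) (init_tapes z k) t (Some (front @ init_tapes y (k - 7))))"
    if k: "k > 7" and z: "z \<in> lists ?A" for k z
  proof -
    define rest where "rest = replicate (k - 8) (init_tape [])"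
    have it: "init_tapes z k = init_tape z # init_tape [] # init_tape [] # init_tape [] # init_tape [] #
      init_tape [] # init_tape [] # init_tape [] # rest"
    proof -
      have "k - 1 = 7 + (k - 8)" using k by simp
      then show ?thesis by (simp add: init_tapes_def rest_def eval_nat_numeral)
    qed
    have it2: "init_tapes y (k - 7) = init_tape y # rest" for y
      by (simp add: init_tapes_def rest_def)
    have "\<forall>c\<in>set z. c div 4 - 2 < b" using z b by auto
    from ex_Verify[OF this, of rest] obtain front t where *: "length front = 7" "t \<le> poly q (length z)"
      "exec (Verify b) (init_tapes z k) t (map_option (\<lambda>y. front @ init_tape y # rest) (verify z))"
      unfolding it q ex_def by blast
    show ?thesis
    proof (cases "verify z")
      case None
      then show ?thesis using * by auto
    next
      case (Some y)
      have "length z * length z \<le> poly q (length z)"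
        unfolding q by (simp add: power3_eq_cube algebra_simps)
      moreover note verify_SomeD[OF Some]
      moreover have "set y \<subseteq> \<Sigma>"
      proof
        fix a assume "a \<in> set y"
        then obtain c where c: "c \<in> set z" "c div 4 \<ge> 2" "a = c div 4 - 2" using verify_SomeD[OF Some] by blast
        then have "c \<in> ?A" using z by auto
        then show "a \<in> \<Sigma>" using c by (auto simp: annotated_def)
      qed
      ultimately show ?thesis using * Some unfolding it2
        by (intro exI[of _ t]) auto
    qed
  qed
  then have "computes (Verify b) 7 ?A \<Sigma> verify"
    unfolding computes_def by (intro conjI det wf exI[of _ q] allI impI ballI zero_less_numeral)
  then show ?thesis by blast
qed

section \<open>Correctness of the certificates\<close>

text \<open>A final run of ones without separator yields no entry, so ones can pad the bits to the
  required length.\<close>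

fun entries :: "nat \<Rightarrow> nat list \<Rightarrow> nat list" where
  "entries k [] = []"
| "entries k (b # w) = (if b = 1 then entries (Suc k) w else k # entries 0 w)"

fun precedes :: "nat \<Rightarrow> nat \<Rightarrow> nat list \<Rightarrow> bool" where
  "precedes u v [] = False"
| "precedes u v (e # l) = (e = u \<or> e \<noteq> v \<and> precedes u v l)"

lemma found_entries: "found u v k w = precedes u v (entries k w)"
  by (induction w arbitrary: k) auto

text \<open>An unlisted vertex gets the length of the list and thus ranks above all listed ones;
  this is why sinks can be left out of the list.\<close>

definition rank_in :: "nat list \<Rightarrow> nat \<Rightarrow> nat" where
  "rank_in l u = length (takeWhile (\<lambda>e. e \<noteq> u) l)"

lemma precedes_rank: "precedes u v l \<Longrightarrow> u \<noteq> v \<Longrightarrow> rank_in l u < rank_in l v"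
  by (induction l) (auto simp: rank_in_def)

lemma entries_unary: "entries k (unary j @ w) = entries (k + j) w"
  by (induction j arbitrary: k) (auto simp: unary_def)

lemma entries_concat: "entries 0 (concat (map (\<lambda>k. unary k @ [0]) l) @ w) = l @ entries 0 w"
  by (induction l) (auto simp: entries_unary)

text \<open>Put an element of \<open>U\<close> first that is minimal for \<open>R\<close>. No pair
  with left component in \<open>U\<close> has it on the right, so placing it in front spoils none of
  the conditions for the remaining list.\<close>

lemma topological_list:
  assumes "finite U" "wf R"
  shows "\<exists>l. distinct l \<and> set l = U \<and> (\<forall>(u, v) \<in> R. u \<in> U \<longrightarrow> precedes u v l)"
  using assms(1)
proof (induction "card U" arbitrary: U)
  case 0
  then show ?case by (intro exI[of _ "[]"]) auto
next
  case (Suc n)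
  then obtain x where "x \<in> U" by force
  from wfE_min[OF assms(2) this] obtain u0 where u0: "u0 \<in> U" "\<And>y. (y, u0) \<in> R \<Longrightarrow> y \<notin> U" by blast
  have "\<exists>l. distinct l \<and> set l = U - {u0} \<and> (\<forall>(u, v) \<in> R. u \<in> U - {u0} \<longrightarrow> precedes u v l)"
    by (rule Suc.hyps(1)) (use Suc u0 in auto)
  then obtain l where l: "distinct l" "set l = U - {u0}" "\<forall>(u, v) \<in> R. u \<in> U - {u0} \<longrightarrow> precedes u v l" by blast
  show ?case
    by (rule exI[of _ "u0 # l"]) (use l u0 in auto)
qed

text \<open>Charge each tail to one of its arcs, whose encoding contains \<open>u\<close> ones and
  more; further arcs with the same tail add nothing on the left, where the sum runs over a
  set.\<close>

lemma sum_image_le: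
  "(\<Sum>u\<in>fst ` set es. Suc u) \<le> length (concat (map encode_arc es))"
proof (induction es)
  case (Cons e es)
  have "(\<Sum>u\<in>fst ` set (e # es). Suc u) \<le> Suc (fst e) + (\<Sum>u\<in>fst ` set es. Suc u)"
    by (cases "fst e \<in> fst ` set es") (auto simp: insert_absorb)
  also have "Suc (fst e) \<le> length (encode_arc e)"
    by (cases e) (simp add: encode_arc_def unary_def)
  finally show ?case using Cons by simp
qed simp

subsection \<open>Walks in labelled graphs\<close>

lemma ldigraph_simps [simp]:
  "verts (ldigraph V E) = V" "arcs (ldigraph V E) = E"
  "tail (ldigraph V E) e = fst e" "head (ldigraph V E) e = snd (snd e)"
  by (auto simp: ldigraph_def case_prod_beta)

lemma yield_simps [simp]: "yield [] = []" "yield (e # p) = fst (snd e) # yield p" "yield (p @ q) = yield p @ yield q"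
  by (auto simp: yield_def case_prod_beta)

text \<open>Ranks increase strictly along the arcs, so no vertex recurs. This both excludes cycles
  and makes every walk an \<open>apath\<close>.\<close>

lemma ranked_walk:
  assumes "\<And>e. e \<in> E \<Longrightarrow> (r :: nat \<Rightarrow> nat) (fst e) < r (snd (snd e))"
    and "pre_digraph.cas (ldigraph V E) u p v" "set p \<subseteq> E"
  shows "distinct (pre_digraph.awalk_verts (ldigraph V E) u p) \<and>
    (\<forall>x\<in>set (pre_digraph.awalk_verts (ldigraph V E) u p). r u \<le> r x) \<and> (p \<noteq> [] \<longrightarrow> r u < r v)"
  using assms(2,3)
proof (induction p arbitrary: u)
  case Nil
  then show ?case by (simp add: pre_digraph.awalk_verts.simps)
next
  case (Cons e p)
  have e: "fst e = u" "pre_digraph.cas (ldigraph V E) (snd (snd e)) p v" "r u < r (snd (snd e))"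
    using Cons.prems assms(1)[of e] by (auto simp: pre_digraph.cas.simps)
  have IH: "distinct (pre_digraph.awalk_verts (ldigraph V E) (snd (snd e)) p)"
    "\<And>x. x \<in> set (pre_digraph.awalk_verts (ldigraph V E) (snd (snd e)) p) \<Longrightarrow> r (snd (snd e)) \<le> r x"
    "p \<noteq> [] \<Longrightarrow> r (snd (snd e)) < r v"
    using Cons.IH[OF e(2)] Cons.prems(2) by auto
  have "p = [] \<Longrightarrow> snd (snd e) = v" using e(2) by (simp add: pre_digraph.cas.simps)
  then have "r u < r v" using IH(3) e(3) by (cases "p = []") auto
  moreover have "r u < r x" if "x \<in> set (pre_digraph.awalk_verts (ldigraph V E) (snd (snd e)) p)" for x
    using IH(2)[OF that] e(3) by simp
  ultimately show ?case using IH(1) e(1)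
    by (auto simp: pre_digraph.awalk_verts.simps intro: less_imp_le)
qed

lemma ranked_no_cycle:
  assumes "\<And>e. e \<in> E \<Longrightarrow> (r :: nat \<Rightarrow> nat) (fst e) < r (snd (snd e))"
  shows "\<nexists>p. pre_digraph.cycle (ldigraph V E) p"
  using ranked_walk[OF assms]
  by (fastforce simp: pre_digraph.cycle_def pre_digraph.awalk_def)

lemma ranked_apath:
  assumes "\<And>e. e \<in> E \<Longrightarrow> (r :: nat \<Rightarrow> nat) (fst e) < r (snd (snd e))"
    and "pre_digraph.cas (ldigraph V E) u p v" "set p \<subseteq> E" "u \<in> V"
  shows "pre_digraph.apath (ldigraph V E) u p v"
  using ranked_walk[OF assms(1-3)] assms by (simp add: pre_digraph.apath_def pre_digraph.awalk_def)

text \<open>Pairs in the transitive closure come from nonempty walks, and a closed walk contains a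
  cycle. By finiteness acyclicity becomes well-foundedness, the source of the minimal elements in
  \<open>topological_list\<close>.\<close>

lemma acyclic_wf:
  assumes "finite V" "E \<subseteq> V \<times> \<Sigma> \<times> V" "finite E" "\<nexists>p. pre_digraph.cycle (ldigraph V E) p"
  shows "wf ((\<lambda>(u, a, v). (u, v)) ` E)"
proof -
  let ?G = "ldigraph V E" and ?R = "(\<lambda>(u, a, v). (u, v)) ` E"
  interpret wf_digraph ?G by unfold_locales (use assms(2) in auto)
  have "\<exists>p. awalk u p v \<and> p \<noteq> []" if "(u, v) \<in> ?R\<^sup>+" for u v
    using that
  proof (induction rule: trancl_induct)
    case (base v)
    then obtain a where "(u, a, v) \<in> E" by auto
    then have "awalk u [(u, a, v)] v" using assms(2) by (auto simp: awalk_def cas.simps)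
    then show ?case by blast
  next
    case (step v x)
    then obtain p a where p: "awalk u p v" "p \<noteq> []" "(v, a, x) \<in> E" by auto
    then have "awalk v [(v, a, x)] x" using assms(2) by (auto simp: awalk_def cas.simps)
    then show ?case using p awalk_appendI by (metis Nil_is_append_conv)
  qed
  then have "acyclic ?R"
    using assms(4) closed_w_imp_cycle unfolding acyclic_def closed_w_def by (metis length_greater_0_conv)
  then show ?thesis using assms(3) by (intro finite_acyclic_wf) auto
qed

subsection \<open>Soundness\<close>

lemma ones_eq_unary: "\<forall>x\<in>set xs. x div 4 = 1 \<Longrightarrow> map (\<lambda>v. v div 4) xs = unary (length xs)"
  unfolding unary_def by (induction xs) auto

lemma check_arcs_sound:
  assumes "check_arcs n w zs = Some ems"
  shows "map (\<lambda>v. v div 4) zs = concat (map (\<lambda>e. encode_arc (fst e)) ems) \<and>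
    (\<forall>((u, a, v), mk)\<in>set ems. u < n \<and> v < n \<and> u \<noteq> v \<and> found u v 0 w)"
  using assms
proof (induction "length zs" arbitrary: zs ems rule: less_induct)
  case less
  show ?case
  proof (cases "zs = []")
    case True
    then show ?thesis using less.prems by (simp add: check_arcs.simps)
  next
    case False
    from less.prems False obtain xs c ys c' r ems' where d: "zs = xs @ c # ys @ c' # r"
      "\<forall>x\<in>set xs. x div 4 = 1" "\<forall>x\<in>set ys. x div 4 = 1"
      "c div 4 \<ge> 2" "c' div 4 = 0" "length xs < n" "length ys < n" "length xs \<noteq> length ys"
      "found (length xs) (length ys) 0 w" "check_arcs n w r = Some ems'"
      "ems = ((length xs, c div 4 - 2, length ys), c mod 4 \<ge> 2) # ems'"
      by (rule check_arcs_Cons)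
    have "length r < length zs" by (simp add: d(1))
    from less.hyps[OF this d(10)] d show ?thesis
      by (auto simp: encode_arc_def ones_eq_unary)
  qed
qed

lemma walk_step_path:
  assumes "\<exists>p. pre_digraph.cas G s p c \<and> set p \<subseteq> E \<and> yield p = y" "fst em \<in> E"
    and "G = ldigraph V E" "walk_step (c, y) em = (c', y')"
  shows "\<exists>p. pre_digraph.cas G s p c' \<and> set p \<subseteq> E \<and> yield p = y'"
proof -
  obtain p where p: "pre_digraph.cas G s p c" "set p \<subseteq> E" "yield p = y" using assms(1) by blast
  obtain u a v mk where em: "em = ((u, a, v), mk)" by (metis surj_pair)
  show ?thesis
  proof (cases "mk \<and> u = c")
    case True
    have "pre_digraph.cas G s (p @ [(u, a, v)]) v"
      using p(1) True assms(3)
    proof (induction p arbitrary: s)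
      case Nil
      then show ?case by (simp add: pre_digraph.cas.simps)
    next
      case (Cons e p)
      then show ?case by (simp add: pre_digraph.cas.simps)
    qed
    then show ?thesis using p True assms(2,4) em by (intro exI[of _ "p @ [(u, a, v)]"]) auto
  next
    case False
    then show ?thesis using assms(4) em p by (intro exI[of _ p]) auto
  qed
qed

text \<open>However the marks are placed, each state of the walk is witnessed by a real walk from
  \<open>s\<close>; that it repeats no vertex is left to the ranks.\<close>

lemma walk_path:
  assumes "fst ` set ems \<subseteq> E" "G = ldigraph V E" "walk ems k (s, []) = (c, y)"
  shows "\<exists>p. pre_digraph.cas G s p c \<and> set p \<subseteq> E \<and> yield p = y"
proof -
  have fold: "\<exists>p. pre_digraph.cas G s p (fst (foldl walk_step cy ems')) \<and> set p \<subseteq> E \<and> yield p = snd (foldl walk_step cy ems')"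
    if "\<exists>p. pre_digraph.cas G s p (fst cy) \<and> set p \<subseteq> E \<and> yield p = snd cy" "fst ` set ems' \<subseteq> E" for ems' cy
    using that
  proof (induction ems' arbitrary: cy)
    case (Cons em ems')
    obtain c1 y1 where 1: "walk_step cy em = (c1, y1)" by fastforce
    have "\<exists>p. pre_digraph.cas G s p c1 \<and> set p \<subseteq> E \<and> yield p = y1"
      using walk_step_path[OF _ _ assms(2), of s "fst cy" "snd cy" em c1 y1] Cons.prems 1 by simp
    then show ?case using Cons.IH[of "(c1, y1)"] Cons.prems 1 by simp
  qed simp
  have "\<exists>p. pre_digraph.cas G s p (fst (walk ems k (s, []))) \<and> set p \<subseteq> E \<and> yield p = snd (walk ems k (s, []))"
  proof (induction k)
    case 0
    show ?case by (intro exI[of _ "[]"]) (simp add: walk_def pre_digraph.cas.simps)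
  next
    case (Suc k)
    then show ?case using fold[OF Suc assms(1)] by (simp add: walk_def)
  qed
  then show ?thesis using assms(3) by simp
qed

lemma verify_sound:
  assumes v: "verify z = Some y" and y: "y \<in> L" and z: "map (\<lambda>v. v div 4) z \<in> lists ({0, 1} \<union> (\<lambda>a. a + 2) ` \<Sigma>)"
  shows "map (\<lambda>v. v div 4) z \<in> snd (DAGREACH (\<Sigma>, L))"
proof -
  let ?d = "\<lambda>v :: nat. v div 4" and ?n = "ones z"
  obtain xs where xs: "z = xs @ after z" "length xs = ?n" "\<forall>x\<in>set xs. x div 4 = 1" using ones_after by blast
  from v obtain c0 r0 where 0: "after z = c0 # r0" "c0 div 4 = 0"
    by (auto simp: verify_def split: list.splits if_splits)
  from v 0 obtain s c1 r1 where 1: "block (\<lambda>d. d = 0) ?n r0 = Some (s, c1, r1)"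
    by (auto simp: verify_def split: option.splits)
  from v 0 1 obtain t c2 r2 where 2: "block (\<lambda>d. d = 0) ?n r1 = Some (t, c2, r2)"
    by (auto simp: verify_def split: option.splits)
  from v 0 1 2 obtain ems where 3: "check_arcs ?n (map (\<lambda>v. v mod 2) z) r2 = Some ems"
    "walk ems ?n (s, []) = (t, y)"
    by (auto simp: verify_def split: option.splits prod.splits if_splits)
  obtain xs1 where 4: "r0 = xs1 @ c1 # r1" "length xs1 = s" "\<forall>x\<in>set xs1. x div 4 = 1" "s < ?n" "c1 div 4 = 0"
    using block_SomeD[OF 1] by blast
  obtain xs2 where 5: "r1 = xs2 @ c2 # r2" "length xs2 = t" "\<forall>x\<in>set xs2. x div 4 = 1" "t < ?n" "c2 div 4 = 0"
    using block_SomeD[OF 2] by blast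
  define w where "w = map (\<lambda>v. v mod 2) z"
  note cs = check_arcs_sound[OF 3(1), folded w_def]
  define es where "es = map fst ems"
  have zz: "z = xs @ c0 # xs1 @ c1 # xs2 @ c2 # r2" using xs(1) 0(1) 4(1) 5(1) by simp
  have enc: "map ?d z = encode ?n es s t"
    by (subst zz) (use cs in \<open>simp add: encode_def es_def ones_eq_unary[OF xs(3)] ones_eq_unary[OF 4(3)]
        ones_eq_unary[OF 5(3)] xs(2) 4(2,5) 5(2,5) 0(2) comp_def\<close>)
  let ?E = "set es" and ?V = "{..<?n}"
  have E: "?E \<subseteq> ?V \<times> \<Sigma> \<times> ?V"
  proof
    fix e assume e: "e \<in> ?E"
    obtain u a v' where ee: "e = (u, a, v')" by (cases e)
    obtain mk where mk: "((u, a, v'), mk) \<in> set ems" using e ee by (auto simp: es_def)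
    have "a \<in> \<Sigma>"
    proof -
      obtain c where c: "c \<in> set r2" "c div 4 \<ge> 2" "a = c div 4 - 2" using labels_check_arcs[OF 3(1) mk] by blast
      have "c \<in> set z" using c(1) by (subst zz) simp
      then have "c div 4 \<in> {0, 1} \<union> (\<lambda>a. a + 2) ` \<Sigma>" using z unfolding in_lists_conv_set set_map by blast
      then show ?thesis using c(2,3) by (elim UnE imageE) auto
    qed
    then show "e \<in> ?V \<times> \<Sigma> \<times> ?V" using cs mk ee by fastforce
  qed
  \<comment> \<open>The certified list becomes a rank that increases along every arc, which yields
    acyclicity and turns the walk found into a path.\<close>
  let ?r = "rank_in (entries 0 w)"
  have r: "?r (fst e) < ?r (snd (snd e))" if er: "e \<in> ?E" for e
  proof -
    obtain u a v' where ee: "e = (u, a, v')" by (cases e)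
    obtain mk where "((u, a, v'), mk) \<in> set ems" using er ee by (auto simp: es_def)
    then show ?thesis using cs ee by (auto simp: found_entries intro!: precedes_rank)
  qed
  obtain p where p: "pre_digraph.cas (ldigraph ?V ?E) s p t" "set p \<subseteq> ?E" "yield p = y"
    using walk_path[OF _ refl 3(2), of ?E ?V] by (auto simp: es_def)
  have "pre_digraph.apath (ldigraph ?V ?E) s p t" by (rule ranked_apath[OF r p(1,2)]) (use 4 in auto)
  then have "(ldigraph ?V ?E, s, t) \<in> dag_reach (\<Sigma>, L)"
    unfolding dag_reach_iff using E ranked_no_cycle[OF r] 4 5 p(3) y by blast
  then show ?thesis unfolding enc by (auto simp: DAGREACH_def)
qed

subsection \<open>Completeness\<close>

definition marked_arc :: "(nat \<times> nat \<times> nat) set \<Rightarrow> nat \<times> nat \<times> nat \<Rightarrow> (nat \<times> bool) list" where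
  "marked_arc P e = map (\<lambda>a. (a, False)) (unary (fst e)) @ [(fst (snd e) + 2, e \<in> P)] @
     map (\<lambda>a. (a, False)) (unary (snd (snd e))) @ [(0, False)]"

lemma map_fst_marked_arc: "map fst (marked_arc P e) = encode_arc e"
  by (cases e) (simp add: marked_arc_def encode_arc_def comp_def)

lemma exists_annotation:
  fixes ams :: "(nat \<times> bool) list" and w :: "nat list"
  shows "length ams = length w \<Longrightarrow> set w \<subseteq> {0, 1} \<Longrightarrow>
    \<exists>z. map (\<lambda>v. (v div 4, v mod 4 \<ge> 2)) z = ams \<and> map (\<lambda>v. v mod 2) z = w"
proof (induction ams w rule: list_induct2)
  case (Cons am ams b w)
  then obtain z where z: "map (\<lambda>v. (v div 4, v mod 4 \<ge> 2)) z = ams" "map (\<lambda>v. v mod 2) z = w" by auto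
  obtain a mk where am: "am = (a, mk)" by (cases am)
  \<comment> \<open>Letter, mark and order bit are recovered as \<open>v div 4\<close>,
    \<open>v mod 4 \<ge> 2\<close> and \<open>v mod 2\<close>.\<close>
  define v where "v = 4 * a + (2 * of_bool mk + b)"
  have "2 * of_bool mk + b < 4" "b < 2" using Cons.prems by auto
  then have "v div 4 = a" "v mod 4 = 2 * of_bool mk + b" by (simp_all add: v_def)
  moreover have "v mod 2 = b"
  proof -
    have "v = 2 * (2 * a + of_bool mk) + b" by (simp add: v_def)
    then show ?thesis using \<open>b < 2\<close> by (metis mod_less mod_mult_self4)
  qed
  ultimately show ?case using z am Cons.prems by (intro exI[of _ "v # z"]) auto
qed simp

lemma map_eq_append_ConsE:
  assumes "map f zs = as @ b # bs"
  obtains xs c r where "zs = xs @ c # r" "map f xs = as" "f c = b" "map f r = bs"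
  using assms by (auto simp: map_eq_append_conv map_eq_Cons_conv)

lemma check_arcs_complete:
  assumes "map (\<lambda>v. (v div 4, v mod 4 \<ge> 2)) zs = concat (map (marked_arc P) es)"
    and "\<forall>(u, a, v)\<in>set es. u < n \<and> v < n \<and> u \<noteq> v \<and> found u v 0 w"
  shows "check_arcs n w zs = Some (map (\<lambda>e. (e, e \<in> P)) es)"
  using assms
proof (induction es arbitrary: zs)
  case Nil
  then show ?case by (simp add: check_arcs.simps)
next
  case (Cons e es)
  obtain u a v where e: "e = (u, a, v)" by (cases e)
  let ?f = "\<lambda>v :: nat. (v div 4, v mod 4 \<ge> 2)"
  have "marked_arc P e = map (\<lambda>a. (a, False)) (unary u) @ (a + 2, e \<in> P) # map (\<lambda>a. (a, False)) (unary v) @ [(0, False)]"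
    by (simp add: marked_arc_def e)
  then have "map ?f zs = map (\<lambda>a. (a, False)) (unary u) @ (a + 2, e \<in> P) # map (\<lambda>a. (a, False)) (unary v) @ (0, False) #
      concat (map (marked_arc P) es)"
    using Cons.prems(1) by simp
  then obtain xs c r0 where 0: "zs = xs @ c # r0" "map ?f xs = map (\<lambda>a. (a, False)) (unary u)" "?f c = (a + 2, e \<in> P)"
    "map ?f r0 = map (\<lambda>a. (a, False)) (unary v) @ (0, False) # concat (map (marked_arc P) es)"
    by (rule map_eq_append_ConsE)
  obtain ys c' r where 1: "r0 = ys @ c' # r" "map ?f ys = map (\<lambda>a. (a, False)) (unary v)" "?f c' = (0, False)"
    "map ?f r = concat (map (marked_arc P) es)"
    using 0(4) by (rule map_eq_append_ConsE)
  have zs: "zs = xs @ c # ys @ c' # r"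
    and m: "map ?f xs = map (\<lambda>a. (a, False)) (unary u)" "?f c = (a + 2, e \<in> P)" "map ?f ys = map (\<lambda>a. (a, False)) (unary v)"
      "?f c' = (0, False)" "map ?f r = concat (map (marked_arc P) es)"
    by (rule 0(1)[unfolded 1(1)], (rule 0 1)+)
  have one: "length xs = u \<and> (\<forall>x\<in>set xs. x div 4 = 1)" if "map ?f xs = map (\<lambda>a. (a, False)) (unary u)" for xs u
  proof
    show "length xs = u" using map_eq_imp_length_eq[OF that] by (simp add: unary_def)
    have "set (map ?f xs) \<subseteq> {(1, False)}" unfolding that by (auto simp: unary_def)
    then show "\<forall>x\<in>set xs. x div 4 = 1" by auto
  qed
  have uv: "u < n" "v < n" "u \<noteq> v" "found u v 0 w" using Cons.prems(2) e by auto
  have "block (\<lambda>d. d \<ge> 2) n zs = Some (length xs, c, ys @ c' # r)"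
    by (rule block_eqI[OF zs]) (use one[OF m(1)] m(2) uv in auto)
  moreover have "block (\<lambda>d. d = 0) n (ys @ c' # r) = Some (length ys, c', r)"
    by (rule block_eqI[OF refl]) (use one[OF m(3)] m(4) uv in auto)
  moreover have "check_arcs n w r = Some (map (\<lambda>e. (e, e \<in> P)) es)"
    by (rule Cons.IH[OF m(5)]) (use Cons.prems(2) in auto)
  moreover have "zs \<noteq> []" by (simp add: zs)
  moreover have "length xs = u" "length ys = v" using one m by blast+
  moreover have "c div 4 - 2 = a" "(c mod 4 \<ge> 2) = (e \<in> P)" using m(2) by auto
  ultimately show ?case using uv by (subst check_arcs.simps) (simp add: e)
qed

text \<open>With distinct vertices, \<open>p ! i\<close> is the only marked arc leaving
  \<open>vs ! i\<close>, so a pass never strays from the path. It meets \<open>p ! i\<close>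
  somewhere in the list and so advances by at least one arc until the end is reached.\<close>

lemma walk_complete:
  assumes apath: "pre_digraph.apath (ldigraph V E) s p t" and es: "set p \<subseteq> set es" and k: "length p \<le> k"
  shows "walk (map (\<lambda>e. (e, e \<in> set p)) es) k (s, []) = (t, yield p)"
proof -
  let ?G = "ldigraph V E"
  define vs where "vs = pre_digraph.awalk_verts ?G s p"
  have cas: "pre_digraph.cas ?G s p t" and dist: "distinct vs"
    using apath by (auto simp: pre_digraph.apath_def pre_digraph.awalk_def vs_def)
  have "length vs = Suc (length p) \<and> vs ! 0 = s \<and> vs ! length p = t \<and>
      (\<forall>i<length p. fst (p ! i) = vs ! i \<and> snd (snd (p ! i)) = vs ! Suc i)"
    unfolding vs_def using cas
  proof (induction p arbitrary: s)
    case Nil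
    then show ?case by (simp add: pre_digraph.awalk_verts.simps pre_digraph.cas.simps)
  next
    case (Cons e p)
    have c: "fst e = s" "pre_digraph.cas ?G (snd (snd e)) p t"
      using Cons.prems by (auto simp: pre_digraph.cas.simps)
    from Cons.IH[OF c(2)] c(1) show ?case
      by (auto simp: pre_digraph.awalk_verts.simps nth_Cons split: nat.split)
  qed
  then have len: "length vs = Suc (length p)" and vs: "vs ! 0 = s" "vs ! length p = t"
      "\<And>i. i < length p \<Longrightarrow> fst (p ! i) = vs ! i" "\<And>i. i < length p \<Longrightarrow> snd (snd (p ! i)) = vs ! Suc i"
    by auto
  define st where "st i = (vs ! i, yield (take i p))" for i
  have stp: "walk_step (st i) (e, e \<in> set p) = (if i < length p \<and> e = p ! i then st (Suc i) else st i)"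
    if i: "i \<le> length p" for i e
  proof -
    obtain u a v where e: "e = (u, a, v)" by (cases e)
    have "e \<in> set p \<and> u = vs ! i \<longleftrightarrow> i < length p \<and> e = p ! i"
    proof
      assume a: "e \<in> set p \<and> u = vs ! i"
      then obtain j where j: "j < length p" "e = p ! j" by (auto simp: in_set_conv_nth)
      have "fst (p ! j) = u" by (simp add: j(2)[symmetric] e)
      then have "vs ! j = vs ! i" using vs(3)[OF j(1)] a by simp
      then have "j = i" using dist len i j(1) by (simp add: nth_eq_iff_index_eq)
      then show "i < length p \<and> e = p ! i" using j by simp
    next
      assume a: "i < length p \<and> e = p ! i"
      then have "fst e = vs ! i" using vs(3)[of i] by simp
      then show "e \<in> set p \<and> u = vs ! i" using a by (auto simp: e)
    qed
    moreover have "st (Suc i) = (v, yield (take i p) @ [a])" if "i < length p" "e = p ! i"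
    proof -
      have "snd (snd e) = vs ! Suc i" using that vs(4)[of i] by simp
      then show ?thesis using that(1) by (simp add: st_def take_Suc_conv_app_nth that(2)[symmetric] e)
    qed
    ultimately show ?thesis by (auto simp: st_def e)
  qed
  have fold: "\<exists>j. i \<le> j \<and> j \<le> length p \<and> foldl walk_step (st i) (map (\<lambda>e. (e, e \<in> set p)) es') = st j \<and>
      (i < length p \<and> p ! i \<in> set es' \<longrightarrow> i < j)" if "i \<le> length p" for i es'
    using that
  proof (induction es' arbitrary: i)
    case (Cons e es')
    show ?case
    proof (cases "i < length p \<and> e = p ! i")
      case True
      then obtain j where "Suc i \<le> j" "j \<le> length p" "foldl walk_step (st (Suc i)) (map (\<lambda>e. (e, e \<in> set p)) es') = st j"
        using Cons.IH[of "Suc i"] by auto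
      then show ?thesis using True stp[OF Cons.prems, of e] by (intro exI[of _ j]) auto
    next
      case False
      obtain j where "i \<le> j" "j \<le> length p" "foldl walk_step (st i) (map (\<lambda>e. (e, e \<in> set p)) es') = st j"
        "i < length p \<and> p ! i \<in> set es' \<longrightarrow> i < j"
        using Cons.IH[OF Cons.prems] by auto
      then show ?thesis using False stp[OF Cons.prems, of e] by (intro exI[of _ j]) auto
    qed
  qed auto
  have "\<exists>j. min k (length p) \<le> j \<and> j \<le> length p \<and> walk (map (\<lambda>e. (e, e \<in> set p)) es) k (st 0) = st j" for k
  proof (induction k)
    case 0
    show ?case by (intro exI[of _ 0]) (simp add: walk_def)
  next
    case (Suc k)
    then obtain i where i: "min k (length p) \<le> i" "i \<le> length p" "walk (map (\<lambda>e. (e, e \<in> set p)) es) k (st 0) = st i" by blast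
    obtain j where j: "i \<le> j" "j \<le> length p" "foldl walk_step (st i) (map (\<lambda>e. (e, e \<in> set p)) es) = st j"
      "i < length p \<and> p ! i \<in> set es \<longrightarrow> i < j" using fold[OF i(2)] by blast
    have "i < length p \<longrightarrow> i < j" using j(4) es by auto
    then have "min (Suc k) (length p) \<le> j" using i(1) j(1) by auto
    moreover have "walk (map (\<lambda>e. (e, e \<in> set p)) es) (Suc k) (st 0) = st j"
      using i(3) j(3) by (simp add: walk_def)
    ultimately show ?case using j(2) by blast
  qed
  from this[of k] have "walk (map (\<lambda>e. (e, e \<in> set p)) es) k (st 0) = st (length p)"
    using k by auto
  then show ?thesis by (simp add: st_def vs)
qed

lemma verify_complete:
  assumes "x \<in> snd (DAGREACH (\<Sigma>, L))"
  shows "\<exists>z. map (\<lambda>v. v div 4) z = x \<and> (\<exists>y\<in>L. verify z = Some y)"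
proof -
  obtain n es s t where x: "x = encode n es s t" and "(ldigraph {..<n} (set es), s, t) \<in> dag_reach (\<Sigma>, L)"
    using assms by (auto simp: DAGREACH_def)
  then obtain p where E: "set es \<subseteq> {..<n} \<times> \<Sigma> \<times> {..<n}" and acyc: "\<nexists>p. pre_digraph.cycle (ldigraph {..<n} (set es)) p"
    and st: "s < n" "t < n" and p: "pre_digraph.apath (ldigraph {..<n} (set es)) s p t" "yield p \<in> L"
    unfolding dag_reach_iff by auto
  let ?G = "ldigraph {..<n} (set es)" and ?R = "(\<lambda>(u, a, v). (u, v)) ` set es"
  have wf: "wf ?R" by (rule acyclic_wf[OF _ E _ acyc]) auto
  obtain l where l: "distinct l" "set l = fst ` set es" "\<forall>(u, v) \<in> ?R. u \<in> fst ` set es \<longrightarrow> precedes u v l"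
    using topological_list[OF _ wf, of "fst ` set es"] by auto
  let ?w0 = "concat (map (\<lambda>k. unary k @ [0]) l)"
  have "length ?w0 = (\<Sum>u\<in>set l. Suc u)"
    using l(1) by (simp add: length_concat comp_def unary_def sum_list_distinct_conv_sum_set)
  also have "\<dots> \<le> length (concat (map encode_arc es))" unfolding l(2) by (rule sum_image_le)
  also have "\<dots> \<le> length x" by (simp add: x encode_def)
  finally have lw: "length ?w0 \<le> length x" .
  \<comment> \<open>Padding with ones, which \<open>entries\<close> drops, gives one order bit per
    letter of \<open>x\<close>.\<close>
  define w where "w = ?w0 @ unary (length x - length ?w0)"
  have w: "length w = length x" "set w \<subseteq> {0, 1}" using lw by (auto simp: w_def unary_def)
  have ent: "entries 0 w = l"
  proof -
    have "entries 0 (unary j) = []" for j using entries_unary[of 0 j "[]"] by simp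
    then show ?thesis by (simp add: w_def entries_concat)
  qed
  have arcs: "\<forall>(u, a, v)\<in>set es. u < n \<and> v < n \<and> u \<noteq> v \<and> found u v 0 w"
  proof clarify
    fix u a v assume e: "(u, a, v) \<in> set es"
    then have r: "(u, v) \<in> ?R" by force
    have "(u, u) \<notin> ?R" by (rule wf_not_refl[OF wf])
    then have "u \<noteq> v" using r by metis
    moreover have "precedes u v l" using l(3) r e by force
    ultimately show "u < n \<and> v < n \<and> u \<noteq> v \<and> found u v 0 w" using E e by (auto simp: found_entries ent)
  qed
  define P where "P = set p"
  let ?un = "\<lambda>k. map (\<lambda>a. (a, False)) (unary k)"
  define ams where "ams = ?un n @ (0, False) # ?un s @ (0, False) # ?un t @ (0, False) # concat (map (marked_arc P) es)"
  have mf: "map fst ams = x"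
    by (simp add: ams_def x encode_def comp_def map_concat map_fst_marked_arc)
  then have "length ams = length w" using w(1) by (metis length_map)
  from exists_annotation[OF this w(2)] obtain z where
    z: "map (\<lambda>v. (v div 4, v mod 4 \<ge> 2)) z = ams" "map (\<lambda>v. v mod 2) z = w" by blast
  have dz: "map (\<lambda>v. v div 4) z = x" using mf unfolding z(1)[symmetric] by (simp add: comp_def)
  let ?f = "\<lambda>v :: nat. (v div 4, v mod 4 \<ge> 2)"
  obtain xs c0 q0 where q0: "z = xs @ c0 # q0" "map ?f xs = ?un n" "?f c0 = (0, False)"
    "map ?f q0 = ?un s @ (0, False) # ?un t @ (0, False) # concat (map (marked_arc P) es)"
    using z(1)[unfolded ams_def] by (rule map_eq_append_ConsE)
  obtain xs1 c1 q1 where q1: "q0 = xs1 @ c1 # q1" "map ?f xs1 = ?un s" "?f c1 = (0, False)"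
    "map ?f q1 = ?un t @ (0, False) # concat (map (marked_arc P) es)"
    using q0(4) by (rule map_eq_append_ConsE)
  obtain xs2 c2 r2 where q2: "q1 = xs2 @ c2 # r2" "map ?f xs2 = ?un t" "?f c2 = (0, False)"
    "map ?f r2 = concat (map (marked_arc P) es)"
    using q1(4) by (rule map_eq_append_ConsE)
  have zz: "z = xs @ c0 # xs1 @ c1 # xs2 @ c2 # r2"
    and m: "map ?f xs = ?un n" "?f c0 = (0, False)" "map ?f xs1 = ?un s" "?f c1 = (0, False)" "map ?f xs2 = ?un t"
      "?f c2 = (0, False)" "map ?f r2 = concat (map (marked_arc P) es)"
    by (rule q0(1)[unfolded q1(1) q2(1)], (rule q0 q1 q2)+)
  have one: "length xs = u \<and> (\<forall>x\<in>set xs. x div 4 = 1)" if "map ?f xs = ?un u" for xs u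
  proof
    show "length xs = u" using map_eq_imp_length_eq[OF that] by (simp add: unary_def)
    have "set (map ?f xs) \<subseteq> {(1, False)}" unfolding that by (auto simp: unary_def)
    then show "\<forall>x\<in>set xs. x div 4 = 1" by auto
  qed
  have "takeWhile (\<lambda>v. v div 4 = 1) z = xs" "dropWhile (\<lambda>v. v div 4 = 1) z = c0 # xs1 @ c1 # xs2 @ c2 # r2"
    using one[OF m(1)] m(2) unfolding zz by (simp_all add: takeWhile_append dropWhile_append)
  then have 0: "ones z = n" "after z = c0 # xs1 @ c1 # xs2 @ c2 # r2" using one[OF m(1)] by (simp_all add: ones_def after_def)
  have 1: "block (\<lambda>d. d = 0) n (xs1 @ c1 # xs2 @ c2 # r2) = Some (s, c1, xs2 @ c2 # r2)"
    using block_eqI[OF refl, of xs1 n "\<lambda>d. d = 0" c1 "xs2 @ c2 # r2"] one[OF m(3)] m(4) st by simp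
  have 2: "block (\<lambda>d. d = 0) n (xs2 @ c2 # r2) = Some (t, c2, r2)"
    using block_eqI[OF refl, of xs2 n "\<lambda>d. d = 0" c2 r2] one[OF m(5)] m(6) st by simp
  have 3: "check_arcs n w r2 = Some (map (\<lambda>e. (e, e \<in> P)) es)"
    by (rule check_arcs_complete[OF m(7) arcs])
  have "set p \<subseteq> set es" using p(1) by (auto simp: pre_digraph.apath_def pre_digraph.awalk_def)
  \<comment> \<open>The \<open>length p + 1\<close> vertices of the path are distinct and below
    \<open>n\<close>, so \<open>n\<close> passes are enough.\<close>
  moreover have "length p \<le> n"
  proof -
    let ?vs = "pre_digraph.awalk_verts ?G s p"
    interpret wf_digraph ?G by unfold_locales (use E in auto)
    have "distinct ?vs" "set ?vs \<subseteq> {..<n}" using p(1) awalk_verts_in_verts by (auto simp: apath_def awalk_def)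
    then have "length ?vs \<le> n" using card_mono[of "{..<n}" "set ?vs"] by (simp add: distinct_card)
    then show ?thesis by (simp add: length_awalk_verts)
  qed
  ultimately have 4: "walk (map (\<lambda>e. (e, e \<in> P)) es) n (s, []) = (t, yield p)"
    unfolding P_def by (intro walk_complete[OF p(1)])
  have "c0 div 4 = 0" using m(2) by simp
  then have "verify z = Some (yield p)"
    by (simp add: verify_def 0 1 2 3 4 z(2))
  then show ?thesis using dz p(2) by blast
qed

section \<open>From certificates to the two inclusions\<close>

lemma DAGREACH_projection:
  assumes "L \<subseteq> lists \<Sigma>" "finite \<Sigma>"
  defines "\<Sigma>' \<equiv> {0, 1} \<union> (\<lambda>a. a + 2) ` \<Sigma>"
  shows "DAGREACH (\<Sigma>, L) = (\<Sigma>', {x \<in> lists \<Sigma>'. \<exists>z\<in>{z \<in> lists (annotated \<Sigma>'). \<exists>y\<in>L. verify z = Some y}.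
    map (\<lambda>v. v div 4) z = x})"
proof -
  have sub: "snd (DAGREACH (\<Sigma>, L)) \<subseteq> lists \<Sigma>'"
    using is_language_DAGREACH[of \<Sigma> L] assms by (simp add: is_language_def DAGREACH_def)
  have "snd (DAGREACH (\<Sigma>, L)) = {x \<in> lists \<Sigma>'. \<exists>z\<in>{z \<in> lists (annotated \<Sigma>'). \<exists>y\<in>L. verify z = Some y}.
    map (\<lambda>v. v div 4) z = x}"
  proof (intro equalityI subsetI)
    fix x assume x: "x \<in> snd (DAGREACH (\<Sigma>, L))"
    then obtain z where "map (\<lambda>v. v div 4) z = x" "\<exists>y\<in>L. verify z = Some y" using verify_complete by blast
    then show "x \<in> {x \<in> lists \<Sigma>'. \<exists>z\<in>{z \<in> lists (annotated \<Sigma>'). \<exists>y\<in>L. verify z = Some y}. map (\<lambda>v. v div 4) z = x}"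
      using sub x annotated_lists by blast
  next
    fix x assume "x \<in> {x \<in> lists \<Sigma>'. \<exists>z\<in>{z \<in> lists (annotated \<Sigma>'). \<exists>y\<in>L. verify z = Some y}. map (\<lambda>v. v div 4) z = x}"
    then show "x \<in> snd (DAGREACH (\<Sigma>, L))" using verify_sound unfolding \<Sigma>'_def by blast
  qed
  then show ?thesis by (simp add: prod_eq_iff DAGREACH_def \<Sigma>'_def)
qed

text \<open>The only arc out of vertex \<open>i\<close> is labelled \<open>x ! i\<close> and leads
  to \<open>Suc i\<close>, so every path to the last vertex spells \<open>x\<close>. Injectivity of
  \<open>encode\<close> allows passing from the word back to this very graph.\<close>

lemma path_encoding_DAGREACH:
  assumes x: "x \<in> lists \<Sigma>"
  shows "path_encoding x \<in> snd (DAGREACH (\<Sigma>, L)) \<longleftrightarrow> x \<in> L"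
proof -
  let ?m = "length x" and ?E = "set (path_arcs 0 x)" and ?V = "{..<Suc (length x)}"
  let ?G = "ldigraph ?V ?E"
  have "path_encoding x \<in> snd (DAGREACH (\<Sigma>, L)) \<longleftrightarrow> (?G, 0, ?m) \<in> dag_reach (\<Sigma>, L)"
    unfolding path_encoding_def DAGREACH_def by (auto dest: encode_inj)
  also have "\<dots> \<longleftrightarrow> x \<in> L"
  proof -
    have arc: "fst e < ?m \<and> snd (snd e) = Suc (fst e) \<and> fst (snd e) = x ! fst e" if "e \<in> ?E" for e
      using path_arcs_set[of "fst e" "fst (snd e)" "snd (snd e)" 0 x] that by auto
    have E: "?E \<subseteq> ?V \<times> \<Sigma> \<times> ?V"
    proof
      fix e assume "e \<in> ?E"
      from arc[OF this] show "e \<in> ?V \<times> \<Sigma> \<times> ?V" using x by (cases e) auto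
    qed
    have r: "id (fst e) < id (snd (snd e))" if "e \<in> ?E" for e using arc[OF that] by simp
    have y: "yield p = drop i x" if "pre_digraph.cas ?G i p ?m" "set p \<subseteq> ?E" for i p
      using that
    proof (induction p arbitrary: i)
      case Nil
      then show ?case by (simp add: pre_digraph.cas.simps)
    next
      case (Cons e p)
      then have c: "fst e = i" "pre_digraph.cas ?G (snd (snd e)) p ?m" "e \<in> ?E" by (auto simp: pre_digraph.cas.simps)
      then show ?case using Cons.IH[OF c(2)] Cons.prems arc[OF c(3)] by (simp add: Cons_nth_drop_Suc)
    qed
    have "pre_digraph.cas G i (path_arcs i xs) (i + length xs) \<and> yield (path_arcs i xs) = xs"
      if "G = ldigraph V E" for G V E i xs
      using that by (induction i xs rule: path_arcs.induct) (auto simp: pre_digraph.cas.simps)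
    from this[OF refl, of ?V ?E 0 x] have "pre_digraph.apath ?G 0 (path_arcs 0 x) ?m" "yield (path_arcs 0 x) = x"
      by (auto intro!: ranked_apath[OF r])
    moreover have "yield p = x" if "pre_digraph.apath ?G 0 p ?m" for p
      using y[of 0 p] that by (simp add: pre_digraph.apath_def pre_digraph.awalk_def)
    ultimately show ?thesis
      unfolding dag_reach_iff using E ranked_no_cycle[OF r] by auto
  qed
  finally show ?thesis .
qed

lemma DAGR_eq:
  assumes red: "\<And>\<Sigma> \<Sigma>' L C off f. (\<Sigma>', L) \<in> \<C> \<Longrightarrow> computes C off \<Sigma> \<Sigma>' f \<Longrightarrow> finite \<Sigma> \<Longrightarrow>
      (\<Sigma>, {x \<in> lists \<Sigma>. \<exists>y\<in>L. f x = Some y}) \<in> \<C>"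
    and proj: "\<And>\<Sigma> L. (annotated \<Sigma>, L) \<in> \<C> \<Longrightarrow> finite \<Sigma> \<Longrightarrow>
      (\<Sigma>, {x \<in> lists \<Sigma>. \<exists>z\<in>L. map (\<lambda>v. v div 4) z = x}) \<in> \<C>"
    and lang: "\<And>\<Sigma> L. (\<Sigma>, L) \<in> \<C> \<Longrightarrow> is_language (\<Sigma>, L)"
  shows "DAGR \<C> = \<C>"
proof (intro equalityI subsetI)
  fix SL assume "SL \<in> DAGR \<C>"
  then obtain \<Sigma> L where SL: "SL = (\<Sigma>, L)" "finite \<Sigma>" "L \<subseteq> lists \<Sigma>" "DAGREACH (\<Sigma>, L) \<in> \<C>"
    by (auto simp: DAGR_def is_language_def)
  obtain b where "computes (write_path b) 2 \<Sigma> ({0, 1} \<union> (\<lambda>a. a + 2) ` \<Sigma>) (\<lambda>x. Some (path_encoding x))"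
    using computes_path_encoding[OF SL(2)] by blast
  moreover have "({0, 1} \<union> (\<lambda>a. a + 2) ` \<Sigma>, snd (DAGREACH (\<Sigma>, L))) \<in> \<C>"
    using SL(4) by (simp add: DAGREACH_def)
  ultimately have "(\<Sigma>, {x \<in> lists \<Sigma>. \<exists>y\<in>snd (DAGREACH (\<Sigma>, L)). Some (path_encoding x) = Some y}) \<in> \<C>"
    using red SL(2) by blast
  moreover have "{x \<in> lists \<Sigma>. \<exists>y\<in>snd (DAGREACH (\<Sigma>, L)). Some (path_encoding x) = Some y} = L"
    using path_encoding_DAGREACH[of _ \<Sigma> L] SL(3) by auto
  ultimately show "SL \<in> \<C>" using SL(1) by simp
next
  fix SL assume SL: "SL \<in> \<C>"
  obtain \<Sigma> L where S: "SL = (\<Sigma>, L)" by (cases SL)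
  have il: "is_language (\<Sigma>, L)" using lang SL S by blast
  then have fin: "finite \<Sigma>" "L \<subseteq> lists \<Sigma>" by (auto simp: is_language_def)
  let ?S = "{0, 1} \<union> (\<lambda>a. a + 2) ` \<Sigma>"
  obtain b where "computes (Verify b) 7 (annotated ?S) \<Sigma> verify" using computes_verify[OF fin(1)] by blast
  then have "(annotated ?S, {z \<in> lists (annotated ?S). \<exists>y\<in>L. verify z = Some y}) \<in> \<C>"
    using red SL S finite_annotated[of ?S] fin(1) by blast
  then have "DAGREACH (\<Sigma>, L) \<in> \<C>"
    unfolding DAGREACH_projection[OF fin(2,1)] using proj fin(1) by blast
  then show "SL \<in> DAGR \<C>" using S il by (simp add: DAGR_def)
qed

theorem theorem9:
  shows "DAGR PSPACE = PSPACE \<and> DAGR NP = NP"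
proof
  show "DAGR PSPACE = PSPACE"
    by (rule DAGR_eq[OF PSPACE_reduction PSPACE_projection]) (auto simp: PSPACE_def)
  show "DAGR NP = NP"
    by (rule DAGR_eq[OF NP_reduction NP_projection]) (auto simp: NP_def)
qed

end
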